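(* Let $d\ge1$, $r,s\ge0$ and $1\le p\le\infty$. Let $g\in M^1_{r,s}$ be admissible, i.e. $\|g\|_{L^2(\mathbb{R}^d)}=1$, and let $A\in\mathrm{GL}(\mathbb{R}^{2d})$. Then there exists $c>0$ such that the lattice $\Lambda=cA\mathbb{Z}^{2d}\subset\mathbb{R}^d\times\mathbb{R}^d$ induces the Banach (Gabor) frame $(M_\omega T_xg)_{(x,\omega)\in\Lambda}$ for $M^p_{r,s}$ with respect to the sequence space $\ell^p_{\widetilde v_{r,s}}(\Lambda)$, where $\widetilde v_{r,s}(x,\omega)=(1+|x|)^r(1+|\omega|)^s$ for $(x,\omega)\in\Lambda$.
   Context: $T_xf(t)=f(t-x)$, $M_\omega f(t)=e^{2\pi i\omega t}f(t)$ (dot product). $V_gf(x,\omega)=\langle f,M_\omega T_xg\rangle_{L^2(\mathbb{R}^d)}$ is the short-time Fourier transform. $v_{r,s}(x,\omega)=(1+|x|)^r(1+|\omega|)^s$; $L^p_{v_{r,s}}(\mathbb{R}^{2d})$ has norm $\|Fv_{r,s}\|_{L^p}$; $\ell^p_{\widetilde v}(\Lambda)$ has norm $\|(c_\lambda\widetilde v(\lambda))_{\lambda\in\Lambda}\|_{\ell^p}$. $\mathcal{A}_{v_{r,s}}=\{g\in L^2(\mathbb{R}^d):V_gg\in L^1_{v_{r,s}}(\mathbb{R}^{2d})\}$. Fix $g_0\in\mathcal{A}_{v_{r,s}}\setminus\{0\}$. $M^1_{r,s}=\{f\in L^2(\mathbb{R}^d):V_{g_0}f\in L^1_{v_{r,s}}(\mathbb{R}^{2d})\}$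 with norm $\|V_{g_0}f\|_{L^1_{v_{r,s}}}$; it is a Banach space invariant under all $M_\omega T_x$, and as a set $M^1_{r,s}=\mathcal{A}_{v_{r,s}}$. Let $\mathcal{R}_{v_{r,s}}$ be its antidual (bounded antilinear functionals), pairing $\langle f,g\rangle=f(g)$, and for $f\in\mathcal{R}_{v_{r,s}}$, $g\in M^1_{r,s}$ set $V_gf(x,\omega)=\langle f,M_\omega T_xg\rangle$. The modulation space is $M^p_{r,s}=\{f\in\mathcal{R}_{v_{r,s}}:V_{g_0}f\in L^p_{v_{r,s}}(\mathbb{R}^{2d})\}$ with norm $\|V_{g_0}f\|_{L^p_{v_{r,s}}}$; up to equivalent norms it is independent of $g_0$. A family $(g_\lambda)_{\lambda\in\Lambda}\subset M^1_{r,s}$ is a Banach frame for $M^p_{r,s}$ with respect to a Banach space $B_d$ of sequences if $f\mapsto\|(\langle f,g_\lambda\rangle)_\lambda\|_{B_d}$ is a well-defined norm on $M^p_{r,s}$ equivalent to its given norm and there is a bounded linear $R:B_d\to M^p_{r,s}$ with $R((\langle f,g_\lambda\rangle)_\lambda)=f$ for all $f\in M^p_{r,s}$. *)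

theory Defs
  imports "HOL-Analysis.Analysis" "HOL-Probability.Essential_Supremum"
begin

text \<open>
  Elements of Lebesgue spaces are represented by Borel measurable functions, not by
  equivalence classes; every class contains a Borel representative. The essential supremum is
  taken in \<^typ>\<open>ennreal\<close>, and \<open>count_space \<Lambda>\<close> gives the sequence spaces over \<open>\<Lambda>\<close>.
\<close>

definition Lp_space :: "'a measure \<Rightarrow> ennreal \<Rightarrow> ('a \<Rightarrow> complex) set" where
  "Lp_space M p = {F \<in> borel_measurable M.
     if p = \<infinity> then esssup M (\<lambda>x. ennreal (norm (F x))) < \<infinity>
     else integrable M (\<lambda>x. norm (F x) powr enn2real p)}"

definition Lp_norm :: "'a measure \<Rightarrow> ennreal \<Rightarrow> ('a \<Rightarrow> complex) \<Rightarrow> real" where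
  "Lp_norm M p F =
     (if p = \<infinity> then enn2real (esssup M (\<lambda>x. ennreal (norm (F x))))
      else (LINT x|M. norm (F x) powr enn2real p) powr (1 / enn2real p))"

definition weighted_Lp_space ::
    "'a measure \<Rightarrow> ('a \<Rightarrow> real) \<Rightarrow> ennreal \<Rightarrow> ('a \<Rightarrow> complex) set" where
  "weighted_Lp_space M v p = {F \<in> borel_measurable M. (\<lambda>x. F x * of_real (v x)) \<in> Lp_space M p}"

definition weighted_Lp_norm ::
    "'a measure \<Rightarrow> ('a \<Rightarrow> real) \<Rightarrow> ennreal \<Rightarrow> ('a \<Rightarrow> complex) \<Rightarrow> real" where
  "weighted_Lp_norm M v p F = Lp_norm M p (\<lambda>x. F x * of_real (v x))"

text \<open>
  Sequences indexed by \<open>\<Lambda>\<close> are functions on the ambient type that vanish off \<open>\<Lambda>\<close>, so that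
  equality of sequences is equality of functions.
\<close>

definition weighted_lp_space :: "'a set \<Rightarrow> ('a \<Rightarrow> real) \<Rightarrow> ennreal \<Rightarrow> ('a \<Rightarrow> complex) set" where
  "weighted_lp_space \<Lambda> v p =
     {c \<in> weighted_Lp_space (count_space \<Lambda>) v p. \<forall>x. x \<notin> \<Lambda> \<longrightarrow> c x = 0}"

definition weighted_lp_norm :: "'a set \<Rightarrow> ('a \<Rightarrow> real) \<Rightarrow> ennreal \<Rightarrow> ('a \<Rightarrow> complex) \<Rightarrow> real" where
  "weighted_lp_norm \<Lambda> v p = weighted_Lp_norm (count_space \<Lambda>) v p"

definition L2_space :: "(real ^ 'n \<Rightarrow> complex) set" where
  "L2_space = Lp_space lborel 2"

definition L2_inner :: "(real ^ 'n \<Rightarrow> complex) \<Rightarrow> (real ^ 'n \<Rightarrow> complex) \<Rightarrow> complex" where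
  "L2_inner f g = (LINT t|lborel. f t * cnj (g t))"

definition translation :: "real ^ 'n \<Rightarrow> (real ^ 'n \<Rightarrow> complex) \<Rightarrow> (real ^ 'n \<Rightarrow> complex)" where
  "translation x f = (\<lambda>t. f (t - x))"

definition modulation :: "real ^ 'n \<Rightarrow> (real ^ 'n \<Rightarrow> complex) \<Rightarrow> (real ^ 'n \<Rightarrow> complex)" where
  "modulation \<omega> f = (\<lambda>t. exp (2 * of_real pi * \<i> * of_real (\<omega> \<bullet> t)) * f t)"

definition STFT ::
    "(real ^ 'n \<Rightarrow> complex) \<Rightarrow> (real ^ 'n \<Rightarrow> complex) \<Rightarrow> (real ^ 'n) \<times> (real ^ 'n) \<Rightarrow> complex" where
  "STFT g f = (\<lambda>(x, \<omega>). L2_inner f (modulation \<omega> (translation x g)))"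

definition poly_weight :: "real \<Rightarrow> real \<Rightarrow> (real ^ 'n) \<times> (real ^ 'n) \<Rightarrow> real" where
  "poly_weight r s = (\<lambda>(x, \<omega>). (1 + norm x) powr r * (1 + norm \<omega>) powr s)"

definition window_class :: "real \<Rightarrow> real \<Rightarrow> (real ^ 'n \<Rightarrow> complex) set" where
  "window_class r s = {g \<in> L2_space. STFT g g \<in> weighted_Lp_space lborel (poly_weight r s) 1}"

definition M1_space ::
    "(real ^ 'n \<Rightarrow> complex) \<Rightarrow> real \<Rightarrow> real \<Rightarrow> (real ^ 'n \<Rightarrow> complex) set" where
  "M1_space g\<^sub>0 r s =
     {f \<in> L2_space. STFT g\<^sub>0 f \<in> weighted_Lp_space lborel (poly_weight r s) 1}"

definition M1_norm ::
    "(real ^ 'n \<Rightarrow> complex) \<Rightarrow> real \<Rightarrow> real \<Rightarrow> (real ^ 'n \<Rightarrow> complex) \<Rightarrow> real" where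
  "M1_norm g\<^sub>0 r s f = weighted_Lp_norm lborel (poly_weight r s) 1 (STFT g\<^sub>0 f)"

text \<open>
  Boundedness forces a functional to agree on almost everywhere equal representatives.
  Functionals are set to zero off the domain, so that two of them are equal as functions
  iff they agree on the domain.
\<close>

definition M1_antidual ::
    "(real ^ 'n \<Rightarrow> complex) \<Rightarrow> real \<Rightarrow> real \<Rightarrow> ((real ^ 'n \<Rightarrow> complex) \<Rightarrow> complex) set" where
  "M1_antidual g\<^sub>0 r s = {f.
     (\<forall>h\<in>M1_space g\<^sub>0 r s. \<forall>k\<in>M1_space g\<^sub>0 r s. f (\<lambda>t. h t + k t) = f h + f k) \<and>
     (\<forall>a. \<forall>h\<in>M1_space g\<^sub>0 r s. f (\<lambda>t. a * h t) = cnj a * f h) \<and>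
     (\<exists>C. \<forall>h\<in>M1_space g\<^sub>0 r s. norm (f h) \<le> C * M1_norm g\<^sub>0 r s h) \<and>
     (\<forall>h. h \<notin> M1_space g\<^sub>0 r s \<longrightarrow> f h = 0)}"

definition antidual_STFT ::
    "(real ^ 'n \<Rightarrow> complex) \<Rightarrow> ((real ^ 'n \<Rightarrow> complex) \<Rightarrow> complex)
       \<Rightarrow> (real ^ 'n) \<times> (real ^ 'n) \<Rightarrow> complex" where
  "antidual_STFT g f = (\<lambda>(x, \<omega>). f (modulation \<omega> (translation x g)))"

definition modulation_space ::
    "(real ^ 'n \<Rightarrow> complex) \<Rightarrow> ennreal \<Rightarrow> real \<Rightarrow> real
       \<Rightarrow> ((real ^ 'n \<Rightarrow> complex) \<Rightarrow> complex) set" where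
  "modulation_space g\<^sub>0 p r s = {f \<in> M1_antidual g\<^sub>0 r s.
     antidual_STFT g\<^sub>0 f \<in> weighted_Lp_space lborel (poly_weight r s) p}"

definition modulation_norm ::
    "(real ^ 'n \<Rightarrow> complex) \<Rightarrow> ennreal \<Rightarrow> real \<Rightarrow> real
       \<Rightarrow> ((real ^ 'n \<Rightarrow> complex) \<Rightarrow> complex) \<Rightarrow> real" where
  "modulation_norm g\<^sub>0 p r s f =
     weighted_Lp_norm lborel (poly_weight r s) p (antidual_STFT g\<^sub>0 f)"

text \<open>
  Normed spaces given by a carrier of complex-valued functions, with pointwise operations,
  and a norm on it.
\<close>

definition norm_on :: "('a \<Rightarrow> complex) set \<Rightarrow> (('a \<Rightarrow> complex) \<Rightarrow> real) \<Rightarrow> bool" where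
  "norm_on V N \<longleftrightarrow>
     (\<lambda>_. 0) \<in> V \<and>
     (\<forall>f\<in>V. \<forall>g\<in>V. (\<lambda>x. f x + g x) \<in> V \<and> N (\<lambda>x. f x + g x) \<le> N f + N g) \<and>
     (\<forall>a. \<forall>f\<in>V. (\<lambda>x. a * f x) \<in> V \<and> N (\<lambda>x. a * f x) = norm a * N f) \<and>
     (\<forall>f\<in>V. 0 \<le> N f \<and> (N f = 0 \<longleftrightarrow> f = (\<lambda>_. 0)))"

definition banach_space_on :: "('a \<Rightarrow> complex) set \<Rightarrow> (('a \<Rightarrow> complex) \<Rightarrow> real) \<Rightarrow> bool" where
  "banach_space_on V N \<longleftrightarrow> norm_on V N \<and>
     (\<forall>X :: nat \<Rightarrow> 'a \<Rightarrow> complex. (\<forall>n. X n \<in> V) \<and>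
        (\<forall>e>0. \<exists>n\<^sub>0. \<forall>m\<ge>n\<^sub>0. \<forall>n\<ge>n\<^sub>0. N (\<lambda>x. X m x - X n x) < e) \<longrightarrow>
        (\<exists>f\<in>V. (\<lambda>n. N (\<lambda>x. X n x - f x)) \<longlonglongrightarrow> 0))"

definition bounded_linear_on ::
    "('a \<Rightarrow> complex) set \<Rightarrow> (('a \<Rightarrow> complex) \<Rightarrow> real)
       \<Rightarrow> ('b \<Rightarrow> complex) set \<Rightarrow> (('b \<Rightarrow> complex) \<Rightarrow> real)
       \<Rightarrow> (('a \<Rightarrow> complex) \<Rightarrow> ('b \<Rightarrow> complex)) \<Rightarrow> bool" where
  "bounded_linear_on V N W N' T \<longleftrightarrow>
     (\<forall>f\<in>V. T f \<in> W) \<and>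
     (\<forall>f\<in>V. \<forall>g\<in>V. T (\<lambda>x. f x + g x) = (\<lambda>y. T f y + T g y)) \<and>
     (\<forall>a. \<forall>f\<in>V. T (\<lambda>x. a * f x) = (\<lambda>y. a * T f y)) \<and>
     (\<exists>C. \<forall>f\<in>V. N' (T f) \<le> C * N f)"

definition equivalent_on ::
    "'a set \<Rightarrow> ('a \<Rightarrow> real) \<Rightarrow> ('a \<Rightarrow> real) \<Rightarrow> bool" where
  "equivalent_on V N N' \<longleftrightarrow>
     (\<exists>a>0. \<exists>b>0. \<forall>f\<in>V. a * N f \<le> N' f \<and> N' f \<le> b * N f)"

definition coefficients ::
    "'i set \<Rightarrow> ('i \<Rightarrow> 'h) \<Rightarrow> ('h \<Rightarrow> complex) \<Rightarrow> 'i \<Rightarrow> complex" where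
  "coefficients \<Lambda> \<gamma> f = (\<lambda>i. if i \<in> \<Lambda> then f (\<gamma> i) else 0)"

text \<open>
  \<open>H\<close> is the space containing the family, \<open>X\<close> with norm \<open>N\<close> a space of functionals on \<open>H\<close>,
  and \<open>B\<close> with norm \<open>N\<^sub>B\<close> the sequence space. That the coefficient norm is well defined
  means that all coefficient sequences lie in \<open>B\<close>.
\<close>

definition banach_frame ::
    "'h set \<Rightarrow> ('h \<Rightarrow> complex) set \<Rightarrow> (('h \<Rightarrow> complex) \<Rightarrow> real)
       \<Rightarrow> ('i \<Rightarrow> complex) set \<Rightarrow> (('i \<Rightarrow> complex) \<Rightarrow> real)
       \<Rightarrow> 'i set \<Rightarrow> ('i \<Rightarrow> 'h) \<Rightarrow> bool" where
  "banach_frame H X N B N\<^sub>B \<Lambda> \<gamma> \<longleftrightarrow>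
     banach_space_on B N\<^sub>B \<and>
     (\<forall>i\<in>\<Lambda>. \<gamma> i \<in> H) \<and>
     (\<forall>f\<in>X. coefficients \<Lambda> \<gamma> f \<in> B) \<and>
     norm_on X (\<lambda>f. N\<^sub>B (coefficients \<Lambda> \<gamma> f)) \<and>
     equivalent_on X N (\<lambda>f. N\<^sub>B (coefficients \<Lambda> \<gamma> f)) \<and>
     (\<exists>R. bounded_linear_on B N\<^sub>B X N R \<and> (\<forall>f\<in>X. R (coefficients \<Lambda> \<gamma> f) = f))"

definition integer_points :: "((real ^ 'n) \<times> (real ^ 'n)) set" where
  "integer_points = {(k, l). \<forall>i. k $ i \<in> \<int> \<and> l $ i \<in> \<int>}"

end

theory Submission
  imports Defs "HOL-Probability.Characteristic_Functions"
begin

text \<open>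
  Write \<open>\<pi>(z)\<close> for the time-frequency shift by \<open>z\<close>, \<open>K(z, w) = \<langle>\<pi>(z) g, \<pi>(w) g\<rangle>\<close> and \<open>G = V\<^sub>g g\<close>, so that
  \<open>\<bar>K(z, w)\<bar> = \<bar>G(w - z)\<bar>\<close>. By the orthogonality relations \<open>F = V\<^sub>g f\<close> satisfies the reproducing formula
  \<open>F(w) = \<integral> F(z) K(z, w) dz\<close>, first for \<open>f\<close> in \<open>M\<^sup>1\<close> and then, approximating elements of \<open>M\<^sup>1\<close> by finite
  sums of shifts of \<open>g\<close>, for all \<open>f\<close> in the antidual. The same formula shows that \<open>\<bar>G\<bar>\<close> has an integrable
  local majorant, hence the oscillation of \<open>G\<close> over small neighbourhoods tends to \<open>0\<close> in the weighted
  \<open>L\<^sup>1\<close> norm. On a fine lattice \<open>F\<close> is therefore close to a step function with (phase corrected)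
  values \<open>F(\<lambda>)\<close>; the error operator is dominated by convolution with a kernel of norm at most \<open>1/2\<close>,
  for every \<open>p\<close> at once by Young's inequality, and a Neumann series gives the reconstruction.
\<close>

section \<open>Square-integrable functions\<close>

lemma borel_measurable_cnj [measurable (raw)]:
  "f \<in> borel_measurable M \<Longrightarrow> (\<lambda>x. cnj (f x)) \<in> borel_measurable M"
  using borel_measurable_continuous_onI[of cnj] measurable_compose[of f M borel cnj borel]
  by (simp add: continuous_on_cnj)

lemma L2_space_iff:
  "f \<in> L2_space \<longleftrightarrow> f \<in> borel_measurable lborel \<and> integrable lborel (\<lambda>t. (norm (f t))\<^sup>2)"
proof -
  have "(\<lambda>t. norm (f t) powr 2) = (\<lambda>t. (norm (f t))\<^sup>2)"
    by (simp add: powr_numeral)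
  then show ?thesis
    by (simp add: L2_space_def Lp_space_def)
qed

lemma L2_D:
  assumes "f \<in> L2_space"
  shows L2_measurable [measurable_dest]: "f \<in> borel_measurable borel"
    and L2_integrable: "integrable lborel (\<lambda>t. (norm (f t))\<^sup>2)"
  using assms by (auto simp: L2_space_iff)

definition L2_nrm :: "(real ^ 'n \<Rightarrow> complex) \<Rightarrow> real" where
  "L2_nrm f = sqrt (LINT t|lborel. (norm (f t))\<^sup>2)"

lemma L2_nrm_nonneg [simp]: "0 \<le> L2_nrm f"
  by (simp add: L2_nrm_def)

lemma L2_nrm_sq: "(L2_nrm f)\<^sup>2 = (LINT t|lborel. (norm (f t))\<^sup>2)"
  by (simp add: L2_nrm_def)

lemma Lp_norm_2: "Lp_norm lborel 2 f = L2_nrm f"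
  by (simp add: Lp_norm_def L2_nrm_def powr_numeral powr_half_sqrt)

lemma L2_mult_integrable:
  assumes "f \<in> L2_space" "g \<in> L2_space"
  shows "integrable lborel (\<lambda>t. f t * g t)"
proof (rule Bochner_Integration.integrable_bound)
  note [measurable] = L2_measurable[OF assms(1)] L2_measurable[OF assms(2)]
  show "integrable lborel (\<lambda>t. (norm (f t))\<^sup>2 + (norm (g t))\<^sup>2)"
    using assms by (intro Bochner_Integration.integrable_add L2_integrable)
  show "(\<lambda>t. f t * g t) \<in> borel_measurable lborel" by measurable
  have "norm a * norm b \<le> (norm a)\<^sup>2 + (norm b)\<^sup>2" for a b :: complex
    using sum_squares_bound[of "norm a" "norm b"] mult_nonneg_nonneg[OF norm_ge_zero norm_ge_zero, of a b] by linarith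
  then show "AE t in lborel. norm (f t * g t) \<le> norm ((norm (f t))\<^sup>2 + (norm (g t))\<^sup>2)"
    by (auto simp: norm_mult)
qed

lemma L2_cnj: "f \<in> L2_space \<Longrightarrow> (\<lambda>t. cnj (f t)) \<in> L2_space"
  by (auto simp: L2_space_iff)

lemma L2_cnj_nrm [simp]: "L2_nrm (\<lambda>t. cnj (f t)) = L2_nrm f"
  by (simp add: L2_nrm_def)

lemma L2_scale: "f \<in> L2_space \<Longrightarrow> (\<lambda>t. c * f t) \<in> L2_space"
  by (auto simp: L2_space_iff norm_mult power_mult_distrib)

lemma L2_add:
  assumes "f \<in> L2_space" "g \<in> L2_space"
  shows "(\<lambda>t. f t + g t) \<in> L2_space"
proof -
  note [measurable] = L2_measurable[OF assms(1)] L2_measurable[OF assms(2)]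
  have "integrable lborel (\<lambda>t. (norm (f t + g t))\<^sup>2)"
  proof (rule Bochner_Integration.integrable_bound)
    show "integrable lborel (\<lambda>t. 2 * (norm (f t))\<^sup>2 + 2 * (norm (g t))\<^sup>2)"
      using assms by (intro Bochner_Integration.integrable_add integrable_mult_right L2_integrable)
    have "(norm (a + b))\<^sup>2 \<le> 2 * (norm a)\<^sup>2 + 2 * (norm b)\<^sup>2" for a b :: complex
    proof -
      have "(norm (a + b))\<^sup>2 \<le> (norm a + norm b)\<^sup>2"
        by (intro power_mono norm_triangle_ineq) auto
      also have "\<dots> \<le> 2 * (norm a)\<^sup>2 + 2 * (norm b)\<^sup>2"
        using sum_squares_bound[of "norm a" "norm b"] by (simp add: power2_sum)
      finally show ?thesis .
    qed
    then show "AE t in lborel. norm ((norm (f t + g t))\<^sup>2) \<le> norm (2 * (norm (f t))\<^sup>2 + 2 * (norm (g t))\<^sup>2)"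
      by auto
  qed auto
  then show ?thesis by (auto simp: L2_space_iff)
qed

lemma L2_diff:
  assumes "f \<in> L2_space" "g \<in> L2_space"
  shows "(\<lambda>t. f t - g t) \<in> L2_space"
  using L2_add[OF assms(1) L2_scale[OF assms(2), of "-1"]] by simp

lemma L2_inner_integrable:
  "f \<in> L2_space \<Longrightarrow> g \<in> L2_space \<Longrightarrow> integrable lborel (\<lambda>t. f t * cnj (g t))"
  by (intro L2_mult_integrable L2_cnj)

lemma L2_Cauchy_Schwarz_abs:
  assumes "f \<in> L2_space" "g \<in> L2_space"
  shows "(LINT t|lborel. norm (f t) * norm (g t)) \<le> L2_nrm f * L2_nrm g"
proof -
  define I where "I = (LINT t|lborel. norm (f t) * norm (g t))"
  define a where "a = (L2_nrm f)\<^sup>2"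
  define b where "b = (L2_nrm g)\<^sup>2"
  have ifg: "integrable lborel (\<lambda>t. norm (f t) * norm (g t))"
    using integrable_norm[OF L2_mult_integrable[OF assms]] by (simp add: norm_mult)
  have q: "0 \<le> x\<^sup>2 * a - 2 * x * I + b" for x
  proof -
    have "0 \<le> (LINT t|lborel. (x * norm (f t) - norm (g t))\<^sup>2)" by simp
    also have "\<dots> = (LINT t|lborel. x\<^sup>2 * (norm (f t))\<^sup>2 - 2 * x * (norm (f t) * norm (g t)) + (norm (g t))\<^sup>2)"
      by (simp add: power2_diff power_mult_distrib algebra_simps)
    also have "\<dots> = x\<^sup>2 * a - 2 * x * I + b"
      unfolding a_def b_def I_def L2_nrm_sq
      using L2_integrable[OF assms(1)] L2_integrable[OF assms(2)] ifg by simp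
    finally show ?thesis .
  qed
  have I0: "I \<ge> 0" unfolding I_def by simp
  have ab: "a \<ge> 0" "b \<ge> 0" unfolding a_def b_def by auto
  have "I\<^sup>2 \<le> a * b"
  proof (cases "a = 0")
    case True
    have "I = 0"
    proof (rule ccontr)
      assume "I \<noteq> 0"
      then have "0 \<le> - (b+1) + b" using q[of "(b+1) / (2 * I)"] True by simp
      then show False by simp
    qed
    then show ?thesis using True by simp
  next
    case False
    then have "0 \<le> I\<^sup>2 / a - 2 * I\<^sup>2 / a + b"
      using q[of "I / a"] by (simp add: power2_eq_square)
    then have "I\<^sup>2 / a \<le> b" by (simp add: field_simps)
    then show ?thesis using False ab by (simp add: field_simps)
  qed
  then have "I\<^sup>2 \<le> (L2_nrm f * L2_nrm g)\<^sup>2" by (simp add: a_def b_def power_mult_distrib)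
  then show ?thesis unfolding I_def[symmetric] by (rule power2_le_imp_le) simp
qed

lemma L2_Cauchy_Schwarz:
  assumes "f \<in> L2_space" "g \<in> L2_space"
  shows "norm (L2_inner f g) \<le> L2_nrm f * L2_nrm g"
proof -
  have "norm (L2_inner f g) \<le> (LINT t|lborel. norm (f t * cnj (g t)))"
    unfolding L2_inner_def by (rule integral_norm_bound)
  then show ?thesis using L2_Cauchy_Schwarz_abs[OF assms] by (simp add: norm_mult)
qed

lemma L2_inner_self: "L2_inner f f = complex_of_real ((L2_nrm f)\<^sup>2)"
  unfolding L2_inner_def L2_nrm_sq complex_norm_square[symmetric] of_real_power[symmetric]
  by (rule integral_complex_of_real)

lemma L2_inner_cnj: "cnj (L2_inner f g) = L2_inner g f"
proof -
  have "cnj (L2_inner f g) = (LINT t|lborel. cnj (f t * cnj (g t)))"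
    unfolding L2_inner_def by (simp only: Bochner_Integration.integral_cnj)
  then show ?thesis unfolding L2_inner_def by (simp add: mult.commute)
qed

lemma L2_inner_diff_left:
  assumes "f \<in> L2_space" "g \<in> L2_space" "h \<in> L2_space"
  shows "L2_inner (\<lambda>t. f t - g t) h = L2_inner f h - L2_inner g h"
  unfolding L2_inner_def left_diff_distrib
  by (intro Bochner_Integration.integral_diff L2_inner_integrable assms)

lemma L2_inner_add_left:
  assumes "f \<in> L2_space" "g \<in> L2_space" "h \<in> L2_space"
  shows "L2_inner (\<lambda>t. f t + g t) h = L2_inner f h + L2_inner g h"
  unfolding L2_inner_def distrib_right
  by (intro Bochner_Integration.integral_add L2_inner_integrable assms)

lemma L2_inner_scale_left: "L2_inner (\<lambda>t. c * f t) h = c * L2_inner f h"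
  unfolding L2_inner_def mult.assoc by simp

lemma L2_inner_diff_right:
  assumes "f \<in> L2_space" "g \<in> L2_space" "h \<in> L2_space"
  shows "L2_inner h (\<lambda>t. f t - g t) = L2_inner h f - L2_inner h g"
  unfolding L2_inner_def complex_cnj_diff right_diff_distrib
  by (intro Bochner_Integration.integral_diff L2_inner_integrable assms)

lemma L2_inner_sum_left:
  assumes "finite I" "\<And>i. i \<in> I \<Longrightarrow> f i \<in> L2_space" "h \<in> L2_space"
  shows "L2_inner (\<lambda>t. \<Sum>i\<in>I. f i t) h = (\<Sum>i\<in>I. L2_inner (f i) h)"
  unfolding L2_inner_def sum_distrib_right
  by (intro Bochner_Integration.integral_sum L2_inner_integrable assms) auto

lemma L2_nrm_triangle:
  assumes "f \<in> L2_space" "g \<in> L2_space"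
  shows "L2_nrm (\<lambda>t. f t + g t) \<le> L2_nrm f + L2_nrm g"
proof (rule power2_le_imp_le)
  have n: "complex_of_real ((L2_nrm (\<lambda>t. f t + g t))\<^sup>2) =
     L2_inner f f + L2_inner f g + cnj (L2_inner f g) + L2_inner g g"
  proof -
    have "complex_of_real ((L2_nrm (\<lambda>t. f t + g t))\<^sup>2) = L2_inner f (\<lambda>t. f t + g t) + L2_inner g (\<lambda>t. f t + g t)"
      unfolding L2_inner_self[symmetric] by (intro L2_inner_add_left L2_add assms)
    also have "\<dots> = cnj (L2_inner (\<lambda>t. f t + g t) f) + cnj (L2_inner (\<lambda>t. f t + g t) g)"
      by (simp add: L2_inner_cnj)
    finally show ?thesis
      using assms by (simp add: L2_inner_add_left L2_inner_cnj)
  qed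
  have "(L2_nrm (\<lambda>t. f t + g t))\<^sup>2 = (L2_nrm f)\<^sup>2 + 2 * Re (L2_inner f g) + (L2_nrm g)\<^sup>2"
    using arg_cong[OF n, of Re] by (simp add: L2_inner_self)
  also have "\<dots> \<le> (L2_nrm f)\<^sup>2 + 2 * (L2_nrm f * L2_nrm g) + (L2_nrm g)\<^sup>2"
    using L2_Cauchy_Schwarz[OF assms] complex_Re_le_cmod[of "L2_inner f g"] by simp
  finally show "(L2_nrm (\<lambda>t. f t + g t))\<^sup>2 \<le> (L2_nrm f + L2_nrm g)\<^sup>2"
    by (simp add: power2_sum)
qed simp

lemma integrable_lborel_translate:
  fixes f :: "'a::euclidean_space \<Rightarrow> 'b::{banach, second_countable_topology}"
  shows "integrable lborel (\<lambda>t. f (t + a)) \<longleftrightarrow> integrable lborel f"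
    "integrable lborel (\<lambda>t. f (t - a)) \<longleftrightarrow> integrable lborel f"
proof -
  have *: "integrable lborel (\<lambda>t. f (t + a))" if "integrable lborel f" for a and f :: "'a \<Rightarrow> 'b"
    using integrable_distr[of "(+) a" lborel borel f] that
    by (simp add: lborel_distr_plus add.commute)
  show "integrable lborel (\<lambda>t. f (t + a)) \<longleftrightarrow> integrable lborel f"
    using *[of "\<lambda>t. f (t + a)" "-a"] *[of f a] by auto
  show "integrable lborel (\<lambda>t. f (t - a)) \<longleftrightarrow> integrable lborel f"
    using *[of "\<lambda>t. f (t - a)" "a"] *[of f "-a"] by auto
qed

lemma integral_lborel_translate:
  fixes f :: "'a::euclidean_space \<Rightarrow> 'b::{banach, second_countable_topology}"
  shows "(LINT t|lborel. f (t + a)) = (LINT t|lborel. f t)"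
    "(LINT t|lborel. f (t - a)) = (LINT t|lborel. f t)"
proof -
  have *: "(LINT t|lborel. f (t + a)) = (LINT t|lborel. f t)" for a
  proof (cases "f \<in> borel_measurable borel")
    case True
    then show ?thesis using integral_distr[of "(+) a" lborel borel f]
      by (simp add: lborel_distr_plus add.commute)
  next
    case False
    then have "\<not> integrable lborel f" by (auto dest: borel_measurable_integrable)
    then show ?thesis using integrable_lborel_translate(1)[of f a] by (simp add: not_integrable_integral_eq)
  qed
  show "(LINT t|lborel. f (t + a)) = (LINT t|lborel. f t)" by (rule *)
  show "(LINT t|lborel. f (t - a)) = (LINT t|lborel. f t)" using *[of "-a"] by simp
qed

lemma lborel_distr_reflect: "distr lborel borel (\<lambda>x. a - x) = (lborel :: 'a::euclidean_space measure)"
  using lborel_affine[of "-1" a] by (simp add: density_1)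

lemma integrable_lborel_reflect:
  fixes f :: "'a::euclidean_space \<Rightarrow> 'b::{banach, second_countable_topology}"
  shows "integrable lborel (\<lambda>t. f (a - t)) \<longleftrightarrow> integrable lborel f"
proof -
  have *: "integrable lborel (\<lambda>t. f (a - t))" if "integrable lborel f" for f :: "'a \<Rightarrow> 'b"
    using integrable_distr[of "(-) a" lborel borel f] that by (simp add: lborel_distr_reflect)
  show ?thesis using *[of f] *[of "\<lambda>t. f (a - t)"] by auto
qed

lemma integral_lborel_reflect:
  fixes f :: "'a::euclidean_space \<Rightarrow> 'b::{banach, second_countable_topology}"
  shows "(LINT t|lborel. f (a - t)) = (LINT t|lborel. f t)"
proof (cases "f \<in> borel_measurable borel")
  case True
  then show ?thesis
    using integral_distr[of "(-) a" lborel borel f] by (simp add: lborel_distr_reflect)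
next
  case False
  then have "\<not> integrable lborel f" by (auto dest: borel_measurable_integrable)
  then show ?thesis using integrable_lborel_reflect[of f a] by (simp add: not_integrable_integral_eq)
qed

lemma nn_integral_lborel_translate:
  fixes f :: "'a::euclidean_space \<Rightarrow> ennreal"
  assumes [measurable]: "f \<in> borel_measurable borel"
  shows "(\<integral>\<^sup>+t. f (t + a) \<partial>lborel) = (\<integral>\<^sup>+t. f t \<partial>lborel)"
    "(\<integral>\<^sup>+t. f (t - a) \<partial>lborel) = (\<integral>\<^sup>+t. f t \<partial>lborel)"
proof -
  have *: "(\<integral>\<^sup>+t. f (t + a) \<partial>lborel) = (\<integral>\<^sup>+t. f t \<partial>lborel)" for a
    using nn_integral_distr[of "(+) a" lborel borel f] by (simp add: lborel_distr_plus add.commute)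
  show "(\<integral>\<^sup>+t. f (t + a) \<partial>lborel) = (\<integral>\<^sup>+t. f t \<partial>lborel)" by (rule *)
  show "(\<integral>\<^sup>+t. f (t - a) \<partial>lborel) = (\<integral>\<^sup>+t. f t \<partial>lborel)" using *[of "-a"] by simp
qed

lemma nn_integral_lborel_reflect:
  fixes f :: "'a::euclidean_space \<Rightarrow> ennreal"
  assumes [measurable]: "f \<in> borel_measurable borel"
  shows "(\<integral>\<^sup>+t. f (a - t) \<partial>lborel) = (\<integral>\<^sup>+t. f t \<partial>lborel)"
  using nn_integral_distr[of "(-) a" lborel borel f] by (simp add: lborel_distr_reflect)

lemma L2_translation: "f \<in> L2_space \<Longrightarrow> translation x f \<in> L2_space"
  unfolding L2_space_iff translation_def
  using integrable_lborel_translate(2)[of "\<lambda>t. (norm (f t))\<^sup>2" x] by auto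

lemma L2_nrm_translation [simp]: "L2_nrm (translation x f) = L2_nrm f"
  unfolding L2_nrm_def translation_def
  using integral_lborel_translate(2)[of "\<lambda>t. (norm (f t))\<^sup>2" x] by simp

lemma norm_cis_factor [simp]: "norm (exp (2 * complex_of_real pi * \<i> * complex_of_real u)) = 1"
  using norm_exp_i_times[of "2 * pi * u"] by (simp add: mult_ac)

lemma L2_modulation: "f \<in> L2_space \<Longrightarrow> modulation w f \<in> L2_space"
  unfolding L2_space_iff modulation_def by (auto simp: norm_mult)

lemma L2_nrm_modulation [simp]: "L2_nrm (modulation w f) = L2_nrm f"
  unfolding L2_nrm_def modulation_def by (simp add: norm_mult)

section \<open>Time-frequency shifts\<close>

lemma translation_continuous_indicator:
  fixes B :: "'a::euclidean_space set"
  assumes B [measurable]: "B \<in> sets borel" and fin: "emeasure lborel B < \<infinity>"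
    and y: "y \<longlonglongrightarrow> 0"
  shows "(\<lambda>n. LINT t|lborel. \<bar>indicat_real B (t + y n) - indicat_real B t\<bar>) \<longlonglongrightarrow> 0"
proof (rule LIMSEQ_I)
  fix e :: real assume e: "e > 0"
  obtain U where U: "open U" "B \<subseteq> U" "emeasure lborel (U - B) < ennreal (e / 4)"
    using outer_regular_lborel[OF B, of "e/4"] e by auto
  have Um [measurable]: "U \<in> sets borel" using U(1) by simp
  have finU: "emeasure lborel U < \<infinity>"
  proof -
    have "emeasure lborel U \<le> emeasure lborel B + emeasure lborel (U - B)"
      using U(2) by (metis B Diff_partition Um emeasure_subadditive sets.Diff sets_lborel)
    also have "\<dots> < \<infinity>"
      using fin U(3) by (auto simp: less_top[symmetric] top_unique)
    finally show ?thesis .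
  qed
  have iB: "integrable lborel (indicat_real B)" and iU: "integrable lborel (indicat_real U)"
    and iUB: "integrable lborel (indicat_real (U - B))"
    using fin finU U(3) by (auto simp: integrable_indicator_iff less_top[symmetric] top_unique
       intro!: integrable_real_indicator intro: le_less_trans[OF emeasure_mono[of _ U]])
  have mUB: "(LINT t|lborel. indicat_real (U - B) t) < e / 4"
  proof -
    have "measure lborel (U - B) < e / 4"
      unfolding measure_def using enn2real_less_iff[of "emeasure lborel (U - B)" "e/4"] U(3) e
      by (cases "emeasure lborel (U - B)") (auto simp: ennreal_less_iff)
    then show ?thesis by simp
  qed
  have lim: "(\<lambda>n. LINT t|lborel. indicat_real U t * indicat_real U (t + y n)) \<longlonglongrightarrow> (LINT t|lborel. indicat_real U t)"
  proof (rule integral_dominated_convergence[where w="indicat_real U"])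
    show "AE t in lborel. (\<lambda>n. indicat_real U t * indicat_real U (t + y n)) \<longlonglongrightarrow> indicat_real U t"
    proof (rule AE_I2)
      fix t :: 'a
      show "(\<lambda>n. indicat_real U t * indicat_real U (t + y n)) \<longlonglongrightarrow> indicat_real U t"
      proof (cases "t \<in> U")
        case True
        have "(\<lambda>n. t + y n) \<longlonglongrightarrow> t" using tendsto_add[OF tendsto_const y, of t] by simp
        then have "eventually (\<lambda>n. t + y n \<in> U) sequentially"
          using topological_tendstoD[OF _ U(1) True] by auto
        then show ?thesis using True by (intro tendsto_eventually) (auto elim: eventually_mono)
      qed simp
    qed
  qed (use iU in \<open>auto simp: indicator_def\<close>)
  obtain N where N: "\<And>n. n \<ge> N \<Longrightarrow> \<bar>(LINT t|lborel. indicat_real U t * indicat_real U (t + y n)) - (LINT t|lborel. indicat_real U t)\<bar> < e / 4"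
    using LIMSEQ_D[OF lim, of "e/4"] e by auto
  show "\<exists>no. \<forall>n\<ge>no. norm ((LINT t|lborel. \<bar>indicat_real B (t + y n) - indicat_real B t\<bar>) - 0) < e"
  proof (intro exI allI impI)
    fix n assume n: "n \<ge> N"
    have iT: "integrable lborel (\<lambda>t. f (t + y n))" if "integrable lborel f" for f :: "'a \<Rightarrow> real"
      using that by (simp add: integrable_lborel_translate)
    have iP: "integrable lborel (\<lambda>t. indicat_real U t * indicat_real U (t + y n))"
      by (rule Bochner_Integration.integrable_bound[OF iU]) (auto simp: indicator_def)
    have "(LINT t|lborel. \<bar>indicat_real B (t + y n) - indicat_real B t\<bar>)
      \<le> (LINT t|lborel. indicat_real (U - B) t + indicat_real (U - B) (t + y n)
         + (indicat_real U t + indicat_real U (t + y n) - 2 * (indicat_real U t * indicat_real U (t + y n))))"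
      by (intro integral_mono integrable_abs Bochner_Integration.integrable_diff Bochner_Integration.integrable_add
           iB iUB iU iT integrable_mult_right iP)
         (use U(2) in \<open>auto simp: indicator_def\<close>)
    also have "\<dots> = 2 * (LINT t|lborel. indicat_real (U - B) t) + 2 * (LINT t|lborel. indicat_real U t)
        - 2 * (LINT t|lborel. indicat_real U t * indicat_real U (t + y n))"
      using iUB iU iP iT[OF iUB] iT[OF iU] integral_lborel_translate(1)[of "indicat_real (U-B)" "y n"]
        integral_lborel_translate(1)[of "indicat_real U" "y n"]
      by simp
    also have "\<dots> < e" using mUB N[OF n] by linarith
    finally show "norm ((LINT t|lborel. \<bar>indicat_real B (t + y n) - indicat_real B t\<bar>) - 0) < e"
      by simp
  qed
qed

lemma translation_continuous_L1:
  fixes f :: "'a::euclidean_space \<Rightarrow> complex"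
  assumes "integrable lborel f" and y: "y \<longlonglongrightarrow> 0"
  shows "(\<lambda>n. LINT t|lborel. norm (f (t + y n) - f t)) \<longlonglongrightarrow> 0"
  using assms(1)
proof (induction rule: integrable_induct)
  case (base A c)
  have "(LINT t|lborel. norm (indicat_real A (t + a) *\<^sub>R c - indicat_real A t *\<^sub>R c))
     = (LINT t|lborel. \<bar>indicat_real A (t + a) - indicat_real A t\<bar>) * norm c" for a
    by (simp add: scaleR_left_diff_distrib[symmetric])
  then show ?case
    using tendsto_mult_left_zero[OF translation_continuous_indicator[OF _ base(2) y]] base(1) by simp
next
  case (add f g)
  have i: "integrable lborel (\<lambda>t. f (t + a))" "integrable lborel (\<lambda>t. g (t + a))" for a
    using add by (simp_all add: integrable_lborel_translate)
  show ?case
  proof (rule tendsto_sandwich[OF _ _ tendsto_const tendsto_add_zero[OF add(3,4)]])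
    show "eventually (\<lambda>n. (LINT t|lborel. norm (f (t + y n) + g (t + y n) - (f t + g t)))
        \<le> (LINT t|lborel. norm (f (t + y n) - f t)) + (LINT t|lborel. norm (g (t + y n) - g t))) sequentially"
    proof (rule always_eventually, rule allI)
      fix n
      have "(LINT t|lborel. norm (f (t + y n) + g (t + y n) - (f t + g t)))
        \<le> (LINT t|lborel. norm (f (t + y n) - f t) + norm (g (t + y n) - g t))"
        using add(1,2) i by (intro integral_mono) (auto intro!: norm_diff_triangle_ineq)
      then show "(LINT t|lborel. norm (f (t + y n) + g (t + y n) - (f t + g t)))
        \<le> (LINT t|lborel. norm (f (t + y n) - f t)) + (LINT t|lborel. norm (g (t + y n) - g t))"
        using add(1,2) i by simp
    qed
  qed auto
next
  case (lim f s)
  have lim1: "(\<lambda>i. LINT t|lborel. norm (f t - s i t)) \<longlonglongrightarrow> 0"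
  proof -
    have "(\<lambda>i. LINT t|lborel. norm (f t - s i t)) \<longlonglongrightarrow> (LINT t|(lborel::'a measure). (0::real))"
    proof (rule integral_dominated_convergence[where w="\<lambda>t. 3 * norm (f t)"])
      show "AE t in lborel. (\<lambda>i. norm (f t - s i t)) \<longlonglongrightarrow> 0"
      proof (rule AE_I2)
        fix t :: 'a
        show "(\<lambda>i. norm (f t - s i t)) \<longlonglongrightarrow> 0"
          using tendsto_norm_zero[OF tendsto_diff[OF tendsto_const[of "f t"] lim(2)[of t], simplified]] by simp
      qed
      show "AE t in lborel. norm (norm (f t - s i t)) \<le> 3 * norm (f t)" for i
        using lim(3) norm_triangle_ineq4[of "f _" "s i _"] by (auto intro!: AE_I2 order_trans[OF norm_triangle_ineq4])
    qed (use lim(1,4) in \<open>auto intro: borel_measurable_integrable\<close>)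
    then show ?thesis by simp
  qed
  show ?case
  proof (rule LIMSEQ_I)
    fix e :: real assume e: "e > 0"
    obtain i where i: "(LINT t|lborel. norm (f t - s i t)) < e / 3"
      using LIMSEQ_D[OF lim1, of "e/3"] e by auto
    obtain N where N: "\<And>n. n \<ge> N \<Longrightarrow> (LINT t|lborel. norm (s i (t + y n) - s i t)) < e / 3"
      using LIMSEQ_D[OF lim(5), of "e/3" i] e by auto
    show "\<exists>N. \<forall>n\<ge>N. norm ((LINT t|lborel. norm (f (t + y n) - f t)) - 0) < e"
    proof (intro exI allI impI)
      fix n assume n: "n \<ge> N"
      have I: "integrable lborel (\<lambda>t. f (t + y n))" "integrable lborel (\<lambda>t. s i (t + y n))"
        using lim(1,4) by (simp_all add: integrable_lborel_translate)
      have "(LINT t|lborel. norm (f (t + y n) - f t))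
        \<le> (LINT t|lborel. norm (f (t + y n) - s i (t + y n)) + norm (s i (t + y n) - s i t) + norm (f t - s i t))"
      proof (intro integral_mono)
        show "norm (f (t + y n) - f t) \<le> norm (f (t + y n) - s i (t + y n)) + norm (s i (t + y n) - s i t) + norm (f t - s i t)" for t
          by norm
      qed (use lim(1,4) I in auto)
      also have "\<dots> = (LINT t|lborel. norm (f (t + y n) - s i (t + y n))) + (LINT t|lborel. norm (s i (t + y n) - s i t)) + (LINT t|lborel. norm (f t - s i t))"
        using lim(1,4) I by simp
      also have "(LINT t|lborel. norm (f (t + y n) - s i (t + y n))) = (LINT t|lborel. norm (f t - s i t))"
        by (rule integral_lborel_translate(1))
      also have "(LINT t|lborel. norm (f t - s i t)) + (LINT t|lborel. norm (s i (t + y n) - s i t)) + (LINT t|lborel. norm (f t - s i t)) < e"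
        using i N[OF n] by linarith
      finally show "norm ((LINT t|lborel. norm (f (t + y n) - f t)) - 0) < e" by simp
    qed
  qed
qed

lemma L2_nrm_minus: "L2_nrm (\<lambda>t. f t - g t) = L2_nrm (\<lambda>t. g t - f t)"
  unfolding L2_nrm_def by (simp add: norm_minus_commute)

lemma L2_nrm_triangle_diff:
  assumes "f \<in> L2_space" "g \<in> L2_space" "h \<in> L2_space"
  shows "L2_nrm (\<lambda>t. f t - h t) \<le> L2_nrm (\<lambda>t. f t - g t) + L2_nrm (\<lambda>t. g t - h t)"
  using L2_nrm_triangle[OF L2_diff[OF assms(1,2)] L2_diff[OF assms(2,3)]] by simp

lemma translation_continuous_L2_bounded:
  assumes f: "f \<in> L2_space" "integrable lborel f" "\<And>t. norm (f t) \<le> M" and y: "y \<longlonglongrightarrow> 0"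
  shows "(\<lambda>n. L2_nrm (\<lambda>t. f (t + y n) - f t)) \<longlonglongrightarrow> 0"
proof -
  have M: "M \<ge> 0" using f(3) norm_ge_zero order_trans by blast
  note [measurable] = L2_measurable[OF f(1)]
  have le: "(LINT t|lborel. (norm (f (t + a) - f t))\<^sup>2) \<le> 2 * M * (LINT t|lborel. norm (f (t + a) - f t))" for a
  proof -
    have i: "integrable lborel (\<lambda>t. f (t + a))"
      using f(2) by (simp add: integrable_lborel_translate)
    have pt: "(norm (f (t + a) - f t))\<^sup>2 \<le> 2 * M * norm (f (t + a) - f t)" for t
    proof -
      have "norm (f (t + a) - f t) \<le> 2 * M"
        using norm_triangle_ineq4[of "f (t+a)" "f t"] f(3)[of t] f(3)[of "t + a"] by linarith
      then show ?thesis by (simp add: power2_eq_square mult_right_mono)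
    qed
    have "(LINT t|lborel. (norm (f (t + a) - f t))\<^sup>2) \<le> (LINT t|lborel. 2 * M * norm (f (t + a) - f t))"
    proof (rule integral_mono)
      show j: "integrable lborel (\<lambda>t. 2 * M * norm (f (t + a) - f t))" using f(2) i by auto
      show "integrable lborel (\<lambda>t. (norm (f (t + a) - f t))\<^sup>2)"
        by (rule Bochner_Integration.integrable_bound[OF j]) (use pt M in \<open>auto\<close>)
    qed (rule pt)
    then show ?thesis by simp
  qed
  have "(\<lambda>n. LINT t|lborel. (norm (f (t + y n) - f t))\<^sup>2) \<longlonglongrightarrow> 0"
  proof (rule tendsto_sandwich[OF _ _ tendsto_const])
    show "(\<lambda>n. 2 * M * (LINT t|lborel. norm (f (t + y n) - f t))) \<longlonglongrightarrow> 0"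
      using tendsto_mult_right_zero[OF translation_continuous_L1[OF f(2) y]] by auto
  qed (use le in auto)
  from tendsto_real_sqrt[OF this] show ?thesis by (simp add: L2_nrm_def)
qed

lemma translation_continuous_L2:
  fixes f :: "real ^ 'n \<Rightarrow> complex"
  assumes f: "f \<in> L2_space" and y: "y \<longlonglongrightarrow> 0"
  shows "(\<lambda>n. L2_nrm (\<lambda>t. f (t + y n) - f t)) \<longlonglongrightarrow> 0"
proof -
  define s where "s = (\<lambda>k::nat. \<lambda>t. if 1 / Suc k \<le> norm (f t) \<and> norm (f t) \<le> Suc k then f t else 0)"
  note [measurable] = L2_measurable[OF f]
  have sm [measurable]: "s k \<in> borel_measurable borel" for k unfolding s_def by measurable
  have sb: "norm (s k t) \<le> Suc k" for k t by (auto simp: s_def)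
  have sle: "norm (s k t) \<le> norm (f t)" for k t by (auto simp: s_def)
  have s1: "norm (s k t) \<le> Suc k * (norm (f t))\<^sup>2" for k t
  proof (cases "1 / Suc k \<le> norm (f t) \<and> norm (f t) \<le> Suc k")
    case True
    then have "1 \<le> Suc k * norm (f t)" by (simp add: field_simps)
    then have "norm (f t) \<le> (Suc k * norm (f t)) * norm (f t)"
      using mult_right_mono[of 1 "Suc k * norm (f t)" "norm (f t)"] by simp
    then show ?thesis by (simp add: s_def True power2_eq_square mult_ac)
  next
    case False
    then have "s k t = 0" unfolding s_def by (rule if_not_P)
    then show ?thesis by simp
  qed
  have sL2: "s k \<in> L2_space" for k
    unfolding L2_space_iff
    by (auto intro!: Bochner_Integration.integrable_bound[OF L2_integrable[OF f]] AE_I2 power_mono sle)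
  have si: "integrable lborel (s k)" for k
    by (rule Bochner_Integration.integrable_bound[OF integrable_mult_right[OF L2_integrable[OF f], of "Suc k"]])
       (auto intro!: AE_I2 order_trans[OF s1])
  have lim1: "(\<lambda>k. L2_nrm (\<lambda>t. f t - s k t)) \<longlonglongrightarrow> 0"
  proof -
    have "(\<lambda>k. LINT t|lborel. (norm (f t - s k t))\<^sup>2) \<longlonglongrightarrow> (LINT t|(lborel::(real^'n) measure). (0::real))"
    proof (rule integral_dominated_convergence[where w="\<lambda>t. (norm (f t))\<^sup>2"])
      show "AE t in lborel. (\<lambda>k. (norm (f t - s k t))\<^sup>2) \<longlonglongrightarrow> 0"
      proof (rule AE_I2)
        fix t :: "real ^ 'n"
        have "eventually (\<lambda>k. (norm (f t - s k t))\<^sup>2 = 0) sequentially"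
        proof (cases "f t = 0")
          case False
          obtain N1 :: nat where N1: "1 / norm (f t) \<le> N1" using real_arch_simple by blast
          obtain N2 :: nat where N2: "norm (f t) \<le> N2" using real_arch_simple by blast
          have "s k t = f t" if "k \<ge> max N1 N2" for k
          proof -
            have "1 / norm (f t) \<le> Suc k" "norm (f t) \<le> Suc k" using N1 N2 that by auto
            then show ?thesis using False by (auto simp: s_def field_simps)
          qed
          then show ?thesis unfolding eventually_sequentially by (auto intro!: exI[of _ "max N1 N2"])
        qed (simp add: s_def)
        then show "(\<lambda>k. (norm (f t - s k t))\<^sup>2) \<longlonglongrightarrow> 0" by (rule tendsto_eventually)
      qed
      show "AE t in lborel. norm ((norm (f t - s k t))\<^sup>2) \<le> (norm (f t))\<^sup>2" for k
        by (auto simp: s_def)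
    qed (use L2_integrable[OF f] in auto)
    from tendsto_real_sqrt[OF this] show ?thesis by (simp add: L2_nrm_def)
  qed
  have tr: "L2_nrm (\<lambda>t. f (t + a) - f t) \<le> 2 * L2_nrm (\<lambda>t. f t - s k t) + L2_nrm (\<lambda>t. s k (t + a) - s k t)" for k a
  proof -
    have t: "(\<lambda>t. h (t + a)) \<in> L2_space" if "h \<in> L2_space" for h :: "real^'n \<Rightarrow> complex"
      using L2_translation[OF that, of "-a"] by (simp add: translation_def)
    have "L2_nrm (\<lambda>t. f (t + a) - f t) \<le> L2_nrm (\<lambda>t. f (t + a) - s k (t + a)) + L2_nrm (\<lambda>t. s k (t + a) - f t)"
      by (rule L2_nrm_triangle_diff) (intro t f sL2)+
    also have "L2_nrm (\<lambda>t. s k (t + a) - f t) \<le> L2_nrm (\<lambda>t. s k (t + a) - s k t) + L2_nrm (\<lambda>t. s k t - f t)"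
      by (rule L2_nrm_triangle_diff) (intro t f sL2)+
    also have "L2_nrm (\<lambda>t. f (t + a) - s k (t + a)) = L2_nrm (\<lambda>t. f t - s k t)"
      using L2_nrm_translation[of "-a" "\<lambda>t. f t - s k t"] by (simp add: translation_def)
    finally show ?thesis using L2_nrm_minus[of "s k" f] by simp
  qed
  show ?thesis
  proof (rule LIMSEQ_I)
    fix e :: real assume e: "e > 0"
    obtain k where k: "L2_nrm (\<lambda>t. f t - s k t) < e / 4"
      using LIMSEQ_D[OF lim1, of "e/4"] e by auto
    obtain N where N: "\<And>n. n \<ge> N \<Longrightarrow> L2_nrm (\<lambda>t. s k (t + y n) - s k t) < e / 2"
      using LIMSEQ_D[OF translation_continuous_L2_bounded[OF sL2 si sb y], of "e/2" k] e by auto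
    show "\<exists>N. \<forall>n\<ge>N. norm (L2_nrm (\<lambda>t. f (t + y n) - f t) - 0) < e"
    proof (intro exI allI impI)
      fix n assume "n \<ge> N"
      then show "norm (L2_nrm (\<lambda>t. f (t + y n) - f t) - 0) < e"
        using tr[of "y n" k] k N[of n] by simp
    qed
  qed
qed


definition unimod :: "real \<Rightarrow> complex" where
  "unimod u = exp (2 * complex_of_real pi * \<i> * complex_of_real u)"

lemma norm_unimod [simp]: "norm (unimod u) = 1"
  by (simp add: unimod_def)

lemma unimod_add: "unimod (u + w) = unimod u * unimod w"
  by (simp add: unimod_def ring_distribs exp_add)

lemma unimod_0 [simp]: "unimod 0 = 1"
  by (simp add: unimod_def)

lemma unimod_uminus: "unimod (- u) = cnj (unimod u)"
  by (simp add: unimod_def exp_cnj)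

lemma unimod_diff: "unimod (u - w) = unimod u * cnj (unimod w)"
  using unimod_add[of u "-w"] by (simp add: unimod_uminus)

lemma unimod_cnj_mult [simp]: "unimod u * cnj (unimod u) = 1" "cnj (unimod u) * unimod u = 1"
  by (simp_all add: unimod_uminus[symmetric] unimod_add[symmetric])

lemma continuous_on_unimod [continuous_intros]:
  "continuous_on S f \<Longrightarrow> continuous_on S (\<lambda>x. unimod (f x))"
  unfolding unimod_def by (intro continuous_intros)

lemma measurable_unimod [measurable]: "unimod \<in> borel_measurable borel"
  by (intro borel_measurable_continuous_onI continuous_intros)

definition tf_shift :: "(real ^ 'n) \<times> (real ^ 'n) \<Rightarrow> (real ^ 'n \<Rightarrow> complex) \<Rightarrow> (real ^ 'n \<Rightarrow> complex)" where
  "tf_shift z f = modulation (snd z) (translation (fst z) f)"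

lemma tf_shift_apply: "tf_shift z f t = unimod (snd z \<bullet> t) * f (t - fst z)"
  by (simp add: tf_shift_def modulation_def translation_def unimod_def)

lemma STFT_eq: "STFT g f z = L2_inner f (tf_shift z g)"
  by (simp add: STFT_def tf_shift_def case_prod_unfold)

lemma L2_tf_shift: "f \<in> L2_space \<Longrightarrow> tf_shift z f \<in> L2_space"
  unfolding tf_shift_def by (intro L2_modulation L2_translation)

lemma L2_nrm_tf_shift [simp]: "L2_nrm (tf_shift z f) = L2_nrm f"
  by (simp add: tf_shift_def)

lemma tf_shift_0 [simp]: "tf_shift 0 f = f"
  by (rule ext) (simp add: tf_shift_apply)

lemma tf_shift_tf_shift:
  "tf_shift z (tf_shift w f) = (\<lambda>t. cnj (unimod (snd w \<bullet> fst z)) * tf_shift (z + w) f t)"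
  by (rule ext) (simp add: tf_shift_apply inner_diff_right inner_add_left unimod_add unimod_diff
      diff_diff_eq mult_ac add.commute)

lemma L2_inner_tf_shift_tf_shift:
  "L2_inner (tf_shift z a) (tf_shift w b) = cnj (unimod (snd (w - z) \<bullet> fst z)) * STFT b a (w - z)"
proof -
  have "L2_inner (tf_shift z a) (tf_shift w b)
     = (LINT t|lborel. unimod (snd z \<bullet> t) * a (t - fst z) * cnj (unimod (snd w \<bullet> t) * b (t - fst w)))"
    by (simp add: L2_inner_def tf_shift_apply)
  also have "\<dots> = (LINT t|lborel. unimod (snd z \<bullet> (t + fst z)) * a (t + fst z - fst z)
      * cnj (unimod (snd w \<bullet> (t + fst z)) * b (t + fst z - fst w)))"
    by (rule integral_lborel_translate(1)[symmetric])
  also have "\<dots> = (LINT t|lborel. cnj (unimod (snd (w - z) \<bullet> fst z))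
      * (a t * cnj (unimod (snd (w - z) \<bullet> t) * b (t - fst (w - z)))))"
  proof (intro Bochner_Integration.integral_cong refl)
    fix t :: "real ^ 'a"
    have e: "unimod (snd z \<bullet> (t + fst z)) * cnj (unimod (snd w \<bullet> (t + fst z)))
       = cnj (unimod (snd (w - z) \<bullet> fst z)) * cnj (unimod (snd (w - z) \<bullet> t))"
      by (simp add: unimod_uminus[symmetric] unimod_add[symmetric] inner_diff_left inner_add_right
            algebra_simps)
    have "unimod (snd z \<bullet> (t + fst z)) * a (t + fst z - fst z)
      * cnj (unimod (snd w \<bullet> (t + fst z)) * b (t + fst z - fst w))
      = (unimod (snd z \<bullet> (t + fst z)) * cnj (unimod (snd w \<bullet> (t + fst z)))) * (a t * cnj (b (t - fst (w - z))))"
      by (simp add: algebra_simps)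
    then show "unimod (snd z \<bullet> (t + fst z)) * a (t + fst z - fst z)
      * cnj (unimod (snd w \<bullet> (t + fst z)) * b (t + fst z - fst w))
      = cnj (unimod (snd (w - z) \<bullet> fst z)) * (a t * cnj (unimod (snd (w - z) \<bullet> t) * b (t - fst (w - z))))"
      unfolding e by (simp add: mult_ac)
  qed
  also have "\<dots> = cnj (unimod (snd (w - z) \<bullet> fst z)) * STFT b a (w - z)"
    by (simp add: STFT_eq L2_inner_def tf_shift_apply)
  finally show ?thesis .
qed

lemma norm_L2_inner_tf_shift:
  "norm (L2_inner (tf_shift z a) (tf_shift w b)) = norm (STFT b a (w - z))"
  by (simp add: L2_inner_tf_shift_tf_shift norm_mult)

lemma norm_STFT_tf_shift: "norm (STFT b (tf_shift z a) w) = norm (STFT b a (w - z))"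
  by (simp add: STFT_eq[of b "tf_shift z a"] norm_L2_inner_tf_shift)

lemma norm_STFT_swap: "norm (STFT b a (- z)) = norm (STFT a b z)"
proof -
  have "norm (STFT b a (- z)) = norm (L2_inner (tf_shift z a) (tf_shift 0 b))"
    by (subst norm_L2_inner_tf_shift) simp
  also have "\<dots> = norm (L2_inner b (tf_shift z a))"
    by (subst L2_inner_cnj[symmetric]) (simp only: complex_mod_cnj tf_shift_0)
  finally show ?thesis by (simp add: STFT_eq)
qed

lemma norm_STFT_window_shift: "norm (STFT (tf_shift y b) a z) = norm (STFT b a (z + y))"
proof -
  have "norm (STFT (tf_shift y b) a z) = norm (STFT a (tf_shift y b) (- z))"
    using norm_STFT_swap[of "tf_shift y b" a "-z"] by simp
  also have "\<dots> = norm (STFT a b (- (z + y)))" by (simp add: norm_STFT_tf_shift)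
  finally show ?thesis by (simp only: norm_STFT_swap)
qed

lemma STFT_bound:
  assumes "a \<in> L2_space" "b \<in> L2_space"
  shows "norm (STFT b a z) \<le> L2_nrm a * L2_nrm b"
  using L2_Cauchy_Schwarz[OF assms(1) L2_tf_shift[OF assms(2)]] by (simp add: STFT_eq)

lemma modulation_continuous_L2:
  fixes f :: "real ^ 'n \<Rightarrow> complex"
  assumes f: "f \<in> L2_space" and y: "w \<longlonglongrightarrow> w0"
  shows "(\<lambda>n. L2_nrm (\<lambda>t. modulation (w n) f t - modulation w0 f t)) \<longlonglongrightarrow> 0"
proof -
  note [measurable] = L2_measurable[OF f]
  have "(\<lambda>n. LINT t|lborel. (norm (unimod (w n \<bullet> t) * f t - unimod (w0 \<bullet> t) * f t))\<^sup>2)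
      \<longlonglongrightarrow> (LINT t|(lborel::(real^'n) measure). (0::real))"
  proof (rule integral_dominated_convergence[where w="\<lambda>t. 4 * (norm (f t))\<^sup>2"])
    show "AE t in lborel. (\<lambda>n. (norm (unimod (w n \<bullet> t) * f t - unimod (w0 \<bullet> t) * f t))\<^sup>2) \<longlonglongrightarrow> 0"
    proof (rule AE_I2)
      fix t :: "real ^ 'n"
      have "isCont unimod (w0 \<bullet> t)"
        using continuous_on_unimod[of UNIV "\<lambda>x. x"] by (simp add: continuous_on_eq_continuous_at)
      then have "(\<lambda>n. unimod (w n \<bullet> t)) \<longlonglongrightarrow> unimod (w0 \<bullet> t)"
        using tendsto_inner[OF y tendsto_const[of t]] by (rule isCont_tendsto_compose)
      then have "(\<lambda>n. unimod (w n \<bullet> t) * f t - unimod (w0 \<bullet> t) * f t) \<longlonglongrightarrow> unimod (w0 \<bullet> t) * f t - unimod (w0 \<bullet> t) * f t"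
        by (intro tendsto_intros)
      then show "(\<lambda>n. (norm (unimod (w n \<bullet> t) * f t - unimod (w0 \<bullet> t) * f t))\<^sup>2) \<longlonglongrightarrow> 0"
        using tendsto_power[OF tendsto_norm, of _ 0 _ 2] by fastforce
    qed
    show "AE t in lborel. norm ((norm (unimod (w n \<bullet> t) * f t - unimod (w0 \<bullet> t) * f t))\<^sup>2) \<le> 4 * (norm (f t))\<^sup>2" for n
    proof (rule AE_I2)
      fix t :: "real ^ 'n"
      have "norm (unimod (w n \<bullet> t) * f t - unimod (w0 \<bullet> t) * f t) \<le> 2 * norm (f t)"
        using norm_triangle_ineq4[of "unimod (w n \<bullet> t) * f t" "unimod (w0 \<bullet> t) * f t"] by (simp add: norm_mult)
      from power_mono[OF this, of 2]
      show "norm ((norm (unimod (w n \<bullet> t) * f t - unimod (w0 \<bullet> t) * f t))\<^sup>2) \<le> 4 * (norm (f t))\<^sup>2"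
        by (simp add: power_mult_distrib)
    qed
  qed (use L2_integrable[OF f] in auto)
  from tendsto_real_sqrt[OF this] show ?thesis
    by (simp add: L2_nrm_def modulation_def unimod_def)
qed

lemma tf_shift_continuous_L2:
  fixes f :: "real ^ 'n \<Rightarrow> complex"
  assumes f: "f \<in> L2_space" and z: "z \<longlonglongrightarrow> z0"
  shows "(\<lambda>n. L2_nrm (\<lambda>t. tf_shift (z n) f t - tf_shift z0 f t)) \<longlonglongrightarrow> 0"
proof -
  have x: "(\<lambda>n. fst z0 - fst (z n)) \<longlonglongrightarrow> 0" and w: "(\<lambda>n. snd (z n)) \<longlonglongrightarrow> snd z0"
    using tendsto_diff[OF tendsto_const tendsto_fst[OF z], of "fst z0"] tendsto_snd[OF z] by simp_all
  let ?u = "translation (fst z0) f"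
  have u: "?u \<in> L2_space" by (rule L2_translation[OF f])
  have le: "L2_nrm (\<lambda>t. tf_shift (z n) f t - tf_shift z0 f t)
     \<le> L2_nrm (\<lambda>t. ?u (t + (fst z0 - fst (z n))) - ?u t) + L2_nrm (\<lambda>t. modulation (snd (z n)) ?u t - modulation (snd z0) ?u t)" for n
  proof -
    have "L2_nrm (\<lambda>t. tf_shift (z n) f t - tf_shift z0 f t)
      \<le> L2_nrm (\<lambda>t. tf_shift (z n) f t - modulation (snd (z n)) ?u t) + L2_nrm (\<lambda>t. modulation (snd (z n)) ?u t - tf_shift z0 f t)"
      by (intro L2_nrm_triangle_diff L2_tf_shift L2_modulation u f)
    also have "L2_nrm (\<lambda>t. tf_shift (z n) f t - modulation (snd (z n)) ?u t)
      = L2_nrm (modulation (snd (z n)) (\<lambda>t. ?u (t + (fst z0 - fst (z n))) - ?u t))"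
      by (rule arg_cong[of _ _ L2_nrm], rule ext)
         (simp add: tf_shift_def modulation_def translation_def right_diff_distrib algebra_simps)
    also have "\<dots> = L2_nrm (\<lambda>t. ?u (t + (fst z0 - fst (z n))) - ?u t)" by simp
    finally show ?thesis by (simp add: tf_shift_def)
  qed
  show ?thesis
    by (rule tendsto_sandwich[OF _ _ tendsto_const
          tendsto_add_zero[OF translation_continuous_L2[OF u x] modulation_continuous_L2[OF u w]]])
       (use le in auto)
qed

lemma continuous_STFT:
  fixes a b :: "real ^ 'n \<Rightarrow> complex"
  assumes a: "a \<in> L2_space" and b: "b \<in> L2_space"
  shows "continuous_on S (STFT b a)"
  unfolding continuous_on_sequentially
proof (intro allI ballI impI, elim conjE)
  fix z and z0 :: "(real ^ 'n) \<times> (real ^ 'n)" assume z: "z \<longlonglongrightarrow> z0"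
  have "(\<lambda>n. STFT b a (z n) - STFT b a z0) \<longlonglongrightarrow> 0"
  proof (rule Lim_null_comparison)
    show "eventually (\<lambda>n. norm (STFT b a (z n) - STFT b a z0)
       \<le> L2_nrm a * L2_nrm (\<lambda>t. tf_shift (z n) b t - tf_shift z0 b t)) sequentially"
    proof (rule always_eventually, rule allI)
      fix n
      have "STFT b a (z n) - STFT b a z0 = L2_inner a (\<lambda>t. tf_shift (z n) b t - tf_shift z0 b t)"
        unfolding STFT_eq by (intro L2_inner_diff_right[symmetric] L2_tf_shift a b)
      then show "norm (STFT b a (z n) - STFT b a z0)
       \<le> L2_nrm a * L2_nrm (\<lambda>t. tf_shift (z n) b t - tf_shift z0 b t)"
        using L2_Cauchy_Schwarz[OF a L2_diff[OF L2_tf_shift[OF b] L2_tf_shift[OF b]]] by simp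
    qed
    show "(\<lambda>n. L2_nrm a * L2_nrm (\<lambda>t. tf_shift (z n) b t - tf_shift z0 b t)) \<longlonglongrightarrow> 0"
      using tendsto_mult_right_zero[OF tf_shift_continuous_L2[OF b z], of "L2_nrm a"] by simp
  qed
  then show "(STFT b a \<circ> z) \<longlonglongrightarrow> STFT b a z0"
    by (simp add: LIM_zero_iff o_def)
qed

lemma measurable_STFT:
  "a \<in> L2_space \<Longrightarrow> b \<in> L2_space \<Longrightarrow> STFT b a \<in> borel_measurable borel"
  by (intro borel_measurable_continuous_onI continuous_STFT)

lemma continuous_tf_kernel:
  assumes "a \<in> L2_space" "b \<in> L2_space" "continuous_on S f" "continuous_on S h"
  shows "continuous_on S (\<lambda>x. L2_inner (tf_shift (f x) a) (tf_shift (h x) b))"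
  unfolding L2_inner_tf_shift_tf_shift
  by (intro continuous_intros assms continuous_on_compose2[OF continuous_STFT[OF assms(1,2), of UNIV]]) auto

lemma measurable_tf_kernel [measurable (raw)]:
  assumes a: "a \<in> L2_space" and b: "b \<in> L2_space"
    and [measurable]: "f \<in> borel_measurable M" "h \<in> borel_measurable M"
  shows "(\<lambda>x. L2_inner (tf_shift (f x) a) (tf_shift (h x) b)) \<in> borel_measurable M"
proof -
  have "(\<lambda>p. L2_inner (tf_shift (fst p) a) (tf_shift (snd p) b)) \<in> borel_measurable (borel \<Otimes>\<^sub>M borel)"
    unfolding borel_prod
    by (intro borel_measurable_continuous_onI continuous_tf_kernel a b continuous_intros)
  from measurable_compose[OF measurable_Pair[OF assms(3,4)] this] show ?thesis by simp
qed

section \<open>Orthogonality of short-time Fourier transforms\<close>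

definition gaussian :: "'a::euclidean_space \<Rightarrow> real" where
  "gaussian u = exp (- (norm u)\<^sup>2 / 2)"

lemma gaussian_le_1: "gaussian u \<le> 1"
  by (simp add: gaussian_def)

lemma gaussian_nonneg [simp]: "0 \<le> gaussian u" and abs_gaussian [simp]: "\<bar>gaussian u\<bar> = gaussian u"
  by (simp_all add: gaussian_def)

lemma continuous_on_gaussian [continuous_intros]:
  "continuous_on S f \<Longrightarrow> continuous_on S (\<lambda>x. gaussian (f x))"
  unfolding gaussian_def by (intro continuous_intros) auto

lemma measurable_gaussian [measurable]: "gaussian \<in> borel_measurable borel"
  by (intro borel_measurable_continuous_onI continuous_intros)

lemma gaussian_eq_prod:
  "gaussian (\<Sum>b\<in>Basis. f b *\<^sub>R b :: 'a::euclidean_space) = (\<Prod>b\<in>(Basis::'a set). exp (- (f b)\<^sup>2 / 2))"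
proof -
  have "(norm (\<Sum>b\<in>Basis. f b *\<^sub>R b :: 'a))\<^sup>2 = (\<Sum>b\<in>(Basis::'a set). (f b)\<^sup>2)"
    unfolding power2_norm_eq_inner by (subst euclidean_inner) (simp add: power2_eq_square)
  then show ?thesis
    by (simp add: gaussian_def exp_sum[symmetric] sum_negf[symmetric] sum_divide_distrib)
qed

lemma exp_half_sq_FT:
  "integrable lborel (\<lambda>x. complex_of_real (exp (- x\<^sup>2 / 2)) * iexp (x * y))"
  "(LINT x|lborel. complex_of_real (exp (- x\<^sup>2 / 2)) * iexp (x * y)) = complex_of_real (sqrt (2 * pi) * exp (- y\<^sup>2 / 2))"
proof -
  have e: "exp (- x\<^sup>2 / 2) = sqrt (2 * pi) * std_normal_density x" for x :: real
    by (simp add: std_normal_density_def)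
  have i: "integrable lborel (\<lambda>x. complex_of_real (std_normal_density x))"
    using integrable_normal_density[of 1 0] by simp
  have i2: "integrable lborel (\<lambda>x. complex_of_real (std_normal_density x) * iexp (x * y))"
    by (rule Bochner_Integration.integrable_bound[OF i]) (auto simp: norm_mult)
  then have "integrable lborel (\<lambda>x. complex_of_real (sqrt (2 * pi)) * (complex_of_real (std_normal_density x) * iexp (x * y)))"
    by (rule integrable_mult_right)
  then show "integrable lborel (\<lambda>x. complex_of_real (exp (- x\<^sup>2 / 2)) * iexp (x * y))"
    unfolding e by (simp add: mult.assoc)
  have "(LINT x|lborel. complex_of_real (std_normal_density x) * iexp (x * y)) = char std_normal_distribution y"
    unfolding char_def by (subst integral_density) (auto simp: scaleR_conv_of_real mult.commute)
  also have "\<dots> = complex_of_real (exp (- y\<^sup>2 / 2))"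
    by (simp add: char_std_normal_distribution)
  finally have "complex_of_real (sqrt (2 * pi)) * (LINT x|lborel. complex_of_real (std_normal_density x) * iexp (x * y))
     = complex_of_real (sqrt (2 * pi) * exp (- y\<^sup>2 / 2))" by simp
  then show "(LINT x|lborel. complex_of_real (exp (- x\<^sup>2 / 2)) * iexp (x * y)) = complex_of_real (sqrt (2 * pi) * exp (- y\<^sup>2 / 2))"
    unfolding e by (simp add: mult.assoc)
qed

lemma gaussian_FT:
  fixes y :: "'a::euclidean_space"
  shows "integrable lborel (\<lambda>u. complex_of_real (gaussian u) * iexp (u \<bullet> y))"
  and "(LINT u|lborel. complex_of_real (gaussian u) * iexp (u \<bullet> y)) = complex_of_real (sqrt (2 * pi) ^ DIM('a) * gaussian y)"
proof -
  interpret product_sigma_finite "\<lambda>_::'a. (lborel :: real measure)"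
    by standard
  let ?f = "\<lambda>b x. complex_of_real (exp (- x\<^sup>2 / 2)) * iexp (x * (y \<bullet> b))"
  have pt: "complex_of_real (gaussian (\<Sum>b\<in>Basis. f b *\<^sub>R b)) * iexp ((\<Sum>b\<in>Basis. f b *\<^sub>R b) \<bullet> y)
     = (\<Prod>b\<in>(Basis::'a set). ?f b (f b))" for f
  proof -
    have "iexp ((\<Sum>b\<in>Basis. f b *\<^sub>R b) \<bullet> y) = (\<Prod>b\<in>(Basis::'a set). iexp (f b * (y \<bullet> b)))"
      unfolding exp_sum[OF finite_Basis, symmetric]
      by (simp add: inner_sum_left inner_sum_right inner_commute sum_distrib_left)
    then show ?thesis unfolding gaussian_eq_prod prod.distrib by simp
  qed
  have m: "(\<lambda>u::'a. complex_of_real (gaussian u) * iexp (u \<bullet> y)) \<in> borel_measurable borel"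
    by measurable
  have m2: "(\<lambda>f. \<Sum>b\<in>Basis. f b *\<^sub>R b :: 'a) \<in> (\<Pi>\<^sub>M b\<in>Basis. lborel) \<rightarrow>\<^sub>M borel" by measurable
  show "integrable lborel (\<lambda>u. complex_of_real (gaussian u) * iexp (u \<bullet> y))"
    unfolding lborel_eq[where ?'a='a] integrable_distr_eq[OF m2 m] pt
    by (intro product_integrable_prod exp_half_sq_FT(1)) auto
  have "(LINT u|lborel. complex_of_real (gaussian u) * iexp (u \<bullet> y)) = (\<Prod>b\<in>(Basis::'a set). (LINT x|lborel. ?f b x))"
    unfolding lborel_eq[where ?'a='a] integral_distr[OF m2 m] pt
    by (intro product_integral_prod exp_half_sq_FT(1)) auto
  also have "\<dots> = complex_of_real (\<Prod>b\<in>(Basis::'a set). sqrt (2 * pi) * exp (- (y \<bullet> b)\<^sup>2 / 2))"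
    unfolding exp_half_sq_FT(2) by simp
  also have "(\<Prod>b\<in>(Basis::'a set). sqrt (2 * pi) * exp (- (y \<bullet> b)\<^sup>2 / 2)) = sqrt (2 * pi) ^ DIM('a) * gaussian y"
    using gaussian_eq_prod[of "\<lambda>b. y \<bullet> b"] by (simp add: prod.distrib euclidean_representation)
  finally show "(LINT u|lborel. complex_of_real (gaussian u) * iexp (u \<bullet> y)) = complex_of_real (sqrt (2 * pi) ^ DIM('a) * gaussian y)" .
qed

lemma integrable_gaussian: "integrable lborel (gaussian :: 'a::euclidean_space \<Rightarrow> real)"
  using integrable_Re[OF gaussian_FT(1)[of "0::'a"]] by simp

lemma integral_gaussian: "(LINT u|lborel. gaussian (u::'a::euclidean_space)) = sqrt (2 * pi) ^ DIM('a)"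
proof -
  have "complex_of_real (LINT u|lborel. gaussian (u::'a)) = complex_of_real (sqrt (2 * pi) ^ DIM('a))"
    using gaussian_FT(2)[of "0::'a"] by (simp add: gaussian_def[of "0::'a"])
  then show ?thesis by (simp only: of_real_eq_iff)
qed

lemma integral_lborel_scale:
  fixes f :: "'a::euclidean_space \<Rightarrow> 'b::{banach, second_countable_topology}"
  assumes c: "c > 0" and f: "integrable lborel f"
  shows "integrable lborel (\<lambda>x. f (c *\<^sub>R x))"
    "(LINT x|lborel. f (c *\<^sub>R x)) = (1 / c ^ DIM('a)) *\<^sub>R (LINT x|lborel. f x)"
proof -
  have m: "f \<in> borel_measurable borel" using f by (auto dest: borel_measurable_integrable)
  have eq: "lborel = density (distr lborel borel (\<lambda>x::'a. 0 + c *\<^sub>R x)) (\<lambda>_. ennreal (\<bar>c\<bar> ^ DIM('a)))"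
    using lborel_affine[of c "0::'a"] c by simp
  have mm: "(\<lambda>x::'a. 0 + c *\<^sub>R x) \<in> lborel \<rightarrow>\<^sub>M borel" by measurable
  have "integrable lborel (\<lambda>x. \<bar>c\<bar> ^ DIM('a) *\<^sub>R f (c *\<^sub>R x))"
    using f m mm by (subst (asm) eq) (simp add: integrable_density integrable_distr_eq)
  then have "integrable lborel (\<lambda>x. (1 / c ^ DIM('a)) *\<^sub>R (\<bar>c\<bar> ^ DIM('a) *\<^sub>R f (c *\<^sub>R x)))"
    by (rule integrable_scaleR_right)
  then show "integrable lborel (\<lambda>x. f (c *\<^sub>R x))" using c by simp
  have "(LINT x|lborel. f x) = (LINT x|lborel. \<bar>c\<bar> ^ DIM('a) *\<^sub>R f (c *\<^sub>R x))"
    using m mm by (subst eq) (simp add: integral_density integral_distr)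
  then show "(LINT x|lborel. f (c *\<^sub>R x)) = (1 / c ^ DIM('a)) *\<^sub>R (LINT x|lborel. f x)"
    using c by simp
qed

lemma scaled_gaussian_FT:
  fixes y :: "'a::euclidean_space"
  assumes e: "e > 0"
  shows "integrable lborel (\<lambda>w. complex_of_real (gaussian (e *\<^sub>R w)) * unimod (w \<bullet> y))"
  and "(LINT w|lborel. complex_of_real (gaussian (e *\<^sub>R w)) * unimod (w \<bullet> y))
     = complex_of_real ((sqrt (2 * pi) / e) ^ DIM('a) * gaussian ((2 * pi / e) *\<^sub>R y))"
proof -
  have eq: "complex_of_real (gaussian (e *\<^sub>R w)) * unimod (w \<bullet> y)
     = complex_of_real (gaussian (e *\<^sub>R w)) * iexp ((e *\<^sub>R w) \<bullet> ((2 * pi / e) *\<^sub>R y))" for w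
    using e by (simp add: unimod_def mult_ac)
  note i = gaussian_FT(1)[of "(2 * pi / e) *\<^sub>R y"]
  show "integrable lborel (\<lambda>w. complex_of_real (gaussian (e *\<^sub>R w)) * unimod (w \<bullet> y))"
    unfolding eq by (rule integral_lborel_scale(1)[OF e i])
  show "(LINT w|lborel. complex_of_real (gaussian (e *\<^sub>R w)) * unimod (w \<bullet> y))
     = complex_of_real ((sqrt (2 * pi) / e) ^ DIM('a) * gaussian ((2 * pi / e) *\<^sub>R y))"
    unfolding eq integral_lborel_scale(2)[OF e i] gaussian_FT(2)
    by (simp add: scaleR_conv_of_real power_divide)
qed

lemma gaussian_approx_identity:
  fixes h :: "'a::euclidean_space \<Rightarrow> complex"
  assumes cont: "continuous_on UNIV h" and bd: "\<And>y. norm (h y) \<le> M"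
    and e: "\<And>n. e n > 0" "e \<longlonglongrightarrow> 0"
  shows "(\<lambda>n. LINT y|lborel. complex_of_real ((sqrt (2 * pi) / e n) ^ DIM('a) * gaussian ((2 * pi / e n) *\<^sub>R y)) * h y) \<longlonglongrightarrow> h 0"
proof -
  let ?s = "sqrt (2 * pi) ^ DIM('a)"
  have s: "?s > 0" by simp
  have m [measurable]: "h \<in> borel_measurable borel" by (rule borel_measurable_continuous_onI[OF cont])
  have eq: "(LINT y|lborel. complex_of_real ((sqrt (2 * pi) / c) ^ DIM('a) * gaussian ((2 * pi / c) *\<^sub>R y)) * h y)
     = complex_of_real (1 / ?s) * (LINT u|lborel. complex_of_real (gaussian u) * h ((c / (2 * pi)) *\<^sub>R u))" if c: "c > 0" for c
  proof -
    let ?g = "\<lambda>u. complex_of_real (gaussian u) * h ((c / (2 * pi)) *\<^sub>R u)"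
    have i: "integrable lborel ?g"
      by (rule Bochner_Integration.integrable_bound[OF integrable_mult_left[OF integrable_gaussian, of M]])
         (auto simp: norm_mult abs_mult intro!: AE_I2 mult_left_mono order_trans[OF bd abs_ge_self])
    have "(LINT y|lborel. ?g ((2 * pi / c) *\<^sub>R y)) = (1 / (2 * pi / c) ^ DIM('a)) *\<^sub>R (LINT u|lborel. ?g u)"
      using c by (intro integral_lborel_scale(2) i) auto
    moreover have "?g ((2 * pi / c) *\<^sub>R y) = complex_of_real (gaussian ((2 * pi / c) *\<^sub>R y)) * h y" for y
    proof -
      have "(c / (2 * pi)) *\<^sub>R (2 * pi / c) *\<^sub>R y = y" using c by simp
      then show ?thesis by (simp only:)
    qed
    ultimately have *: "(LINT y|lborel. complex_of_real (gaussian ((2 * pi / c) *\<^sub>R y)) * h y)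
       = (1 / (2 * pi / c) ^ DIM('a)) *\<^sub>R (LINT u|lborel. ?g u)" by (simp only:)
    have sc: "(sqrt (2 * pi) / c) ^ DIM('a) * (1 / (2 * pi / c) ^ DIM('a)) = 1 / ?s"
    proof -
      have "sqrt (2 * pi) / c * (c / (2 * pi)) = 1 / sqrt (2 * pi)"
        using c by (simp add: real_div_sqrt field_simps)
      then show ?thesis by (simp add: power_mult_distrib[symmetric] power_divide[symmetric] power_one_over[symmetric] flip: power_mult_distrib)
    qed
    have "(LINT y|lborel. complex_of_real ((sqrt (2 * pi) / c) ^ DIM('a) * gaussian ((2 * pi / c) *\<^sub>R y)) * h y)
      = complex_of_real ((sqrt (2 * pi) / c) ^ DIM('a)) * (LINT y|lborel. complex_of_real (gaussian ((2 * pi / c) *\<^sub>R y)) * h y)"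
      by (simp add: mult.assoc)
    also have "\<dots> = complex_of_real ((sqrt (2 * pi) / c) ^ DIM('a) * (1 / (2 * pi / c) ^ DIM('a))) * (LINT u|lborel. ?g u)"
      unfolding * by (simp only: scaleR_conv_of_real of_real_mult mult.assoc)
    finally show ?thesis unfolding sc .
  qed
  have "(\<lambda>n. LINT u|lborel. complex_of_real (gaussian u) * h ((e n / (2 * pi)) *\<^sub>R u)) \<longlonglongrightarrow> (LINT u|lborel. complex_of_real (gaussian (u::'a)) * h 0)"
  proof (rule integral_dominated_convergence[where w="\<lambda>u. gaussian u * M"])
    show "AE u in lborel. (\<lambda>n. complex_of_real (gaussian u) * h ((e n / (2 * pi)) *\<^sub>R u)) \<longlonglongrightarrow> complex_of_real (gaussian u) * h 0"
    proof (rule AE_I2, rule tendsto_mult[OF tendsto_const])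
      fix u :: 'a
      have "(\<lambda>n. (e n / (2 * pi)) *\<^sub>R u) \<longlonglongrightarrow> (0 / (2 * pi)) *\<^sub>R u"
        by (intro tendsto_intros e) auto
      then show "(\<lambda>n. h ((e n / (2 * pi)) *\<^sub>R u)) \<longlonglongrightarrow> h 0"
        using cont by (auto simp: continuous_on_eq_continuous_at intro: isCont_tendsto_compose)
    qed
    show "AE u in lborel. norm (complex_of_real (gaussian u) * h ((e n / (2 * pi)) *\<^sub>R u)) \<le> gaussian u * M" for n
      using bd by (auto simp: norm_mult intro!: AE_I2 mult_left_mono)
  qed (use integrable_gaussian in auto)
  also have "(LINT u|lborel. complex_of_real (gaussian (u::'a)) * h 0) = complex_of_real ?s * h 0"
  proof -
    have "(LINT u|lborel. complex_of_real (gaussian (u::'a)) * h 0) = (LINT u|lborel. complex_of_real (gaussian (u::'a))) * h 0"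
      by simp
    then show ?thesis by (simp add: integral_gaussian)
  qed
  finally have "(\<lambda>n. complex_of_real (1 / ?s) * (LINT u|lborel. complex_of_real (gaussian u) * h ((e n / (2 * pi)) *\<^sub>R u)))
     \<longlonglongrightarrow> complex_of_real (1 / ?s) * (complex_of_real ?s * h 0)" by (intro tendsto_intros)
  moreover have "complex_of_real (1 / ?s) * (complex_of_real ?s * h 0) = h 0" using s by simp
  ultimately show ?thesis by (simp only: eq[OF e(1)])
qed

lemma integrable_cross_correlation:
  fixes P Q :: "'a::euclidean_space \<Rightarrow> complex"
  assumes P: "integrable lborel P" and Q: "integrable lborel Q"
  shows "integrable (lborel \<Otimes>\<^sub>M lborel) (\<lambda>(y, t). P t * Q (t + y))"
    and "(LINT y|lborel. LINT t|lborel. P t * Q (t + y)) = (LINT t|lborel. P t) * (LINT t|lborel. Q t)"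
    and "(\<integral>\<^sup>+y. \<integral>\<^sup>+t. norm (P t * Q (t + y)) \<partial>lborel \<partial>lborel) = (\<integral>\<^sup>+t. norm (P t) \<partial>lborel) * (\<integral>\<^sup>+t. norm (Q t) \<partial>lborel)"
proof -
  have [measurable]: "P \<in> borel_measurable borel" "Q \<in> borel_measurable borel"
    using P Q by (auto dest: borel_measurable_integrable)
  have "(\<integral>\<^sup>+y. \<integral>\<^sup>+t. norm (P t * Q (t + y)) \<partial>lborel \<partial>lborel) = (\<integral>\<^sup>+t. \<integral>\<^sup>+y. norm (P t * Q (t + y)) \<partial>lborel \<partial>lborel)"
    by (intro lborel_pair.Fubini') measurable
  also have "\<dots> = (\<integral>\<^sup>+t. norm (P t) * (\<integral>\<^sup>+y. norm (Q (y + t)) \<partial>lborel) \<partial>lborel)"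
    by (simp add: norm_mult ennreal_mult' nn_integral_cmult add.commute)
  also have "\<dots> = (\<integral>\<^sup>+t. norm (P t) * (\<integral>\<^sup>+y. norm (Q y) \<partial>lborel) \<partial>lborel)"
    by (subst nn_integral_lborel_translate(1)[of "\<lambda>y. ennreal (norm (Q y))"]) auto
  also have "\<dots> = (\<integral>\<^sup>+t. norm (P t) \<partial>lborel) * (\<integral>\<^sup>+t. norm (Q t) \<partial>lborel)"
    by (simp add: nn_integral_multc)
  finally show nn: "(\<integral>\<^sup>+y. \<integral>\<^sup>+t. norm (P t * Q (t + y)) \<partial>lborel \<partial>lborel) = (\<integral>\<^sup>+t. norm (P t) \<partial>lborel) * (\<integral>\<^sup>+t. norm (Q t) \<partial>lborel)" .
  have "(\<integral>\<^sup>+z. norm (case z of (y, t) \<Rightarrow> P t * Q (t + y)) \<partial>(lborel \<Otimes>\<^sub>M lborel))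
     = (\<integral>\<^sup>+y. \<integral>\<^sup>+t. norm (P t * Q (t + y)) \<partial>lborel \<partial>lborel)"
    by (subst lborel.nn_integral_fst[symmetric]) (auto simp: case_prod_unfold)
  also have "\<dots> < \<infinity>" unfolding nn
    using P Q by (auto simp: integrable_iff_bounded ennreal_mult_less_top)
  finally show i: "integrable (lborel \<Otimes>\<^sub>M lborel) (\<lambda>(y, t). P t * Q (t + y))"
    by (intro integrableI_bounded) (auto simp: case_prod_unfold)
  have "(LINT y|lborel. LINT t|lborel. P t * Q (t + y)) = (LINT t|lborel. LINT y|lborel. P t * Q (t + y))"
    using lborel_pair.Fubini_integral[of "\<lambda>y t. P t * Q (t + y)"] i by simp
  also have "\<dots> = (LINT t|lborel. P t * (LINT y|lborel. Q y))"
    using integral_lborel_translate(1)[of Q] by (simp add: add.commute)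
  finally show "(LINT y|lborel. LINT t|lborel. P t * Q (t + y)) = (LINT t|lborel. P t) * (LINT t|lborel. Q t)"
    by simp
qed


lemma integrable_cross_correlation_diff:
  fixes P Q :: "'a::euclidean_space \<Rightarrow> complex"
  assumes P: "integrable lborel P" and Q: "integrable lborel Q"
  shows "(LINT x|lborel. LINT t|lborel. P t * Q (t - x)) = (LINT t|lborel. P t) * (LINT t|lborel. Q t)"
    and "(\<integral>\<^sup>+x. \<integral>\<^sup>+t. norm (P t * Q (t - x)) \<partial>lborel \<partial>lborel) = (\<integral>\<^sup>+t. norm (P t) \<partial>lborel) * (\<integral>\<^sup>+t. norm (Q t) \<partial>lborel)"
proof -
  have [measurable]: "P \<in> borel_measurable borel" "Q \<in> borel_measurable borel"
    using P Q by (auto dest: borel_measurable_integrable)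
  show "(LINT x|lborel. LINT t|lborel. P t * Q (t - x)) = (LINT t|lborel. P t) * (LINT t|lborel. Q t)"
    unfolding integrable_cross_correlation(2)[OF P Q, symmetric]
    using integral_lborel_reflect[of "\<lambda>y. LINT t|lborel. P t * Q (t + y)" 0] by simp
  show "(\<integral>\<^sup>+x. \<integral>\<^sup>+t. norm (P t * Q (t - x)) \<partial>lborel \<partial>lborel) = (\<integral>\<^sup>+t. norm (P t) \<partial>lborel) * (\<integral>\<^sup>+t. norm (Q t) \<partial>lborel)"
    unfolding integrable_cross_correlation(3)[OF P Q, symmetric]
    using nn_integral_lborel_reflect[of "\<lambda>y. \<integral>\<^sup>+t. norm (P t * Q (t + y)) \<partial>lborel" 0] by simp
qed

lemma nn_integral_norm_mult_L2:
  assumes "f \<in> L2_space" "g \<in> L2_space"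
  shows "(\<integral>\<^sup>+t. norm (f t * g t) \<partial>lborel) \<le> ennreal (L2_nrm f * L2_nrm g)"
proof -
  have "(\<integral>\<^sup>+t. norm (f t * g t) \<partial>lborel) = ennreal (LINT t|lborel. norm (f t * g t))"
    by (rule nn_integral_eq_integral) (auto intro: L2_mult_integrable[OF assms])
  then show ?thesis using L2_Cauchy_Schwarz_abs[OF assms] by (simp add: norm_mult)
qed

theorem STFT_orthogonality:
  fixes a b c d :: "real ^ 'n \<Rightarrow> complex"
  assumes a: "a \<in> L2_space" and b: "b \<in> L2_space" and c: "c \<in> L2_space" and d: "d \<in> L2_space"
    and int: "integrable lborel (\<lambda>z. STFT b a z * cnj (STFT d c z))"
  shows "(LINT z|lborel. STFT b a z * cnj (STFT d c z)) = L2_inner a c * cnj (L2_inner b d)"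
proof -
  note [measurable] = L2_measurable[OF a] L2_measurable[OF b] L2_measurable[OF c] L2_measurable[OF d]
  have regm: "(\<lambda>z. complex_of_real (gaussian (e *\<^sub>R snd z)) * (STFT b a z * cnj (STFT d c z))) \<in> borel_measurable borel" for e
    by (intro borel_measurable_continuous_onI continuous_intros continuous_STFT a b c d)
  have tr: "(\<lambda>t. f (t + y)) \<in> L2_space" "(\<lambda>t. f (t - y)) \<in> L2_space"
     "L2_nrm (\<lambda>t. f (t + y)) = L2_nrm f" "L2_nrm (\<lambda>t. f (t - y)) = L2_nrm f"
    if "f \<in> L2_space" for f :: "real ^ 'n \<Rightarrow> complex" and y
    using L2_translation[OF that, of "-y"] L2_translation[OF that, of y]
      L2_nrm_translation[of "-y" f] L2_nrm_translation[of y f] by (simp_all add: translation_def)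
  define \<alpha> where "\<alpha> = (\<lambda>x t. a t * cnj (b (t - x)))"
  define \<beta> where "\<beta> = (\<lambda>x t. d (t - x) * cnj (c t))"
  define C where "C = (\<lambda>x y. LINT t|lborel. \<alpha> x t * \<beta> x (t + y))"
  define P where "P = (\<lambda>y t. a t * cnj (c (t + y)))"
  define Q where "Q = (\<lambda>y u. cnj (b u) * d (u + y))"
  define \<Theta> where "\<Theta> = (\<lambda>y. (LINT t|lborel. P y t) * (LINT u|lborel. Q y u))"
  have \<alpha>i: "integrable lborel (\<alpha> x)" for x
    unfolding \<alpha>_def by (intro L2_inner_integrable a tr b)
  have \<beta>i: "integrable lborel (\<beta> x)" for x
    unfolding \<beta>_def by (intro L2_inner_integrable c tr d)
  have Pi: "integrable lborel (P y)" for y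
    unfolding P_def by (intro L2_inner_integrable a tr c)
  have Qi: "integrable lborel (Q y)" for y
    unfolding Q_def using L2_mult_integrable[OF L2_cnj[OF b] tr(1)[OF d]] by simp
  have \<alpha>m [measurable]: "(\<lambda>p. \<alpha> (f p) (h p)) \<in> borel_measurable M"
    "(\<lambda>p. \<beta> (f p) (h p)) \<in> borel_measurable M"
    if [measurable]: "f \<in> borel_measurable M" "h \<in> borel_measurable M" for f h and M :: "'z measure"
    unfolding \<alpha>_def \<beta>_def by measurable
  have Cm [measurable]: "(\<lambda>(x, y). C x y) \<in> borel_measurable (borel \<Otimes>\<^sub>M borel)"
    unfolding C_def by measurable
  have Cm1 [measurable]: "C x \<in> borel_measurable borel" for x
    unfolding C_def by measurable

  have prod: "STFT b a (x, w) * cnj (STFT d c (x, w)) = (LINT y|lborel. C x y * unimod (w \<bullet> y))" for x w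
  proof -
    let ?A = "\<lambda>t. \<alpha> x t * cnj (unimod (w \<bullet> t))" and ?B = "\<lambda>t. \<beta> x t * unimod (w \<bullet> t)"
    have iA: "integrable lborel ?A"
      by (rule Bochner_Integration.integrable_bound[OF \<alpha>i[of x]]) (auto simp: norm_mult)
    have iB: "integrable lborel ?B"
      by (rule Bochner_Integration.integrable_bound[OF \<beta>i[of x]]) (auto simp: norm_mult)
    have "STFT b a (x, w) = (LINT t|lborel. ?A t)"
      by (simp add: STFT_eq L2_inner_def tf_shift_apply \<alpha>_def mult_ac)
    moreover have "cnj (STFT d c (x, w)) = (LINT t|lborel. ?B t)"
      unfolding STFT_eq L2_inner_cnj by (simp add: L2_inner_def tf_shift_apply \<beta>_def mult_ac)
    moreover have AB: "?A t * ?B (t + y) = (\<alpha> x t * \<beta> x (t + y)) * unimod (w \<bullet> y)" for t y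
      by (simp add: inner_add_right unimod_add mult_ac)
    ultimately show ?thesis
      using integrable_cross_correlation(2)[OF iA iB, symmetric] unfolding AB C_def
      by (simp del: mult_eq_0_iff)
  qed
  have Ci: "integrable lborel (C x)" for x
    using lborel_pair.integrable_fst'[OF integrable_cross_correlation(1)[OF \<alpha>i[of x] \<beta>i[of x]]]
    by (simp add: C_def)
  have Cx: "(LINT x|lborel. C x y) = \<Theta> y" and
    Cb: "(\<integral>\<^sup>+x. norm (C x y) \<partial>lborel) \<le> ennreal ((L2_nrm a * L2_nrm c) * (L2_nrm b * L2_nrm d))" for y
  proof -
    have eq: "\<alpha> x t * \<beta> x (t + y) = P y t * Q y (t - x)" for x t
      by (simp add: \<alpha>_def \<beta>_def P_def Q_def algebra_simps)
    show "(LINT x|lborel. C x y) = \<Theta> y"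
      unfolding C_def eq \<Theta>_def by (rule integrable_cross_correlation_diff[OF Pi Qi])
    have "(\<integral>\<^sup>+x. norm (C x y) \<partial>lborel) \<le> (\<integral>\<^sup>+x. \<integral>\<^sup>+t. norm (P y t * Q y (t - x)) \<partial>lborel \<partial>lborel)"
      unfolding C_def eq
    proof (intro nn_integral_mono)
      fix x :: "real ^ 'n"
      show "ennreal (norm (LINT t|lborel. P y t * Q y (t - x))) \<le> (\<integral>\<^sup>+t. norm (P y t * Q y (t - x)) \<partial>lborel)"
        by (cases "integrable lborel (\<lambda>t. P y t * Q y (t - x))")
           (auto simp: not_integrable_integral_eq intro: integral_norm_bound_ennreal)
    qed
    also have "\<dots> = (\<integral>\<^sup>+t. norm (P y t) \<partial>lborel) * (\<integral>\<^sup>+t. norm (Q y t) \<partial>lborel)"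
      by (rule integrable_cross_correlation_diff[OF Pi Qi])
    also have "\<dots> \<le> ennreal (L2_nrm a * L2_nrm c) * ennreal (L2_nrm b * L2_nrm d)"
      using nn_integral_norm_mult_L2[OF a L2_cnj[OF tr(1)[OF c, of y]]]
         nn_integral_norm_mult_L2[OF L2_cnj[OF b] tr(1)[OF d, of y]]
      by (intro mult_mono) (simp_all add: P_def Q_def tr c d)
    finally show "(\<integral>\<^sup>+x. norm (C x y) \<partial>lborel) \<le> ennreal ((L2_nrm a * L2_nrm c) * (L2_nrm b * L2_nrm d))"
      by (simp add: ennreal_mult)
  qed
  have \<Theta>eq: "\<Theta> y = STFT c a (- y, 0) * cnj (STFT d b (- y, 0))" for y
    unfolding \<Theta>_def STFT_eq L2_inner_cnj by (simp add: L2_inner_def tf_shift_apply P_def Q_def mult_ac)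
  have \<Theta>c: "continuous_on UNIV \<Theta>"
    unfolding \<Theta>eq
    by (intro continuous_intros continuous_on_compose2[OF continuous_STFT[OF a c, of UNIV]]
         continuous_on_compose2[OF continuous_STFT[OF b d, of UNIV]]) auto
  have \<Theta>b: "norm (\<Theta> y) \<le> (L2_nrm a * L2_nrm c) * (L2_nrm b * L2_nrm d)" for y
    unfolding \<Theta>eq norm_mult complex_mod_cnj by (intro mult_mono STFT_bound a b c d) auto
  define \<rho> where "\<rho> = (\<lambda>e y. complex_of_real ((sqrt (2 * pi) / e) ^ DIM(real ^ 'n) * gaussian ((2 * pi / e) *\<^sub>R (y :: real ^ 'n))))"
  have \<rho>m [measurable]: "\<rho> e \<in> borel_measurable borel" for e unfolding \<rho>_def by measurable
  have \<rho>i: "integrable lborel (\<rho> e)" if "e > 0" for e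
    unfolding \<rho>_def of_real_mult
    by (intro integrable_mult_right integrable_of_real integral_lborel_scale integrable_gaussian) (use that in auto)

  have reg: "(LINT z|lborel. complex_of_real (gaussian (e *\<^sub>R snd z)) * (STFT b a z * cnj (STFT d c z)))
     = (LINT y|lborel. \<rho> e y * \<Theta> y)" if e: "e > 0" for e
  proof -
    have i1: "integrable (lborel \<Otimes>\<^sub>M lborel) (\<lambda>z. complex_of_real (gaussian (e *\<^sub>R snd z)) * (STFT b a z * cnj (STFT d c z)))"
    proof (rule Bochner_Integration.integrable_bound)
      show "integrable (lborel \<Otimes>\<^sub>M lborel) (\<lambda>z. STFT b a z * cnj (STFT d c z))"
        using int by (simp add: lborel_prod)
      show "AE z in lborel \<Otimes>\<^sub>M lborel. norm (complex_of_real (gaussian (e *\<^sub>R snd z)) * (STFT b a z * cnj (STFT d c z)))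
         \<le> norm (STFT b a z * cnj (STFT d c z))"
        using gaussian_le_1 by (auto simp: norm_mult intro!: AE_I2 mult_left_le_one_le)
      show "(\<lambda>z. complex_of_real (gaussian (e *\<^sub>R snd z)) * (STFT b a z * cnj (STFT d c z))) \<in> borel_measurable (lborel \<Otimes>\<^sub>M lborel)"
        unfolding lborel_prod using regm by simp
    qed
    have "(LINT z|lborel. complex_of_real (gaussian (e *\<^sub>R snd z)) * (STFT b a z * cnj (STFT d c z)))
       = (LINT x|lborel. LINT w|lborel. complex_of_real (gaussian (e *\<^sub>R w)) * (STFT b a (x, w) * cnj (STFT d c (x, w))))"
      using lborel_pair.integral_fst'[OF i1] by (simp add: lborel_prod)
    also have "\<dots> = (LINT x|lborel. LINT y|lborel. \<rho> e y * C x y)"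
    proof (rule Bochner_Integration.integral_cong[OF refl])
      fix x
      have m: "(\<lambda>(w, y). complex_of_real (gaussian (e *\<^sub>R w)) * (C x y * unimod (w \<bullet> y))) \<in> borel_measurable (lborel \<Otimes>\<^sub>M lborel)"
        by measurable
      have i2: "integrable (lborel \<Otimes>\<^sub>M lborel) (\<lambda>(w, y). complex_of_real (gaussian (e *\<^sub>R w)) * (C x y * unimod (w \<bullet> y)))"
      proof (rule integrableI_bounded[OF m])
        have "(\<integral>\<^sup>+p. norm (case p of (w, y) \<Rightarrow> complex_of_real (gaussian (e *\<^sub>R w)) * (C x y * unimod (w \<bullet> y))) \<partial>(lborel \<Otimes>\<^sub>M lborel))
          = (\<integral>\<^sup>+w. \<integral>\<^sup>+y. ennreal (norm (gaussian (e *\<^sub>R w :: real ^ 'n))) * norm (C x y) \<partial>lborel \<partial>lborel)"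
          by (subst lborel.nn_integral_fst[symmetric]) (auto simp: norm_mult ennreal_mult' case_prod_unfold)
        also have "\<dots> = (\<integral>\<^sup>+w. norm (gaussian (e *\<^sub>R w :: real ^ 'n)) \<partial>lborel) * (\<integral>\<^sup>+y. norm (C x y) \<partial>lborel)"
          by (simp add: nn_integral_cmult nn_integral_multc)
        also have "\<dots> < \<infinity>"
          using Ci[of x] integral_lborel_scale(1)[OF e integrable_gaussian]
          by (auto simp: integrable_iff_bounded ennreal_mult_less_top)
        finally show "(\<integral>\<^sup>+p. norm (case p of (w, y) \<Rightarrow> complex_of_real (gaussian (e *\<^sub>R w)) * (C x y * unimod (w \<bullet> y))) \<partial>(lborel \<Otimes>\<^sub>M lborel)) < \<infinity>" .
      qed
      have "(LINT w|lborel. complex_of_real (gaussian (e *\<^sub>R w)) * (STFT b a (x, w) * cnj (STFT d c (x, w))))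
         = (LINT w|lborel. LINT y|lborel. complex_of_real (gaussian (e *\<^sub>R w)) * (C x y * unimod (w \<bullet> y)))"
        unfolding prod by simp
      also have "\<dots> = (LINT y|lborel. LINT w|lborel. complex_of_real (gaussian (e *\<^sub>R w)) * (C x y * unimod (w \<bullet> y)))"
        using lborel_pair.Fubini_integral[OF i2] by simp
      also have "\<dots> = (LINT y|lborel. \<rho> e y * C x y)"
      proof (rule Bochner_Integration.integral_cong[OF refl])
        fix y
        have "(LINT w|lborel. complex_of_real (gaussian (e *\<^sub>R w)) * (C x y * unimod (w \<bullet> y)))
          = (LINT w|lborel. complex_of_real (gaussian (e *\<^sub>R w)) * unimod (w \<bullet> y) * C x y)"
          by (simp add: mult_ac)
        also have "\<dots> = (LINT w|lborel. complex_of_real (gaussian (e *\<^sub>R w)) * unimod (w \<bullet> y)) * C x y"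
          by (rule Bochner_Integration.integral_mult_left) (rule scaled_gaussian_FT(1)[OF e])
        finally show "(LINT w|lborel. complex_of_real (gaussian (e *\<^sub>R w)) * (C x y * unimod (w \<bullet> y))) = \<rho> e y * C x y"
          unfolding scaled_gaussian_FT(2)[OF e] \<rho>_def .
      qed
      finally show "(LINT w|lborel. complex_of_real (gaussian (e *\<^sub>R w)) * (STFT b a (x, w) * cnj (STFT d c (x, w))))
         = (LINT y|lborel. \<rho> e y * C x y)" .
    qed
    also have "\<dots> = (LINT y|lborel. LINT x|lborel. \<rho> e y * C x y)"
    proof -
      have m: "(\<lambda>(x, y). \<rho> e y * C x y) \<in> borel_measurable (lborel \<Otimes>\<^sub>M lborel)" by measurable
      have "integrable (lborel \<Otimes>\<^sub>M lborel) (\<lambda>(x, y). \<rho> e y * C x y)"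
      proof (rule integrableI_bounded[OF m])
        have "(\<integral>\<^sup>+p. norm (case p of (x, y) \<Rightarrow> \<rho> e y * C x y) \<partial>(lborel \<Otimes>\<^sub>M lborel))
          = (\<integral>\<^sup>+y. \<integral>\<^sup>+x. ennreal (norm (\<rho> e y)) * norm (C x y) \<partial>lborel \<partial>lborel)"
          by (subst lborel_pair.nn_integral_snd[symmetric]) (auto simp: norm_mult ennreal_mult' case_prod_unfold)
        also have "\<dots> = (\<integral>\<^sup>+y. ennreal (norm (\<rho> e y)) * (\<integral>\<^sup>+x. norm (C x y) \<partial>lborel) \<partial>lborel)"
          by (simp add: nn_integral_cmult)
        also have "\<dots> \<le> (\<integral>\<^sup>+y. ennreal (norm (\<rho> e y)) * ennreal ((L2_nrm a * L2_nrm c) * (L2_nrm b * L2_nrm d)) \<partial>lborel)"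
          by (intro nn_integral_mono mult_left_mono Cb) auto
        also have "\<dots> < \<infinity>"
          using \<rho>i[OF e] by (simp add: nn_integral_multc integrable_iff_bounded ennreal_mult_less_top)
        finally show "(\<integral>\<^sup>+p. norm (case p of (x, y) \<Rightarrow> \<rho> e y * C x y) \<partial>(lborel \<Otimes>\<^sub>M lborel)) < \<infinity>" .
      qed
      from lborel_pair.Fubini_integral[OF this] show ?thesis by simp
    qed
    also have "\<dots> = (LINT y|lborel. \<rho> e y * \<Theta> y)"
      by (simp add: Cx)
    finally show ?thesis .
  qed
  define e where "e = (\<lambda>n::nat. 1 / real (Suc n))"
  have e: "e n > 0" for n by (simp add: e_def)
  have e0: "e \<longlonglongrightarrow> 0" unfolding e_def by (rule LIMSEQ_Suc[OF lim_1_over_n])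
  have L1: "(\<lambda>n. LINT y|lborel. \<rho> (e n) y * \<Theta> y) \<longlonglongrightarrow> \<Theta> 0"
    unfolding \<rho>_def by (rule gaussian_approx_identity[OF \<Theta>c \<Theta>b e e0])
  have L2: "(\<lambda>n. LINT z|lborel. complex_of_real (gaussian (e n *\<^sub>R snd z)) * (STFT b a z * cnj (STFT d c z)))
    \<longlonglongrightarrow> (LINT z|lborel. STFT b a z * cnj (STFT d c z))"
  proof (rule integral_dominated_convergence[where w="\<lambda>z. norm (STFT b a z * cnj (STFT d c z))"])
    show "AE z in lborel. (\<lambda>n. complex_of_real (gaussian (e n *\<^sub>R snd z)) * (STFT b a z * cnj (STFT d c z)))
       \<longlonglongrightarrow> STFT b a z * cnj (STFT d c z)"
    proof (rule AE_I2)
      fix z :: "(real ^ 'n) \<times> (real ^ 'n)"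
      have z0: "(\<lambda>n. e n *\<^sub>R snd z) \<longlonglongrightarrow> 0 *\<^sub>R snd z" by (intro tendsto_intros e0)
      have "isCont gaussian (0 *\<^sub>R snd z)"
        using continuous_on_gaussian[of UNIV "\<lambda>x. x"] by (auto simp: continuous_on_eq_continuous_at)
      then have "(\<lambda>n. gaussian (e n *\<^sub>R snd z)) \<longlonglongrightarrow> gaussian (0 *\<^sub>R snd z)"
        by (rule isCont_tendsto_compose[OF _ z0])
      then have "(\<lambda>n. complex_of_real (gaussian (e n *\<^sub>R snd z)) * (STFT b a z * cnj (STFT d c z)))
        \<longlonglongrightarrow> complex_of_real (gaussian (0 *\<^sub>R snd z)) * (STFT b a z * cnj (STFT d c z))"
        by (intro tendsto_intros)
      then show "(\<lambda>n. complex_of_real (gaussian (e n *\<^sub>R snd z)) * (STFT b a z * cnj (STFT d c z)))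
       \<longlonglongrightarrow> STFT b a z * cnj (STFT d c z)" by (simp add: gaussian_def)
    qed
    show "AE z in lborel. norm (complex_of_real (gaussian (e n *\<^sub>R snd z)) * (STFT b a z * cnj (STFT d c z)))
         \<le> norm (STFT b a z * cnj (STFT d c z))" for n
        using gaussian_le_1 by (auto simp: norm_mult intro!: AE_I2 mult_left_le_one_le)
  qed (use int regm in auto)
  have "(LINT z|lborel. STFT b a z * cnj (STFT d c z)) = \<Theta> 0"
    by (rule LIMSEQ_unique[OF L2[unfolded reg[OF e]] L1])
  also have "\<Theta> 0 = L2_inner a c * cnj (L2_inner b d)"
    unfolding \<Theta>eq STFT_eq by (simp add: zero_prod_def[symmetric])
  finally show ?thesis .
qed

section \<open>Norm bounds and weighted convolution\<close>

text \<open>For \<open>C \<ge> 0\<close>, \<open>Lp_le M p F C\<close> says that \<open>F\<close> lies in \<open>L\<^sup>p\<close> with norm at most \<open>C\<close>.\<close>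

definition Lp_le :: "'a measure \<Rightarrow> ennreal \<Rightarrow> ('a \<Rightarrow> real) \<Rightarrow> real \<Rightarrow> bool" where
  "Lp_le M p F C \<longleftrightarrow> F \<in> borel_measurable M \<and>
     (if p = \<infinity> then AE x in M. \<bar>F x\<bar> \<le> C
      else (\<integral>\<^sup>+x. ennreal (\<bar>F x\<bar> powr enn2real p) \<partial>M) \<le> ennreal (C powr enn2real p))"

lemma Lp_leD: "Lp_le M p F C \<Longrightarrow> F \<in> borel_measurable M"
  by (simp add: Lp_le_def)

lemma enn2real_ge_1: "1 \<le> p \<Longrightarrow> p \<noteq> \<infinity> \<Longrightarrow> 1 \<le> enn2real p"
  using enn2real_mono[of 1 p] by (simp add: less_top)

lemma Lp_le_mono:
  assumes F: "Lp_le M p F C" and G: "G \<in> borel_measurable M" and le: "\<And>x. x \<in> space M \<Longrightarrow> \<bar>G x\<bar> \<le> \<bar>F x\<bar>"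
    and C: "0 \<le> C" "C \<le> D"
  shows "Lp_le M p G D"
proof (cases "p = \<infinity>")
  case True
  have "AE x in M. \<bar>F x\<bar> \<le> C" using F True by (simp add: Lp_le_def)
  then have "AE x in M. \<bar>G x\<bar> \<le> D"
    using AE_space by eventually_elim (use le C in force)
  then show ?thesis using True G by (simp add: Lp_le_def)
next
  case False
  have "(\<integral>\<^sup>+x. ennreal (\<bar>G x\<bar> powr enn2real p) \<partial>M) \<le> (\<integral>\<^sup>+x. ennreal (\<bar>F x\<bar> powr enn2real p) \<partial>M)"
    by (intro nn_integral_mono ennreal_leI powr_mono2 le) auto
  also have "\<dots> \<le> ennreal (C powr enn2real p)" using F False by (simp add: Lp_le_def)
  also have "\<dots> \<le> ennreal (D powr enn2real p)"
    using C by (intro ennreal_leI powr_mono2) auto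
  finally show ?thesis using False G by (simp add: Lp_le_def)
qed

lemma Lp_le_scale:
  assumes F: "Lp_le M p F C" and C: "0 \<le> C"
  shows "Lp_le M p (\<lambda>x. c * F x) (\<bar>c\<bar> * C)"
proof (cases "p = \<infinity>")
  case True
  have "AE x in M. \<bar>F x\<bar> \<le> C" using F True by (simp add: Lp_le_def)
  then have "AE x in M. \<bar>c * F x\<bar> \<le> \<bar>c\<bar> * C"
    by eventually_elim (simp add: abs_mult mult_left_mono)
  then show ?thesis using True Lp_leD[OF F] by (simp add: Lp_le_def)
next
  case False
  have [measurable]: "F \<in> borel_measurable M" using F by (rule Lp_leD)
  have "(\<integral>\<^sup>+x. ennreal (\<bar>c * F x\<bar> powr enn2real p) \<partial>M)
      = (\<integral>\<^sup>+x. ennreal (\<bar>c\<bar> powr enn2real p) * ennreal (\<bar>F x\<bar> powr enn2real p) \<partial>M)"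
    by (simp add: abs_mult powr_mult ennreal_mult)
  also have "\<dots> = ennreal (\<bar>c\<bar> powr enn2real p) * (\<integral>\<^sup>+x. ennreal (\<bar>F x\<bar> powr enn2real p) \<partial>M)"
    by (rule nn_integral_cmult) measurable
  also have "\<dots> \<le> ennreal (\<bar>c\<bar> powr enn2real p) * ennreal (C powr enn2real p)"
    using F False by (intro mult_left_mono) (auto simp: Lp_le_def)
  also have "\<dots> = ennreal ((\<bar>c\<bar> * C) powr enn2real p)"
    using C by (simp add: powr_mult ennreal_mult)
  finally show ?thesis using False by (simp add: Lp_le_def)
qed

lemma powr_tangent:
  fixes t s q :: real
  assumes q: "q \<ge> 1" and t: "t \<ge> 0" and s: "s > 0"
  shows "t \<le> s powr (1 - q) / q * t powr q + s * (q - 1) / q"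
proof (cases "t = 0")
  case True
  then show ?thesis using q s by simp
next
  case False
  then have t: "t > 0" using t by simp
  have "(t powr q * s powr (1 - q)) powr (1 / q) * s powr ((q - 1) / q) \<le> 1 / q * (t powr q * s powr (1 - q)) + (q - 1) / q * s"
    using q s t by (intro Youngs_inequality_0) (auto simp: field_simps)
  moreover have "(t powr q * s powr (1 - q)) powr (1 / q) * s powr ((q - 1) / q) = t"
  proof -
    have "(t powr q * s powr (1 - q)) powr (1 / q) = t * s powr ((1 - q) / q)"
      using q t s by (simp add: powr_mult powr_powr)
    then show ?thesis using s q by (simp add: powr_add[symmetric] add_divide_distrib[symmetric])
  qed
  ultimately show ?thesis by (simp add: mult_ac)
qed

text \<open>Minkowski's integral inequality. With \<open>s = h x / D\<close> the tangent of \<open>t\<^sup>q\<close> at \<open>s\<close> turns the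
  pointwise bound into \<open>h\<^sup>q \<le> D\<^bsup>q-1\<^esup> \<integral> \<Phi> f\<^sup>q\<close>.\<close>

lemma Lp_le_integral:
  assumes M: "sigma_finite_measure M" and N: "sigma_finite_measure N"
    and p: "1 \<le> p"
    and h: "h \<in> borel_measurable M" and \<Phi>: "\<Phi> \<in> borel_measurable N"
    and f: "(\<lambda>(x, z). f z x) \<in> borel_measurable (M \<Otimes>\<^sub>M N)"
    and hle: "\<And>x. x \<in> space M \<Longrightarrow> ennreal \<bar>h x\<bar> \<le> (\<integral>\<^sup>+z. \<Phi> z * ennreal \<bar>f z x\<bar> \<partial>N)"
    and D: "(\<integral>\<^sup>+z. \<Phi> z \<partial>N) \<le> ennreal D" "0 < D"
    and C: "\<And>z. z \<in> space N \<Longrightarrow> Lp_le M p (f z) C" "0 \<le> C"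
  shows "Lp_le M p h (D * C)"
proof -
  interpret pair_sigma_finite M N by (rule pair_sigma_finite.intro[OF M N])
  note [measurable] = h \<Phi> f
  have fx [measurable]: "(\<lambda>z. f z x) \<in> borel_measurable N" if "x \<in> space M" for x
    using measurable_compose[OF measurable_Pair1'[OF that, of N] f] by simp
  show ?thesis
  proof (cases "p = \<infinity>")
    case True
    have "AE z in N. AE x in M. \<bar>f z x\<bar> \<le> C"
      using C(1) True by (auto simp: Lp_le_def intro!: AE_I2)
    moreover have "{x \<in> space (M \<Otimes>\<^sub>M N). \<bar>f (snd x) (fst x)\<bar> \<le> C} \<in> sets (M \<Otimes>\<^sub>M N)"
      using f by measurable
    ultimately have "AE x in M. AE z in N. \<bar>f z x\<bar> \<le> C"
      by (subst AE_commute) (auto simp: case_prod_unfold)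
    then have "AE x in M. \<bar>h x\<bar> \<le> D * C"
      using AE_space
    proof eventually_elim
      case (elim x)
      have "ennreal \<bar>h x\<bar> \<le> (\<integral>\<^sup>+z. \<Phi> z * ennreal \<bar>f z x\<bar> \<partial>N)" using hle elim by simp
      also have "\<dots> \<le> (\<integral>\<^sup>+z. \<Phi> z * ennreal C \<partial>N)"
        using elim(1) by (intro nn_integral_mono_AE) (auto elim!: eventually_mono intro!: mult_left_mono ennreal_leI)
      also have "\<dots> = (\<integral>\<^sup>+z. \<Phi> z \<partial>N) * ennreal C" by (rule nn_integral_multc) measurable
      also have "\<dots> \<le> ennreal D * ennreal C" by (intro mult_right_mono D) auto
      also have "\<dots> = ennreal (D * C)" using C(2) D(2) by (simp add: ennreal_mult)
      finally show ?case using C(2) D(2) by (simp add: ennreal_le_iff)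
    qed
    then show ?thesis using True h by (simp add: Lp_le_def)
  next
    case False
    define q where "q = enn2real p"
    have q: "1 \<le> q" unfolding q_def using p False by (rule enn2real_ge_1)
    have pt: "ennreal (\<bar>h x\<bar> powr q) \<le> ennreal (D powr (q - 1)) * (\<integral>\<^sup>+z. \<Phi> z * ennreal (\<bar>f z x\<bar> powr q) \<partial>N)"
      if x: "x \<in> space M" for x
    proof (cases "h x = 0")
      case True
      then show ?thesis using q by simp
    next
      case hx: False
      define s where "s = \<bar>h x\<bar> / D"
      have s: "s > 0" using hx D by (simp add: s_def)
      let ?I = "\<integral>\<^sup>+z. \<Phi> z * ennreal (\<bar>f z x\<bar> powr q) \<partial>N"
      note [measurable] = fx[OF x]
      have "ennreal \<bar>h x\<bar> \<le> (\<integral>\<^sup>+z. \<Phi> z * ennreal \<bar>f z x\<bar> \<partial>N)" by (rule hle[OF x])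
      also have "\<dots> \<le> (\<integral>\<^sup>+z. \<Phi> z * (ennreal (s powr (1 - q) / q) * ennreal (\<bar>f z x\<bar> powr q) + ennreal (s * (q - 1) / q)) \<partial>N)"
      proof (intro nn_integral_mono mult_left_mono)
        fix z
        have "ennreal \<bar>f z x\<bar> \<le> ennreal (s powr (1 - q) / q * \<bar>f z x\<bar> powr q + s * (q - 1) / q)"
          by (intro ennreal_leI powr_tangent q s) auto
        also have "\<dots> = ennreal (s powr (1 - q) / q) * ennreal (\<bar>f z x\<bar> powr q) + ennreal (s * (q - 1) / q)"
          using q s by (subst ennreal_plus) (auto simp: ennreal_mult[symmetric])
        finally show "ennreal \<bar>f z x\<bar> \<le> \<dots>" .
      qed auto
      also have "\<dots> = (\<integral>\<^sup>+z. ennreal (s powr (1 - q) / q) * (\<Phi> z * ennreal (\<bar>f z x\<bar> powr q)) + \<Phi> z * ennreal (s * (q - 1) / q) \<partial>N)"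
        by (simp add: distrib_left mult_ac)
      also have "\<dots> = ennreal (s powr (1 - q) / q) * ?I + (\<integral>\<^sup>+z. \<Phi> z \<partial>N) * ennreal (s * (q - 1) / q)"
        by (subst nn_integral_add) (auto simp: nn_integral_cmult nn_integral_multc)
      also have "\<dots> \<le> ennreal (s powr (1 - q) / q) * ?I + ennreal D * ennreal (s * (q - 1) / q)"
        by (intro add_left_mono mult_right_mono D) auto
      also have "ennreal D * ennreal (s * (q - 1) / q) = ennreal (\<bar>h x\<bar> * (q - 1) / q)"
        using D q s by (simp add: ennreal_mult[symmetric] s_def)
      finally have le: "ennreal \<bar>h x\<bar> \<le> ennreal (s powr (1 - q) / q) * ?I + ennreal (\<bar>h x\<bar> * (q - 1) / q)" .
      show ?thesis
      proof (cases "?I")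
        case top
        then show ?thesis using D by (simp add: ennreal_mult_top)
      next
        case (real I)
        have "ennreal \<bar>h x\<bar> \<le> ennreal (s powr (1 - q) / q * I + \<bar>h x\<bar> * (q - 1) / q)"
          using le real q by (simp add: ennreal_mult[symmetric] ennreal_plus[symmetric] del: ennreal_plus)
        then have "\<bar>h x\<bar> \<le> s powr (1 - q) / q * I + \<bar>h x\<bar> * (q - 1) / q"
          using real q by (subst (asm) ennreal_le_iff) auto
        then have "\<bar>h x\<bar> / q \<le> s powr (1 - q) / q * I"
          using q by (simp add: field_simps)
        then have "\<bar>h x\<bar> \<le> s powr (1 - q) * I" using q by (simp add: field_simps)
        then have "s powr (q - 1) * \<bar>h x\<bar> \<le> s powr (q - 1) * (s powr (1 - q) * I)"
          by (intro mult_left_mono) auto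
        also have "\<dots> = I" using s by (simp add: mult.assoc[symmetric] powr_add[symmetric])
        finally have "s powr (q - 1) * \<bar>h x\<bar> \<le> I" .
        moreover have "s powr (q - 1) * \<bar>h x\<bar> = \<bar>h x\<bar> powr q / D powr (q - 1)"
          using hx D by (simp add: s_def powr_divide powr_diff field_simps)
        ultimately have "\<bar>h x\<bar> powr q / D powr (q - 1) \<le> I" by (simp only:)
        then have "\<bar>h x\<bar> powr q \<le> D powr (q - 1) * I"
          using D by (simp add: pos_divide_le_eq mult.commute)
        then show ?thesis using real by (simp add: ennreal_mult[symmetric] ennreal_leI)
      qed
    qed
    have "(\<integral>\<^sup>+x. ennreal (\<bar>h x\<bar> powr q) \<partial>M)
       \<le> (\<integral>\<^sup>+x. ennreal (D powr (q - 1)) * (\<integral>\<^sup>+z. \<Phi> z * ennreal (\<bar>f z x\<bar> powr q) \<partial>N) \<partial>M)"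
      by (intro nn_integral_mono pt)
    also have "\<dots> = ennreal (D powr (q - 1)) * (\<integral>\<^sup>+x. \<integral>\<^sup>+z. \<Phi> z * ennreal (\<bar>f z x\<bar> powr q) \<partial>N \<partial>M)"
      by (rule nn_integral_cmult) measurable
    finally have le1: "(\<integral>\<^sup>+x. ennreal (\<bar>h x\<bar> powr q) \<partial>M)
       \<le> ennreal (D powr (q - 1)) * (\<integral>\<^sup>+x. \<integral>\<^sup>+z. \<Phi> z * ennreal (\<bar>f z x\<bar> powr q) \<partial>N \<partial>M)" .
    have "(\<integral>\<^sup>+x. \<integral>\<^sup>+z. \<Phi> z * ennreal (\<bar>f z x\<bar> powr q) \<partial>N \<partial>M) = (\<integral>\<^sup>+z. \<integral>\<^sup>+x. \<Phi> z * ennreal (\<bar>f z x\<bar> powr q) \<partial>M \<partial>N)"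
      by (rule Fubini'[symmetric]) measurable
    also have "\<dots> \<le> (\<integral>\<^sup>+z. \<Phi> z * ennreal (C powr q) \<partial>N)"
    proof (intro nn_integral_mono)
      fix z assume z: "z \<in> space N"
      have [measurable]: "f z \<in> borel_measurable M" using C(1)[OF z] by (rule Lp_leD)
      have "(\<integral>\<^sup>+x. \<Phi> z * ennreal (\<bar>f z x\<bar> powr q) \<partial>M) = \<Phi> z * (\<integral>\<^sup>+x. ennreal (\<bar>f z x\<bar> powr q) \<partial>M)"
        by (rule nn_integral_cmult) measurable
      also have "\<dots> \<le> \<Phi> z * ennreal (C powr q)"
        using C(1)[OF z] False by (intro mult_left_mono) (auto simp: Lp_le_def q_def)
      finally show "(\<integral>\<^sup>+x. \<Phi> z * ennreal (\<bar>f z x\<bar> powr q) \<partial>M) \<le> \<Phi> z * ennreal (C powr q)" .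
    qed
    also have "\<dots> = (\<integral>\<^sup>+z. \<Phi> z \<partial>N) * ennreal (C powr q)" by (rule nn_integral_multc) measurable
    also have "\<dots> \<le> ennreal D * ennreal (C powr q)" by (intro mult_right_mono D) auto
    finally have "(\<integral>\<^sup>+x. \<integral>\<^sup>+z. \<Phi> z * ennreal (\<bar>f z x\<bar> powr q) \<partial>N \<partial>M) \<le> ennreal D * ennreal (C powr q)" .
    then have "(\<integral>\<^sup>+x. ennreal (\<bar>h x\<bar> powr q) \<partial>M) \<le> ennreal (D powr (q - 1)) * (ennreal D * ennreal (C powr q))"
      by (intro order_trans[OF le1] mult_left_mono) auto
    also have "\<dots> = ennreal ((D * C) powr q)"
      using D C(2) by (simp add: ennreal_mult[symmetric] powr_mult powr_diff)
    finally show ?thesis using False h by (simp add: Lp_le_def q_def)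
  qed
qed

lemma Lp_le_add:
  assumes M: "sigma_finite_measure M" and p: "1 \<le> p"
    and F: "Lp_le M p F C" and G: "Lp_le M p G D" and C: "0 < C" "0 < D"
  shows "Lp_le M p (\<lambda>x. F x + G x) (C + D)"
proof -
  let ?f = "\<lambda>z x. if z then F x / C else G x / D"
  note [measurable] = Lp_leD[OF F] Lp_leD[OF G]
  have "Lp_le M p (\<lambda>x. F x + G x) ((C + D) * 1)"
  proof (rule Lp_le_integral[OF M sigma_finite_measure_count_space_countable p, where f="?f" and \<Phi>="\<lambda>z. if z then ennreal C else ennreal D"])
    show "countable (UNIV :: bool set)" by simp
    show "(\<lambda>(x, z). ?f z x) \<in> borel_measurable (M \<Otimes>\<^sub>M count_space UNIV)" by measurable
    show "ennreal \<bar>F x + G x\<bar> \<le> (\<integral>\<^sup>+z. (if z then ennreal C else ennreal D) * ennreal \<bar>?f z x\<bar> \<partial>count_space UNIV)" for x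
    proof -
      have "ennreal \<bar>F x + G x\<bar> \<le> ennreal \<bar>F x\<bar> + ennreal \<bar>G x\<bar>"
        by (simp add: ennreal_plus[symmetric] del: ennreal_plus)
      also have "\<dots> = ennreal C * ennreal \<bar>F x / C\<bar> + ennreal D * ennreal \<bar>G x / D\<bar>"
        using C by (simp add: ennreal_mult[symmetric])
      finally show ?thesis using C by (subst nn_integral_count_space_finite) (auto simp: UNIV_bool add.commute)
    qed
    show "(\<integral>\<^sup>+z. (if z then ennreal C else ennreal D) \<partial>count_space UNIV) \<le> ennreal (C + D)"
      using C by (subst nn_integral_count_space_finite) (auto simp: UNIV_bool add.commute)
    show "Lp_le M p (?f z) 1" for z
      using Lp_le_scale[OF F, of "1/C"] Lp_le_scale[OF G, of "1/D"] C by (cases z) auto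
  qed (use C in auto)
  then show ?thesis by simp
qed

lemma Lp_le_suminf:
  assumes M: "sigma_finite_measure M" and p: "1 \<le> p"
    and F: "\<And>n. Lp_le M p (F n) (C * (1/2) ^ n)" and C: "0 < C"
    and h: "h \<in> borel_measurable M"
    and hle: "\<And>x. x \<in> space M \<Longrightarrow> ennreal \<bar>h x\<bar> \<le> (\<Sum>n. ennreal \<bar>F n x\<bar>)"
  shows "Lp_le M p h (2 * C)"
proof (rule Lp_le_integral[OF M sigma_finite_measure_count_space_countable p h, where f="\<lambda>n x. 2 ^ n * F n x" and \<Phi>="\<lambda>n. ennreal ((1/2) ^ n)"])
  note [measurable] = Lp_leD[OF F]
  show "countable (UNIV :: nat set)" by simp
  show "(\<lambda>(x, n). 2 ^ n * F n x) \<in> borel_measurable (M \<Otimes>\<^sub>M count_space UNIV)" by measurable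
  show "ennreal \<bar>h x\<bar> \<le> (\<integral>\<^sup>+n. ennreal ((1/2) ^ n) * ennreal \<bar>2 ^ n * F n x\<bar> \<partial>count_space UNIV)" if "x \<in> space M" for x
    using hle[OF that] by (simp add: nn_integral_count_space_nat ennreal_mult[symmetric] abs_mult power_one_over)
  have "(\<integral>\<^sup>+n. ennreal ((1/2) ^ n) \<partial>count_space UNIV) = ennreal (\<Sum>n. (1/2) ^ n)"
    unfolding nn_integral_count_space_nat by (rule suminf_ennreal2) (auto intro: summable_geometric)
  then show "(\<integral>\<^sup>+n. ennreal ((1/2) ^ n) \<partial>count_space UNIV) \<le> ennreal 2"
    by (simp add: suminf_geometric)
  show "Lp_le M p (\<lambda>x. 2 ^ n * F n x) C" for n
    using Lp_le_scale[OF F[of n], of "2^n"] C by (simp add: power_one_over)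
qed (use C in auto)

lemma Lp_le_limit:
  assumes F: "\<And>n::nat. Lp_le M p (F n) C" and C: "0 \<le> C"
    and lim: "\<And>x. x \<in> space M \<Longrightarrow> (\<lambda>n. F n x) \<longlonglongrightarrow> G x"
  shows "Lp_le M p G C"
proof -
  note [measurable] = Lp_leD[OF F]
  have [measurable]: "G \<in> borel_measurable M" by (rule borel_measurable_LIMSEQ_metric[OF _ lim]) auto
  show ?thesis
  proof (cases "p = \<infinity>")
    case True
    have "AE x in M. \<forall>n. \<bar>F n x\<bar> \<le> C" using F True by (auto simp: Lp_le_def AE_all_countable)
    then have "AE x in M. \<bar>G x\<bar> \<le> C" using AE_space
    proof eventually_elim
      case (elim x)
      show ?case by (rule LIMSEQ_le_const2[OF tendsto_rabs[OF lim]]) (use elim in auto)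
    qed
    then show ?thesis using True by (simp add: Lp_le_def)
  next
    case False
    let ?q = "enn2real p"
    have "(\<integral>\<^sup>+x. ennreal (\<bar>G x\<bar> powr ?q) \<partial>M) \<le> (\<integral>\<^sup>+x. liminf (\<lambda>n. ennreal (\<bar>F n x\<bar> powr ?q)) \<partial>M)"
    proof (intro nn_integral_mono)
      fix x assume x: "x \<in> space M"
      show "ennreal (\<bar>G x\<bar> powr ?q) \<le> liminf (\<lambda>n. ennreal (\<bar>F n x\<bar> powr ?q))"
      proof (cases "G x = 0")
        case False
        then have "(\<lambda>n. ennreal (\<bar>F n x\<bar> powr ?q)) \<longlonglongrightarrow> ennreal (\<bar>G x\<bar> powr ?q)"
          by (intro tendsto_intros tendsto_ennrealI lim x) auto
        then show ?thesis using lim_imp_Liminf[of sequentially] by (metis order_refl trivial_limit_sequentially)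
      qed simp
    qed
    also have "\<dots> \<le> liminf (\<lambda>n. \<integral>\<^sup>+x. ennreal (\<bar>F n x\<bar> powr ?q) \<partial>M)"
      by (rule nn_integral_liminf) measurable
    also have "\<dots> \<le> liminf (\<lambda>n::nat. ennreal (C powr ?q))"
      using F False by (intro Liminf_mono) (auto simp: Lp_le_def)
    also have "\<dots> = ennreal (C powr ?q)" by (simp add: Liminf_const)
    finally show ?thesis using False by (simp add: Lp_le_def)
  qed
qed

lemma Lp_le_iff:
  assumes p: "1 \<le> p" and C: "0 \<le> C" and m: "F \<in> borel_measurable M"
  shows "Lp_le M p (\<lambda>x. norm (F x)) C \<longleftrightarrow> F \<in> Lp_space M p \<and> Lp_norm M p F \<le> C"
proof (cases "p = \<infinity>")
  case True
  have m' [measurable]: "(\<lambda>x. ennreal (norm (F x))) \<in> borel_measurable M" using m by measurable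
  have "(AE x in M. norm (F x) \<le> C) \<longleftrightarrow> esssup M (\<lambda>x. ennreal (norm (F x))) \<le> ennreal C"
  proof
    assume "AE x in M. norm (F x) \<le> C"
    then show "esssup M (\<lambda>x. ennreal (norm (F x))) \<le> ennreal C"
      by (intro esssup_I m') (auto elim!: eventually_mono intro: ennreal_leI)
  next
    assume a: "esssup M (\<lambda>x. ennreal (norm (F x))) \<le> ennreal C"
    show "AE x in M. norm (F x) \<le> C"
      using esssup_AE[of "\<lambda>x. ennreal (norm (F x))" M]
      by eventually_elim (use a C in \<open>auto dest: order_trans simp: ennreal_le_iff\<close>)
  qed
  also have "\<dots> \<longleftrightarrow> esssup M (\<lambda>x. ennreal (norm (F x))) < \<infinity> \<and> enn2real (esssup M (\<lambda>x. ennreal (norm (F x)))) \<le> C"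
    using C by (cases "esssup M (\<lambda>x. ennreal (norm (F x)))") (auto simp: ennreal_le_iff top_unique)
  finally show ?thesis using True m by (simp add: Lp_le_def Lp_space_def Lp_norm_def)
next
  case False
  define q where "q = enn2real p"
  have q: "1 \<le> q" unfolding q_def using p False by (rule enn2real_ge_1)
  have mq: "(\<lambda>x. norm (F x) powr q) \<in> borel_measurable M" using m by measurable
  have i: "integrable M (\<lambda>x. norm (F x) powr q) \<longleftrightarrow> (\<integral>\<^sup>+x. ennreal (norm (F x) powr q) \<partial>M) < \<infinity>"
    using mq by (simp add: integrable_iff_bounded)
  have e: "(\<integral>\<^sup>+x. ennreal (norm (F x) powr q) \<partial>M) = ennreal (LINT x|M. norm (F x) powr q)"
    if "integrable M (\<lambda>x. norm (F x) powr q)"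
    using that by (intro nn_integral_eq_integral) auto
  have I: "0 \<le> (LINT x|M. norm (F x) powr q)" by simp
  have r: "(LINT x|M. norm (F x) powr q) \<le> C powr q \<longleftrightarrow> (LINT x|M. norm (F x) powr q) powr (1/q) \<le> C"
  proof
    assume "(LINT x|M. norm (F x) powr q) \<le> C powr q"
    then have "(LINT x|M. norm (F x) powr q) powr (1/q) \<le> (C powr q) powr (1/q)"
      using q by (intro powr_mono2) auto
    then show "(LINT x|M. norm (F x) powr q) powr (1/q) \<le> C" using q C by (simp add: powr_powr)
  next
    assume "(LINT x|M. norm (F x) powr q) powr (1/q) \<le> C"
    then have "((LINT x|M. norm (F x) powr q) powr (1/q)) powr q \<le> C powr q"
      using q by (intro powr_mono2) auto
    then show "(LINT x|M. norm (F x) powr q) \<le> C powr q" using q I by (simp add: powr_powr)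
  qed
  have "Lp_le M p (\<lambda>x. norm (F x)) C \<longleftrightarrow> (\<integral>\<^sup>+x. ennreal (norm (F x) powr q) \<partial>M) \<le> ennreal (C powr q)"
    using False m by (simp add: Lp_le_def q_def)
  also have "\<dots> \<longleftrightarrow> integrable M (\<lambda>x. norm (F x) powr q) \<and> (LINT x|M. norm (F x) powr q) \<le> C powr q"
    using i e I by (auto simp: ennreal_le_iff dest: le_less_trans[OF _ ennreal_less_top])
  finally show ?thesis unfolding r using False m by (simp add: Lp_space_def Lp_norm_def q_def)
qed

lemma Lp_norm_nonneg: "0 \<le> Lp_norm M p F"
  by (simp add: Lp_norm_def)

locale tf_weight =
  fixes r s :: real and v :: "(real ^ 'n) \<times> (real ^ 'n) \<Rightarrow> real"
  assumes r_nonneg: "0 \<le> r" and s_nonneg: "0 \<le> s" and v_def: "v = poly_weight r s"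
begin

lemma v_apply: "v z = (1 + norm (fst z)) powr r * (1 + norm (snd z)) powr s"
  by (simp add: v_def poly_weight_def case_prod_unfold)

lemma v_ge_1: "1 \<le> v z"
proof -
  have "1 * 1 \<le> (1 + norm (fst z)) powr r * (1 + norm (snd z)) powr s"
    by (intro mult_mono ge_one_powr_ge_zero r_nonneg s_nonneg) auto
  then show ?thesis by (simp add: v_apply)
qed

lemma v_pos [simp]: "0 < v z" and v_nonneg [simp]: "0 \<le> v z" and v_nonzero [simp]: "v z \<noteq> 0"
  using v_ge_1[of z] by auto

lemma v_uminus [simp]: "v (- z) = v z"
  by (simp add: v_apply)

lemma v_minus_commute: "v (z - w) = v (w - z)"
  using v_uminus[of "z - w"] by simp

lemma v_submult: "v (z + w) \<le> v z * v w"
proof -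
  have le: "1 + norm (x + y) \<le> (1 + norm x) * (1 + norm y)" for x y :: "real ^ 'n"
  proof -
    have "(1 + norm x) * (1 + norm y) = 1 + norm x + norm y + norm x * norm y"
      by (simp add: algebra_simps)
    moreover have "0 \<le> norm x * norm y" by simp
    ultimately show ?thesis using norm_triangle_ineq[of x y] by linarith
  qed
  have "v (z + w) \<le> ((1 + norm (fst z)) * (1 + norm (fst w))) powr r * ((1 + norm (snd z)) * (1 + norm (snd w))) powr s"
    unfolding v_apply fst_add snd_add
    by (intro mult_mono powr_mono2 le r_nonneg s_nonneg) auto
  also have "\<dots> = v z * v w"
    by (simp add: v_apply powr_mult)
  finally show ?thesis .
qed

lemma v_le_diff: "v w \<le> v z * v (w - z)"
  using v_submult[of z "w - z"] by simp

lemma continuous_v: "continuous_on S v"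
  unfolding v_apply[abs_def] by (intro continuous_intros) (auto simp: add_nonneg_eq_0_iff)

lemma measurable_v [measurable]: "v \<in> borel_measurable borel"
  by (rule borel_measurable_continuous_onI[OF continuous_v])

lemma v_bounded_cball:
  obtains V where "1 \<le> V" "\<And>z. norm z \<le> d \<Longrightarrow> v z \<le> V"
proof -
  have "compact (v ` cball 0 d)"
    by (intro compact_continuous_image continuous_v compact_cball)
  then have "bounded (v ` cball 0 d)" by (rule compact_imp_bounded)
  then obtain V where V: "\<And>z. z \<in> cball 0 d \<Longrightarrow> norm (v z) \<le> V"
    unfolding bounded_iff by fastforce
  have "v z \<le> max 1 V" if "norm z \<le> d" for z
  proof -
    have "norm (v z) \<le> V" using V that by auto
    then show ?thesis by simp
  qed
  then show ?thesis using that[of "max 1 V"] by auto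
qed

definition wint :: "((real ^ 'n) \<times> (real ^ 'n) \<Rightarrow> ennreal) \<Rightarrow> ennreal" where
  "wint \<Psi> = (\<integral>\<^sup>+z. \<Psi> z * ennreal (v z) \<partial>lborel)"

lemma wint_mono: "(\<And>z. \<Psi> z \<le> \<Phi> z) \<Longrightarrow> wint \<Psi> \<le> wint \<Phi>"
  unfolding wint_def by (intro nn_integral_mono mult_right_mono) auto

lemma wint_ge: "\<Psi> \<in> borel_measurable borel \<Longrightarrow> (\<integral>\<^sup>+z. \<Psi> z \<partial>lborel) \<le> wint \<Psi>"
  unfolding wint_def
proof (intro nn_integral_mono)
  fix z
  have "\<Psi> z * 1 \<le> \<Psi> z * ennreal (v z)"
    using v_ge_1[of z] by (intro mult_left_mono) (auto simp: one_ennreal.rep_eq[symmetric] ennreal_ge_1)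
  then show "\<Psi> z \<le> \<Psi> z * ennreal (v z)" by simp
qed

lemma wint_reflect:
  assumes [measurable]: "\<Psi> \<in> borel_measurable borel"
  shows "wint (\<lambda>z. \<Psi> (- z)) = wint \<Psi>"
  unfolding wint_def using nn_integral_lborel_reflect[of "\<lambda>z. \<Psi> z * ennreal (v z)" 0] by simp

lemma wint_cmult:
  "\<Psi> \<in> borel_measurable borel \<Longrightarrow> wint (\<lambda>z. c * \<Psi> z) = c * wint \<Psi>"
  unfolding wint_def mult.assoc by (subst nn_integral_cmult) auto

lemma wint_translate:
  assumes [measurable]: "\<Psi> \<in> borel_measurable borel"
  shows "wint (\<lambda>w. \<Psi> (w - z)) \<le> ennreal (v z) * wint \<Psi>"
proof -
  have "wint (\<lambda>w. \<Psi> (w - z)) \<le> (\<integral>\<^sup>+w. ennreal (v z) * (\<Psi> (w - z) * ennreal (v (w - z))) \<partial>lborel)"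
    unfolding wint_def
  proof (intro nn_integral_mono)
    fix w
    have "\<Psi> (w - z) * ennreal (v w) \<le> \<Psi> (w - z) * ennreal (v z * v (w - z))"
      by (intro mult_left_mono ennreal_leI v_le_diff) auto
    then show "\<Psi> (w - z) * ennreal (v w) \<le> ennreal (v z) * (\<Psi> (w - z) * ennreal (v (w - z)))"
      by (simp add: ennreal_mult mult_ac)
  qed
  also have "\<dots> = ennreal (v z) * (\<integral>\<^sup>+w. \<Psi> (w - z) * ennreal (v (w - z)) \<partial>lborel)"
    by (rule nn_integral_cmult) measurable
  also have "\<dots> = ennreal (v z) * wint \<Psi>"
    unfolding wint_def by (subst nn_integral_lborel_translate(2)[of "\<lambda>w. \<Psi> w * ennreal (v w)"]) auto
  finally show ?thesis .
qed

lemma wint_conv: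
  assumes [measurable]: "\<Phi> \<in> borel_measurable borel" "\<Psi> \<in> borel_measurable borel"
  shows "wint (\<lambda>w. \<integral>\<^sup>+z. \<Phi> z * \<Psi> (w - z) \<partial>lborel) \<le> wint \<Phi> * wint \<Psi>"
proof -
  have "wint (\<lambda>w. \<integral>\<^sup>+z. \<Phi> z * \<Psi> (w - z) \<partial>lborel)
     = (\<integral>\<^sup>+w. \<integral>\<^sup>+z. \<Phi> z * \<Psi> (w - z) * ennreal (v w) \<partial>lborel \<partial>lborel)"
    unfolding wint_def by (simp add: nn_integral_multc)
  also have "\<dots> = (\<integral>\<^sup>+z. \<integral>\<^sup>+w. \<Phi> z * \<Psi> (w - z) * ennreal (v w) \<partial>lborel \<partial>lborel)"
    by (rule lborel_pair.Fubini') measurable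
  also have "\<dots> = (\<integral>\<^sup>+z. \<Phi> z * wint (\<lambda>w. \<Psi> (w - z)) \<partial>lborel)"
    unfolding wint_def by (simp add: mult.assoc nn_integral_cmult)
  also have "\<dots> \<le> (\<integral>\<^sup>+z. \<Phi> z * (ennreal (v z) * wint \<Psi>) \<partial>lborel)"
    by (intro nn_integral_mono mult_left_mono wint_translate) auto
  also have "\<dots> = wint \<Phi> * wint \<Psi>"
    unfolding wint_def mult.assoc[symmetric] by (rule nn_integral_multc) measurable
  finally show ?thesis .
qed

lemma weighted_Young:
  assumes p: "1 \<le> p" and F: "Lp_le lborel p (\<lambda>z. F z * v z) C" and C: "0 \<le> C"
    and Fm: "F \<in> borel_measurable borel"
    and \<Psi> [measurable]: "\<Psi> \<in> borel_measurable borel" and D: "wint \<Psi> \<le> ennreal D" "0 < D"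
    and h: "h \<in> borel_measurable borel"
    and hle: "\<And>w. ennreal \<bar>h w\<bar> \<le> (\<integral>\<^sup>+z. ennreal \<bar>F z\<bar> * \<Psi> (w - z) \<partial>lborel)"
  shows "Lp_le lborel p (\<lambda>z. h z * v z) (D * C)"
proof (rule Lp_le_integral[OF sigma_finite_lborel sigma_finite_lborel p, where
      f="\<lambda>z x. F (x - z) * v (x - z)" and \<Phi>="\<lambda>z. \<Psi> z * ennreal (v z)"])
  note [measurable] = Fm h
  show "(\<lambda>z. h z * v z) \<in> borel_measurable lborel" "(\<lambda>z. \<Psi> z * ennreal (v z)) \<in> borel_measurable lborel"
     "(\<lambda>(x, z). F (x - z) * v (x - z)) \<in> borel_measurable (lborel \<Otimes>\<^sub>M lborel)"
    by measurable
  show "ennreal \<bar>h w * v w\<bar> \<le> (\<integral>\<^sup>+z. \<Psi> z * ennreal (v z) * ennreal \<bar>F (w - z) * v (w - z)\<bar> \<partial>lborel)" for w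
  proof -
    have "ennreal \<bar>h w * v w\<bar> = ennreal \<bar>h w\<bar> * ennreal (v w)"
      by (simp add: abs_mult ennreal_mult)
    also have "\<dots> \<le> (\<integral>\<^sup>+z. ennreal \<bar>F z\<bar> * \<Psi> (w - z) \<partial>lborel) * ennreal (v w)"
      by (intro mult_right_mono hle) auto
    also have "\<dots> = (\<integral>\<^sup>+z. ennreal \<bar>F z\<bar> * \<Psi> (w - z) * ennreal (v w) \<partial>lborel)"
      by (rule nn_integral_multc[symmetric]) measurable
    also have "\<dots> \<le> (\<integral>\<^sup>+z. \<Psi> (w - z) * ennreal (v (w - z)) * ennreal \<bar>F z * v z\<bar> \<partial>lborel)"
    proof (intro nn_integral_mono)
      fix z
      have "ennreal \<bar>F z\<bar> * \<Psi> (w - z) * ennreal (v w) \<le> ennreal \<bar>F z\<bar> * \<Psi> (w - z) * ennreal (v z * v (w - z))"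
        by (intro mult_left_mono ennreal_leI v_le_diff) auto
      then show "ennreal \<bar>F z\<bar> * \<Psi> (w - z) * ennreal (v w) \<le> \<Psi> (w - z) * ennreal (v (w - z)) * ennreal \<bar>F z * v z\<bar>"
        by (simp add: ennreal_mult abs_mult mult_ac)
    qed
    also have "\<dots> = (\<integral>\<^sup>+z. \<Psi> z * ennreal (v z) * ennreal \<bar>F (w - z) * v (w - z)\<bar> \<partial>lborel)"
      using nn_integral_lborel_reflect[of "\<lambda>z. \<Psi> z * ennreal (v z) * ennreal \<bar>F (w - z) * v (w - z)\<bar>" w] by simp
    finally show ?thesis .
  qed
  show "(\<integral>\<^sup>+z. \<Psi> z * ennreal (v z) \<partial>lborel) \<le> ennreal D" using D by (simp add: wint_def)
  show "Lp_le lborel p (\<lambda>x. F (x - z) * v (x - z)) C" for z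
  proof (cases "p = \<infinity>")
    case True
    have "AE x in lborel. \<bar>F x * v x\<bar> \<le> C" using F True by (simp add: Lp_le_def)
    have "(\<lambda>x. x - z) = (+) (- z)" by auto
    then have eq: "distr lborel borel (\<lambda>x. x - z) = lborel" by (simp only: lborel_distr_plus)
    have "AE x in distr lborel borel (\<lambda>x. x - z). \<bar>F x * v x\<bar> \<le> C"
      unfolding eq by fact
    then have "AE x in lborel. \<bar>F (x - z) * v (x - z)\<bar> \<le> C"
      by (subst (asm) AE_distr_iff) auto
    then show ?thesis using True by (simp add: Lp_le_def)
  next
    case False
    then show ?thesis
      using F nn_integral_lborel_translate(2)[of "\<lambda>x. ennreal (\<bar>F x * v x\<bar> powr enn2real p)" z]
      by (simp add: Lp_le_def)
  qed
qed (use C D in auto)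

lemma growth_Young:
  assumes F: "\<And>z. \<bar>F z\<bar> \<le> C * v z" and C: "0 \<le> C"
    and \<Psi> [measurable]: "\<Psi> \<in> borel_measurable borel" and D: "wint \<Psi> \<le> ennreal D" "0 \<le> D"
    and hle: "ennreal \<bar>h\<bar> \<le> (\<integral>\<^sup>+z. ennreal \<bar>F z\<bar> * \<Psi> (w - z) \<partial>lborel)"
  shows "\<bar>h\<bar> \<le> D * C * v w"
proof -
  have "ennreal \<bar>h\<bar> \<le> (\<integral>\<^sup>+z. ennreal \<bar>F z\<bar> * \<Psi> (w - z) \<partial>lborel)" by (rule hle)
  also have "\<dots> \<le> (\<integral>\<^sup>+z. ennreal (C * v w) * (\<Psi> (w - z) * ennreal (v (w - z))) \<partial>lborel)"
  proof (intro nn_integral_mono)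
    fix z
    have le: "v z \<le> v w * v (w - z)" using v_le_diff[of z w] v_minus_commute[of z w] by simp
    then have "\<bar>F z\<bar> \<le> C * v w * v (w - z)"
      using F[of z] mult_left_mono[OF le C] by (simp add: mult.assoc)
    then have "ennreal \<bar>F z\<bar> * \<Psi> (w - z) \<le> ennreal (C * v w * v (w - z)) * \<Psi> (w - z)"
      by (intro mult_right_mono ennreal_leI) auto
    then show "ennreal \<bar>F z\<bar> * \<Psi> (w - z) \<le> ennreal (C * v w) * (\<Psi> (w - z) * ennreal (v (w - z)))"
      using C by (simp add: ennreal_mult mult_ac)
  qed
  also have "\<dots> = ennreal (C * v w) * (\<integral>\<^sup>+z. \<Psi> (w - z) * ennreal (v (w - z)) \<partial>lborel)"
    by (rule nn_integral_cmult) measurable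
  also have "\<dots> = ennreal (C * v w) * wint \<Psi>"
    unfolding wint_def using nn_integral_lborel_reflect[of "\<lambda>z. \<Psi> z * ennreal (v z)" w] by simp
  also have "\<dots> \<le> ennreal (C * v w) * ennreal D" by (intro mult_left_mono D) auto
  also have "\<dots> = ennreal (D * C * v w)" using C D by (simp add: ennreal_mult[symmetric] mult_ac)
  finally show ?thesis using C D by (subst (asm) ennreal_le_iff) auto
qed

end

section \<open>Windows\<close>

context tf_weight
begin

lemma M1_iff:
  assumes "g\<^sub>0 \<in> L2_space"
  shows "f \<in> M1_space g\<^sub>0 r s \<longleftrightarrow> f \<in> L2_space \<and> wint (\<lambda>z. norm (STFT g\<^sub>0 f z)) < \<infinity>"
    and "f \<in> L2_space \<Longrightarrow> M1_norm g\<^sub>0 r s f = enn2real (wint (\<lambda>z. norm (STFT g\<^sub>0 f z)))"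
proof -
  have m [measurable]: "STFT g\<^sub>0 f \<in> borel_measurable borel" if "f \<in> L2_space"
    using measurable_STFT[OF that assms] .
  have vm: "(\<lambda>z. norm (F z) * v z) \<in> borel_measurable borel" if "F \<in> borel_measurable borel" for F :: "_ \<Rightarrow> complex"
    using that by measurable
  have eq: "weighted_Lp_space lborel v 1 = {F \<in> borel_measurable borel. integrable lborel (\<lambda>z. norm (F z) * v z)}"
    by (auto simp: weighted_Lp_space_def Lp_space_def norm_mult abs_of_nonneg intro!: borel_measurable_times)
  have int: "integrable lborel (\<lambda>z. norm (F z) * v z) \<longleftrightarrow> wint (\<lambda>z. norm (F z)) < \<infinity>"
    if "F \<in> borel_measurable borel" for F :: "_ \<Rightarrow> complex"
    using that vm[OF that] by (simp add: integrable_iff_bounded wint_def ennreal_mult abs_mult)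
  show "f \<in> M1_space g\<^sub>0 r s \<longleftrightarrow> f \<in> L2_space \<and> wint (\<lambda>z. norm (STFT g\<^sub>0 f z)) < \<infinity>"
    using int m by (auto simp: M1_space_def eq[unfolded v_def] v_def)
  show "M1_norm g\<^sub>0 r s f = enn2real (wint (\<lambda>z. norm (STFT g\<^sub>0 f z)))" if f: "f \<in> L2_space"
  proof -
    have "M1_norm g\<^sub>0 r s f = (LINT z|lborel. norm (STFT g\<^sub>0 f z) * v z)"
      by (simp add: M1_norm_def weighted_Lp_norm_def Lp_norm_def v_def[symmetric] norm_mult)
    also have "\<dots> = enn2real (\<integral>\<^sup>+z. ennreal (norm (STFT g\<^sub>0 f z) * v z) \<partial>lborel)"
      using vm[OF m[OF f]] by (intro integral_eq_nn_integral) auto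
    finally show ?thesis by (simp add: wint_def ennreal_mult)
  qed
qed

lemma integrable_if_wint:
  assumes "F \<in> borel_measurable borel" "wint (\<lambda>z. norm (F z)) < \<infinity>"
  shows "integrable lborel (F :: _ \<Rightarrow> complex)"
  using assms wint_ge[of "\<lambda>z. norm (F z)"] by (auto simp: integrable_iff_bounded intro: le_less_trans)

lemma wint_STFT_swap:
  assumes "a \<in> L2_space" "b \<in> L2_space"
  shows "wint (\<lambda>z. norm (STFT b a z)) = wint (\<lambda>z. norm (STFT a b z))"
proof -
  note [measurable] = measurable_STFT[OF assms]
  have "wint (\<lambda>z. norm (STFT b a z)) = wint (\<lambda>z. norm (STFT b a (- z)))"
    by (rule wint_reflect[symmetric]) measurable
  then show ?thesis by (simp add: norm_STFT_swap)
qed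

lemma STFT_reproducing:
  assumes a: "a \<in> L2_space" and b: "b \<in> L2_space" and e: "e \<in> L2_space"
    and int: "integrable lborel (STFT b a)"
  shows "integrable lborel (\<lambda>z. STFT b a z * L2_inner (tf_shift z b) (tf_shift w e))"
    and "(LINT z|lborel. STFT b a z * L2_inner (tf_shift z b) (tf_shift w e)) = STFT e a w * of_real ((L2_nrm b)\<^sup>2)"
proof -
  have eq: "L2_inner (tf_shift z b) (tf_shift w e) = cnj (STFT b (tf_shift w e) z)" for z
    by (simp add: STFT_eq L2_inner_cnj)
  have m: "STFT b (tf_shift w e) \<in> borel_measurable borel" by (intro measurable_STFT L2_tf_shift b e)
  have bd: "norm (cnj (STFT b (tf_shift w e) z)) \<le> L2_nrm e * L2_nrm b" for z
    using STFT_bound[OF L2_tf_shift[OF e] b] by simp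
  show i: "integrable lborel (\<lambda>z. STFT b a z * L2_inner (tf_shift z b) (tf_shift w e))"
    unfolding eq
  proof (rule Bochner_Integration.integrable_bound[OF integrable_mult_left[OF int, of "of_real (L2_nrm e * L2_nrm b)"]])
    show "(\<lambda>z. STFT b a z * cnj (STFT b (tf_shift w e) z)) \<in> borel_measurable lborel"
      using m measurable_STFT[OF a b] by measurable
    show "AE z in lborel. norm (STFT b a z * cnj (STFT b (tf_shift w e) z)) \<le> norm (STFT b a z * of_real (L2_nrm e * L2_nrm b))"
      unfolding norm_mult by (intro AE_I2 mult_left_mono order_trans[OF bd]) (auto simp: norm_mult)
  qed
  show "(LINT z|lborel. STFT b a z * L2_inner (tf_shift z b) (tf_shift w e)) = STFT e a w * of_real ((L2_nrm b)\<^sup>2)"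
    using STFT_orthogonality[OF a b L2_tf_shift[OF e] b i[unfolded eq]]
    by (simp add: eq L2_inner_self STFT_eq)
qed

lemma STFT_window_change:
  assumes a: "a \<in> L2_space" and b: "b \<in> L2_space" and e: "e \<in> L2_space"
    and int: "integrable lborel (STFT b a)"
  shows "ennreal (norm (STFT e a w)) * ennreal ((L2_nrm b)\<^sup>2)
     \<le> (\<integral>\<^sup>+z. norm (STFT b a z) * norm (STFT e b (w - z)) \<partial>lborel)"
proof -
  have "ennreal (norm (STFT e a w * of_real ((L2_nrm b)\<^sup>2)))
      \<le> (\<integral>\<^sup>+z. norm (STFT b a z * L2_inner (tf_shift z b) (tf_shift w e)) \<partial>lborel)"
    unfolding STFT_reproducing(2)[OF assms, symmetric]
    by (rule integral_norm_bound_ennreal[OF STFT_reproducing(1)[OF assms]])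
  then show ?thesis by (simp add: norm_mult norm_L2_inner_tf_shift ennreal_mult norm_power)
qed

lemma wint_STFT_window_change:
  assumes a: "a \<in> L2_space" and b: "b \<in> L2_space" and e: "e \<in> L2_space"
    and fin: "wint (\<lambda>z. norm (STFT b a z)) < \<infinity>"
  shows "wint (\<lambda>z. norm (STFT e a z)) * ennreal ((L2_nrm b)\<^sup>2)
     \<le> wint (\<lambda>z. norm (STFT b a z)) * wint (\<lambda>z. norm (STFT e b z))"
proof -
  note [measurable] = measurable_STFT[OF a b] measurable_STFT[OF a e] measurable_STFT[OF b e]
  have int: "integrable lborel (STFT b a)" using fin by (intro integrable_if_wint) auto
  have "wint (\<lambda>z. norm (STFT e a z)) * ennreal ((L2_nrm b)\<^sup>2)
     = wint (\<lambda>w. ennreal ((L2_nrm b)\<^sup>2) * ennreal (norm (STFT e a w)))"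
    by (subst wint_cmult) (auto simp: mult.commute)
  also have "\<dots> \<le> wint (\<lambda>w. \<integral>\<^sup>+z. ennreal (norm (STFT b a z)) * ennreal (norm (STFT e b (w - z))) \<partial>lborel)"
    using STFT_window_change[OF a b e int] by (intro wint_mono) (simp add: mult.commute ennreal_mult)
  also have "\<dots> \<le> wint (\<lambda>z. norm (STFT b a z)) * wint (\<lambda>z. norm (STFT e b z))"
    by (rule wint_conv) measurable
  finally show ?thesis .
qed

lemma wint_STFT_finite:
  assumes a: "a \<in> L2_space" and b: "b \<in> L2_space" and e: "e \<in> L2_space" and nz: "L2_nrm b \<noteq> 0"
    and fin: "wint (\<lambda>z. norm (STFT b a z)) < \<infinity>" "wint (\<lambda>z. norm (STFT b e z)) < \<infinity>"
  shows "wint (\<lambda>z. norm (STFT e a z)) < \<infinity>"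
proof -
  have "wint (\<lambda>z. norm (STFT e a z)) * ennreal ((L2_nrm b)\<^sup>2) < \<infinity>"
    by (rule le_less_trans[OF wint_STFT_window_change[OF a b e fin(1)]])
       (use fin wint_STFT_swap[OF b e] in \<open>simp add: ennreal_mult_less_top\<close>)
  then show ?thesis using nz by (auto simp: ennreal_mult_less_top)
qed

lemma wint_STFT_tf_shift:
  assumes "a \<in> L2_space" "b \<in> L2_space"
  shows "wint (\<lambda>w. norm (STFT b (tf_shift z a) w)) \<le> ennreal (v z) * wint (\<lambda>w. norm (STFT b a w))"
proof -
  note [measurable] = measurable_STFT[OF assms]
  show ?thesis unfolding norm_STFT_tf_shift by (rule wint_translate) measurable
qed

text \<open>Since \<open>G w * G y\<close> is a twisted convolution of \<open>G\<close> with a shift of \<open>G\<close>, every value \<open>G w\<close> is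
  controlled by an average of \<open>\<bar>G\<bar> * \<bar>G\<bar>\<close> around \<open>w\<close>; no smoothness of the window is used.\<close>

lemma STFT_local_majorant:
  assumes \<gamma>: "\<gamma> \<in> L2_space" and nz: "L2_nrm \<gamma> \<noteq> 0" and fin: "wint (\<lambda>z. norm (STFT \<gamma> \<gamma> z)) < \<infinity>"
  obtains \<delta> B where "0 < \<delta>" "B \<in> borel_measurable borel" "wint B < \<infinity>"
    "\<And>x u. norm u \<le> \<delta> \<Longrightarrow> ennreal (norm (STFT \<gamma> \<gamma> (x + u))) \<le> B x"
proof -
  define G where "G = STFT \<gamma> \<gamma>"
  have Gm [measurable]: "G \<in> borel_measurable borel" unfolding G_def by (rule measurable_STFT[OF \<gamma> \<gamma>])
  have Gint: "integrable lborel G" using fin by (intro integrable_if_wint Gm) (simp add: G_def)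
  define S where "S = (\<lambda>w. \<integral>\<^sup>+z. ennreal (norm (G z)) * ennreal (norm (G (w - z))) \<partial>lborel)"
  have Sm [measurable]: "S \<in> borel_measurable borel" unfolding S_def by measurable
  have Sfin: "wint S < \<infinity>"
  proof (rule le_less_trans)
    show "wint S \<le> wint (\<lambda>z. norm (G z)) * wint (\<lambda>z. norm (G z))"
      unfolding S_def by (rule wint_conv) measurable
  qed (use fin in \<open>simp add: G_def ennreal_mult_less_top\<close>)
  have GS: "ennreal (norm (G w) * norm (G y)) \<le> S (w + y)" for w y
  proof -
    have "integrable lborel (\<lambda>z. norm (G (z + y)))"
      using integrable_norm[OF Gint] integrable_lborel_translate(1)[of "\<lambda>z. norm (G z)" y] by simp
    then have int1: "integrable lborel (STFT (tf_shift y \<gamma>) \<gamma>)"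
      by (subst integrable_norm_iff[symmetric])
         (auto simp: norm_STFT_window_shift G_def intro!: measurable_STFT L2_tf_shift \<gamma>)
    have bd: "norm (cnj (STFT \<gamma> (tf_shift w \<gamma>) z)) \<le> L2_nrm \<gamma> * L2_nrm \<gamma>" for z
      using STFT_bound[OF L2_tf_shift[OF \<gamma>] \<gamma>] by simp
    have int: "integrable lborel (\<lambda>z. STFT (tf_shift y \<gamma>) \<gamma> z * cnj (STFT \<gamma> (tf_shift w \<gamma>) z))"
    proof (rule Bochner_Integration.integrable_bound[OF integrable_mult_left[OF int1, of "of_real (L2_nrm \<gamma> * L2_nrm \<gamma>)"]])
      show "(\<lambda>z. STFT (tf_shift y \<gamma>) \<gamma> z * cnj (STFT \<gamma> (tf_shift w \<gamma>) z)) \<in> borel_measurable lborel"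
        using measurable_STFT[OF \<gamma> L2_tf_shift[OF \<gamma>, of y]] measurable_STFT[OF L2_tf_shift[OF \<gamma>, of w] \<gamma>] by measurable
      show "AE z in lborel. norm (STFT (tf_shift y \<gamma>) \<gamma> z * cnj (STFT \<gamma> (tf_shift w \<gamma>) z))
          \<le> norm (STFT (tf_shift y \<gamma>) \<gamma> z * of_real (L2_nrm \<gamma> * L2_nrm \<gamma>))"
        unfolding norm_mult by (intro AE_I2 mult_left_mono order_trans[OF bd]) (auto simp: norm_mult)
    qed
    have "L2_inner \<gamma> (tf_shift w \<gamma>) = G w" "cnj (L2_inner (tf_shift y \<gamma>) \<gamma>) = G y"
      by (simp_all add: G_def STFT_eq L2_inner_cnj)
    then have "G w * G y = (LINT z|lborel. STFT (tf_shift y \<gamma>) \<gamma> z * cnj (STFT \<gamma> (tf_shift w \<gamma>) z))"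
      using STFT_orthogonality[OF \<gamma> L2_tf_shift[OF \<gamma>, of y] L2_tf_shift[OF \<gamma>, of w] \<gamma> int] by simp
    then have "ennreal (norm (G w * G y)) \<le> (\<integral>\<^sup>+z. norm (STFT (tf_shift y \<gamma>) \<gamma> z * cnj (STFT \<gamma> (tf_shift w \<gamma>) z)) \<partial>lborel)"
      using integral_norm_bound_ennreal[OF int] by simp
    also have "\<dots> = (\<integral>\<^sup>+z. ennreal (norm (G (z + y))) * ennreal (norm (G (w + y - (z + y)))) \<partial>lborel)"
    proof (intro nn_integral_cong)
      fix z
      have "norm (G (z - w)) = norm (G (w + y - (z + y)))"
        using norm_STFT_swap[of \<gamma> \<gamma> "w - z"] by (simp add: G_def)
      then show "ennreal (norm (STFT (tf_shift y \<gamma>) \<gamma> z * cnj (STFT \<gamma> (tf_shift w \<gamma>) z)))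
         = ennreal (norm (G (z + y))) * ennreal (norm (G (w + y - (z + y))))"
        by (simp only: norm_mult complex_mod_cnj norm_STFT_window_shift norm_STFT_tf_shift G_def[symmetric] ennreal_mult norm_ge_zero)
    qed
    also have "\<dots> = S (w + y)"
      unfolding S_def by (rule nn_integral_lborel_translate(1)) measurable
    finally show ?thesis by (simp add: norm_mult)
  qed
  have G0: "G 0 = of_real ((L2_nrm \<gamma>)\<^sup>2)" by (simp add: G_def STFT_eq L2_inner_self)
  define \<kappa> where "\<kappa> = (L2_nrm \<gamma>)\<^sup>2 / 2"
  have \<kappa>: "\<kappa> > 0" using nz by (simp add: \<kappa>_def)
  have "continuous_on UNIV (\<lambda>z. norm (G z))"
    unfolding G_def by (intro continuous_on_norm continuous_STFT \<gamma>)
  then have "isCont (\<lambda>z. norm (G z)) 0"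
    using continuous_on_eq_continuous_at[OF open_UNIV] by blast
  then have "((\<lambda>z. norm (G z)) \<longlongrightarrow> norm (G 0)) (nhds 0)"
    unfolding continuous_at using tendsto_at_iff_tendsto_nhds[of "\<lambda>z. norm (G z)" 0] by blast
  moreover have "norm (G 0) > \<kappa>" using \<kappa> by (simp add: G0 \<kappa>_def norm_power)
  ultimately have "eventually (\<lambda>y. norm (G y) > \<kappa>) (nhds 0)"
    by (rule order_tendstoD(1))
  then obtain \<delta>0 where \<delta>0: "\<delta>0 > 0" "\<And>y. dist y 0 < \<delta>0 \<Longrightarrow> norm (G y) > \<kappa>"
    by (auto simp: eventually_nhds_metric)
  define \<delta> where "\<delta> = \<delta>0 / 2"
  have \<delta>: "\<delta> > 0" "\<And>y. norm y \<le> \<delta> \<Longrightarrow> norm (G y) \<ge> \<kappa>"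
    using \<delta>0 by (auto simp: \<delta>_def dist_norm intro!: less_imp_le)
  define m where "m = measure lborel (cball (0 :: (real ^ 'n) \<times> (real ^ 'n)) \<delta>)"
  have m: "m > 0" and em: "emeasure lborel (cball (0 :: (real ^ 'n) \<times> (real ^ 'n)) \<delta>) = ennreal m"
  proof -
    have fm: "emeasure lborel (cball (0 :: (real ^ 'n) \<times> (real ^ 'n)) \<delta>) < \<infinity>"
      using emeasure_bounded_finite[OF bounded_cball] by simp
    then show "emeasure lborel (cball (0 :: (real ^ 'n) \<times> (real ^ 'n)) \<delta>) = ennreal m"
      unfolding m_def by (simp add: emeasure_eq_ennreal_measure)
    show "m > 0" unfolding m_def using content_cball_pos[OF \<delta>(1)] by (simp add: measure_completion)
  qed
  define I :: "(real ^ 'n) \<times> (real ^ 'n) \<Rightarrow> ennreal" where "I = indicator (cball 0 (2 * \<delta>))"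
  have [measurable]: "cball (0 :: (real ^ 'n) \<times> (real ^ 'n)) (2 * \<delta>) \<in> sets borel"
    by (intro borel_closed closed_cball)
  have Im [measurable]: "I \<in> borel_measurable borel"
    unfolding I_def by measurable
  define B where "B = (\<lambda>x. ennreal (1 / (\<kappa> * m)) * (\<integral>\<^sup>+z. I z * S (x - z) \<partial>lborel))"
  have Bm [measurable]: "B \<in> borel_measurable borel" unfolding B_def by measurable
  have "wint I < \<infinity>"
  proof -
    obtain V where V: "1 \<le> V" "\<And>z. norm z \<le> 2 * \<delta> \<Longrightarrow> v z \<le> V" by (rule v_bounded_cball) auto
    have "wint I \<le> (\<integral>\<^sup>+z. ennreal V * I z \<partial>lborel)"
      unfolding wint_def I_def by (intro nn_integral_mono) (auto simp: indicator_def V ennreal_leI)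
    also have "\<dots> = ennreal V * emeasure lborel (cball (0::(real ^ 'n) \<times> (real ^ 'n)) (2 * \<delta>))"
      unfolding I_def by (subst nn_integral_cmult) auto
    also have "\<dots> < \<infinity>"
      using emeasure_bounded_finite[OF bounded_cball, of "0 :: (real ^ 'n) \<times> (real ^ 'n)" "2 * \<delta>"]
      by (simp add: ennreal_mult_less_top)
    finally show ?thesis .
  qed
  then have Bfin: "wint B < \<infinity>"
  proof -
    assume If: "wint I < \<infinity>"
    have "wint (\<lambda>x. \<integral>\<^sup>+z. I z * S (x - z) \<partial>lborel) \<le> wint I * wint S"
      by (rule wint_conv) measurable
    also have "\<dots> < \<infinity>" using If Sfin by (simp add: ennreal_mult_less_top)
    finally show ?thesis
      unfolding B_def by (subst wint_cmult) (auto simp: ennreal_mult_less_top)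
  qed
  have "ennreal (norm (G (x + u))) \<le> B x" if u: "norm u \<le> \<delta>" for x u
  proof -
    have "ennreal (\<kappa> * norm (G (x + u))) * ennreal m
       = (\<integral>\<^sup>+y. ennreal (\<kappa> * norm (G (x + u))) * indicator (cball (0 :: (real ^ 'n) \<times> (real ^ 'n)) \<delta>) y \<partial>lborel)"
      by (simp add: nn_integral_cmult_indicator em)
    also have "\<dots> \<le> (\<integral>\<^sup>+y. I (u + y) * S (x + (u + y)) \<partial>lborel)"
    proof (intro nn_integral_mono)
      fix y :: "(real ^ 'n) \<times> (real ^ 'n)"
      show "ennreal (\<kappa> * norm (G (x + u))) * indicator (cball 0 \<delta>) y \<le> I (u + y) * S (x + (u + y))"
      proof (cases "norm y \<le> \<delta>")
        case True
        have I1: "I (u + y) = 1"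
          using norm_triangle_ineq[of u y] u True by (simp add: I_def indicator_def)
        have "ennreal (\<kappa> * norm (G (x + u))) \<le> ennreal (norm (G (x + u)) * norm (G y))"
          using mult_right_mono[OF \<delta>(2)[OF True], of "norm (G (x + u))"]
          by (intro ennreal_leI) (simp add: mult.commute)
        also have "\<dots> \<le> S (x + (u + y))" using GS[of "x + u" y] by (simp add: add.assoc)
        finally show ?thesis using True by (simp add: I1)
      qed (simp add: indicator_def)
    qed
    also have "\<dots> = (\<integral>\<^sup>+y. I y * S (x + y) \<partial>lborel)"
      using nn_integral_lborel_translate(1)[of "\<lambda>y. I y * S (x + y)" u] by (simp add: add.commute)
    also have "\<dots> = (\<integral>\<^sup>+z. I (- z) * S (x - z) \<partial>lborel)"
      using nn_integral_lborel_reflect[of "\<lambda>y. I y * S (x + y)" 0] by simp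
    also have "\<dots> = (\<integral>\<^sup>+z. I z * S (x - z) \<partial>lborel)"
      by (simp add: I_def indicator_def dist_norm)
    finally have le: "ennreal (\<kappa> * norm (G (x + u))) * ennreal m \<le> (\<integral>\<^sup>+z. I z * S (x - z) \<partial>lborel)" .
    have "ennreal (norm (G (x + u))) = ennreal (1 / (\<kappa> * m)) * (ennreal (\<kappa> * norm (G (x + u))) * ennreal m)"
      using \<kappa> m by (simp add: ennreal_mult[symmetric])
    also have "\<dots> \<le> B x" unfolding B_def by (intro mult_left_mono le) auto
    finally show ?thesis .
  qed
  then show ?thesis using that[OF \<delta>(1) Bm Bfin] by (simp add: G_def)
qed

end

locale tf_window = tf_weight r s v
  for r s and v :: "(real ^ 'n) \<times> (real ^ 'n) \<Rightarrow> real" +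
  fixes g\<^sub>0 \<gamma> :: "real ^ 'n \<Rightarrow> complex"
  assumes g0: "g\<^sub>0 \<in> window_class r s" and g0_nz: "L2_nrm g\<^sub>0 \<noteq> 0"
    and \<gamma>: "\<gamma> \<in> M1_space g\<^sub>0 r s" and \<gamma>_nrm: "L2_nrm \<gamma> = 1"
begin

abbreviation "G \<equiv> STFT \<gamma> \<gamma>"
abbreviation "K z w \<equiv> L2_inner (tf_shift z \<gamma>) (tf_shift w \<gamma>)"

lemma g0_L2: "g\<^sub>0 \<in> L2_space"
  using g0 by (simp add: window_class_def)

lemmas M1_iff' = M1_iff(1)[OF g0_L2]

lemma g0_M1: "g\<^sub>0 \<in> M1_space g\<^sub>0 r s"
  using g0 by (simp add: window_class_def M1_space_def)

lemma M1_L2: "h \<in> M1_space g\<^sub>0 r s \<Longrightarrow> h \<in> L2_space"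
  by (simp add: M1_iff')

lemmas \<gamma>_L2 = M1_L2[OF \<gamma>]

lemma wint_STFT_M1:
  assumes "h \<in> M1_space g\<^sub>0 r s" "k \<in> M1_space g\<^sub>0 r s"
  shows "wint (\<lambda>z. norm (STFT k h z)) < \<infinity>"
  by (rule wint_STFT_finite[OF _ g0_L2 _ g0_nz]) (use assms in \<open>auto simp: M1_iff'\<close>)

lemma wint_G: "wint (\<lambda>z. norm (G z)) < \<infinity>"
  by (rule wint_STFT_M1[OF \<gamma> \<gamma>])

lemma G_majorant:
  obtains \<delta> B where "0 < \<delta>" "B \<in> borel_measurable borel" "wint B < \<infinity>"
    "\<And>x u. norm u \<le> \<delta> \<Longrightarrow> ennreal (norm (G (x + u))) \<le> B x"
  using STFT_local_majorant[OF \<gamma>_L2 _ wint_G] \<gamma>_nrm by auto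

lemma norm_K: "norm (K z w) = norm (G (w - z))"
  by (rule norm_L2_inner_tf_shift)

lemma measurable_G [measurable]: "G \<in> borel_measurable borel"
  by (rule measurable_STFT[OF \<gamma>_L2 \<gamma>_L2])

lemma measurable_K [measurable]:
  "f \<in> borel_measurable M \<Longrightarrow> h \<in> borel_measurable M \<Longrightarrow> (\<lambda>x. K (f x) (h x)) \<in> borel_measurable M"
  by (rule measurable_tf_kernel[OF \<gamma>_L2 \<gamma>_L2])

lemma continuous_K [continuous_intros]:
  "continuous_on S f \<Longrightarrow> continuous_on S h \<Longrightarrow> continuous_on S (\<lambda>x. K (f x) (h x))"
  by (rule continuous_tf_kernel[OF \<gamma>_L2 \<gamma>_L2])

lemma STFT_add:
  assumes "f \<in> L2_space" "h \<in> L2_space" "e \<in> L2_space"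
  shows "STFT e (\<lambda>t. f t + h t) z = STFT e f z + STFT e h z"
  unfolding STFT_eq by (intro L2_inner_add_left L2_tf_shift assms)

lemma STFT_diff:
  assumes "f \<in> L2_space" "h \<in> L2_space" "e \<in> L2_space"
  shows "STFT e (\<lambda>t. f t - h t) z = STFT e f z - STFT e h z"
  unfolding STFT_eq by (intro L2_inner_diff_left L2_tf_shift assms)

lemma STFT_scale: "STFT e (\<lambda>t. c * f t) z = c * STFT e f z"
  unfolding STFT_eq by (rule L2_inner_scale_left)

lemma M1_scale:
  assumes "h \<in> M1_space g\<^sub>0 r s" shows "(\<lambda>t. c * h t) \<in> M1_space g\<^sub>0 r s"
proof -
  have [measurable]: "STFT g\<^sub>0 h \<in> borel_measurable borel" by (intro measurable_STFT M1_L2 assms g0_L2)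
  have "wint (\<lambda>z. norm (STFT g\<^sub>0 (\<lambda>t. c * h t) z)) = ennreal (norm c) * wint (\<lambda>z. norm (STFT g\<^sub>0 h z))"
    unfolding STFT_scale norm_mult by (subst wint_cmult[symmetric]) (auto simp: ennreal_mult)
  then show ?thesis using assms L2_scale[of h c] by (auto simp: M1_iff' ennreal_mult_less_top)
qed

lemma M1_add:
  assumes h: "h \<in> M1_space g\<^sub>0 r s" and k: "k \<in> M1_space g\<^sub>0 r s"
  shows "(\<lambda>t. h t + k t) \<in> M1_space g\<^sub>0 r s"
proof -
  have [measurable]: "STFT g\<^sub>0 h \<in> borel_measurable borel" "STFT g\<^sub>0 k \<in> borel_measurable borel"
    by (intro measurable_STFT M1_L2 h k g0_L2)+
  have "wint (\<lambda>z. norm (STFT g\<^sub>0 (\<lambda>t. h t + k t) z)) \<le> wint (\<lambda>z. ennreal (norm (STFT g\<^sub>0 h z)) + ennreal (norm (STFT g\<^sub>0 k z)))"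
    by (intro wint_mono)
       (auto simp: STFT_add[OF M1_L2[OF h] M1_L2[OF k] g0_L2] ennreal_plus[symmetric] norm_triangle_ineq
          simp del: ennreal_plus intro!: ennreal_leI)
  also have "\<dots> = wint (\<lambda>z. norm (STFT g\<^sub>0 h z)) + wint (\<lambda>z. norm (STFT g\<^sub>0 k z))"
    unfolding wint_def distrib_right by (rule nn_integral_add) measurable
  also have "\<dots> < \<infinity>" using h k by (auto simp: M1_iff')
  finally show ?thesis using h k by (auto simp: M1_iff' intro: L2_add)
qed

lemma M1_diff:
  "h \<in> M1_space g\<^sub>0 r s \<Longrightarrow> k \<in> M1_space g\<^sub>0 r s \<Longrightarrow> (\<lambda>t. h t - k t) \<in> M1_space g\<^sub>0 r s"
  using M1_add[of h "\<lambda>t. - 1 * k t"] M1_scale[of k "-1"] by simp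

lemma M1_sum:
  assumes "finite I" "\<And>i. i \<in> I \<Longrightarrow> h i \<in> M1_space g\<^sub>0 r s"
  shows "(\<lambda>t. \<Sum>i\<in>I. h i t) \<in> M1_space g\<^sub>0 r s"
  using assms
proof (induction I rule: finite_induct)
  case empty
  then show ?case using M1_scale[OF \<gamma>, of 0] by simp
next
  case (insert x F)
  then show ?case by (simp add: M1_add)
qed

lemma M1_tf_shift:
  assumes "h \<in> M1_space g\<^sub>0 r s" shows "tf_shift z h \<in> M1_space g\<^sub>0 r s"
  using assms wint_STFT_tf_shift[of h g\<^sub>0 z] g0_L2
  by (auto simp: M1_iff' L2_tf_shift ennreal_mult_less_top intro!: le_less_trans[OF wint_STFT_tf_shift])

context
  fixes f assumes f: "f \<in> M1_antidual g\<^sub>0 r s"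
begin

lemma antidual_add: "h \<in> M1_space g\<^sub>0 r s \<Longrightarrow> k \<in> M1_space g\<^sub>0 r s \<Longrightarrow> f (\<lambda>t. h t + k t) = f h + f k"
  and antidual_scale: "h \<in> M1_space g\<^sub>0 r s \<Longrightarrow> f (\<lambda>t. a * h t) = cnj a * f h"
  and antidual_off: "h \<notin> M1_space g\<^sub>0 r s \<Longrightarrow> f h = 0"
  using f by (auto simp: M1_antidual_def)

lemma antidual_diff:
  assumes "h \<in> M1_space g\<^sub>0 r s" "k \<in> M1_space g\<^sub>0 r s" shows "f (\<lambda>t. h t - k t) = f h - f k"
  using antidual_add[OF assms(1) M1_scale[OF assms(2), of "-1"]] antidual_scale[OF assms(2), of "-1"] by simp

lemma antidual_sum:
  assumes "finite I" "\<And>i. i \<in> I \<Longrightarrow> h i \<in> M1_space g\<^sub>0 r s"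
  shows "f (\<lambda>t. \<Sum>i\<in>I. h i t) = (\<Sum>i\<in>I. f (h i))"
  using assms
proof (induction I rule: finite_induct)
  case empty
  then show ?case using antidual_scale[OF \<gamma>, of 0] by simp
next
  case (insert x F)
  then show ?case using antidual_add[OF _ M1_sum[of F h]] by simp
qed

lemma antidual_bound:
  obtains C where "0 \<le> C" "\<forall>h\<in>M1_space g\<^sub>0 r s. norm (f h) \<le> C * enn2real (wint (\<lambda>z. norm (STFT \<gamma> h z)))"
proof -
  obtain C where C: "\<forall>h\<in>M1_space g\<^sub>0 r s. norm (f h) \<le> C * M1_norm g\<^sub>0 r s h"
    using f unfolding M1_antidual_def by blast
  let ?D = "enn2real (wint (\<lambda>z. norm (STFT g\<^sub>0 \<gamma> z)))"
  have "norm (f h) \<le> (\<bar>C\<bar> * ?D) * enn2real (wint (\<lambda>z. norm (STFT \<gamma> h z)))" if h: "h \<in> M1_space g\<^sub>0 r s" for h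
  proof -
    have "wint (\<lambda>z. norm (STFT g\<^sub>0 h z)) \<le> wint (\<lambda>z. norm (STFT \<gamma> h z)) * wint (\<lambda>z. norm (STFT g\<^sub>0 \<gamma> z))"
      using wint_STFT_window_change[OF M1_L2[OF h] \<gamma>_L2 g0_L2 wint_STFT_M1[OF h \<gamma>]] \<gamma>_nrm by simp
    then have "enn2real (wint (\<lambda>z. norm (STFT g\<^sub>0 h z))) \<le> enn2real (wint (\<lambda>z. norm (STFT \<gamma> h z)) * wint (\<lambda>z. norm (STFT g\<^sub>0 \<gamma> z)))"
      using wint_STFT_M1[OF h \<gamma>] wint_STFT_M1[OF \<gamma> g0_M1]
      by (intro enn2real_mono) (auto simp: ennreal_mult_less_top)
    then have le: "M1_norm g\<^sub>0 r s h \<le> enn2real (wint (\<lambda>z. norm (STFT \<gamma> h z))) * ?D"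
      using M1_iff(2)[OF g0_L2 M1_L2[OF h]] by (simp add: enn2real_mult)
    have "norm (f h) \<le> \<bar>C\<bar> * M1_norm g\<^sub>0 r s h"
      using bspec[OF C h] M1_iff(2)[OF g0_L2 M1_L2[OF h]]
        mult_right_mono[OF abs_ge_self[of C], of "M1_norm g\<^sub>0 r s h"] by simp
    also have "\<dots> \<le> \<bar>C\<bar> * (enn2real (wint (\<lambda>z. norm (STFT \<gamma> h z))) * ?D)"
      by (intro mult_left_mono le) auto
    finally show ?thesis by (simp add: mult_ac)
  qed
  then show ?thesis using that[of "\<bar>C\<bar> * ?D"] by auto
qed

lemma antidual_growth:
  assumes k: "k \<in> M1_space g\<^sub>0 r s"
  obtains C where "0 \<le> C" "\<And>z. norm (f (tf_shift z k)) \<le> C * v z"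
proof -
  obtain C where C: "0 \<le> C" "\<forall>h\<in>M1_space g\<^sub>0 r s. norm (f h) \<le> C * enn2real (wint (\<lambda>z. norm (STFT \<gamma> h z)))"
    by (rule antidual_bound)
  let ?D = "enn2real (wint (\<lambda>w. norm (STFT \<gamma> k w)))"
  have "norm (f (tf_shift z k)) \<le> (C * ?D) * v z" for z
  proof -
    have "enn2real (wint (\<lambda>w. norm (STFT \<gamma> (tf_shift z k) w))) \<le> enn2real (ennreal (v z) * wint (\<lambda>w. norm (STFT \<gamma> k w)))"
      using wint_STFT_M1[OF k \<gamma>] by (intro enn2real_mono wint_STFT_tf_shift M1_L2 k \<gamma>_L2) (auto simp: ennreal_mult_less_top)
    then have "enn2real (wint (\<lambda>w. norm (STFT \<gamma> (tf_shift z k) w))) \<le> v z * ?D"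
      by (simp add: enn2real_mult)
    then have "C * enn2real (wint (\<lambda>w. norm (STFT \<gamma> (tf_shift z k) w))) \<le> C * (v z * ?D)"
      using C(1) by (rule mult_left_mono)
    then show ?thesis using bspec[OF C(2) M1_tf_shift[OF k, of z]] by (simp add: mult_ac)
  qed
  then show ?thesis using that[of "C * ?D"] C(1) by auto
qed

lemma antidual_continuous: "continuous_on S (\<lambda>z. f (tf_shift z \<gamma>))"
  unfolding continuous_on_sequentially
proof (intro allI ballI impI, elim conjE)
  fix z and z0 :: "(real ^ 'n) \<times> (real ^ 'n)" assume z: "z \<longlonglongrightarrow> z0"
  obtain C where C: "0 \<le> C" "\<forall>h\<in>M1_space g\<^sub>0 r s. norm (f h) \<le> C * enn2real (wint (\<lambda>z. norm (STFT \<gamma> h z)))"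
    by (rule antidual_bound)
  obtain \<delta> B where B: "0 < \<delta>" "B \<in> borel_measurable borel" "wint B < \<infinity>"
    "\<And>x u. norm u \<le> \<delta> \<Longrightarrow> ennreal (norm (G (x + u))) \<le> B x"
    using G_majorant by blast
  note [measurable] = B(2)
  obtain N where N: "\<And>n. n \<ge> N \<Longrightarrow> norm (z n - z0) \<le> \<delta>"
    using LIMSEQ_D[OF z B(1)] less_imp_le by blast
  define h where "h = (\<lambda>n t. tf_shift (z (n + N)) \<gamma> t - tf_shift z0 \<gamma> t)"
  have hM: "h n \<in> M1_space g\<^sub>0 r s" for n unfolding h_def by (intro M1_diff M1_tf_shift \<gamma>)
  have Vh: "STFT \<gamma> (h n) w = K (z (n + N)) w - K z0 w" for n w
    unfolding h_def by (subst STFT_diff) (auto intro!: L2_tf_shift \<gamma>_L2 simp: STFT_eq)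
  have zN: "(\<lambda>n. z (n + N)) \<longlonglongrightarrow> z0" using z by (rule LIMSEQ_ignore_initial_segment)
  have "(\<lambda>n. wint (\<lambda>w. norm (STFT \<gamma> (h n) w))) \<longlonglongrightarrow> (\<integral>\<^sup>+w. 0 \<partial>(lborel :: ((real ^ 'n) \<times> (real ^ 'n)) measure))"
    unfolding wint_def
  proof (rule nn_integral_dominated_convergence[where w="\<lambda>w. 2 * B (w - z0) * ennreal (v w)"])
    show "(\<lambda>w. ennreal (norm (STFT \<gamma> (h n) w)) * ennreal (v w)) \<in> borel_measurable lborel" for n
      unfolding Vh by measurable
    show "AE w in lborel. ennreal (norm (STFT \<gamma> (h n) w)) * ennreal (v w) \<le> 2 * B (w - z0) * ennreal (v w)" for n
    proof (intro AE_I2 mult_right_mono)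
      fix w
      have a: "ennreal (norm (K (z (n + N)) w)) \<le> B (w - z0)"
        using B(4)[of "z0 - z (n + N)" "w - z0"] N[of "n + N"] by (simp add: norm_K norm_minus_commute algebra_simps)
      have b: "ennreal (norm (K z0 w)) \<le> B (w - z0)"
        using B(4)[of 0 "w - z0"] B(1) by (simp add: norm_K)
      have "ennreal (norm (STFT \<gamma> (h n) w)) \<le> ennreal (norm (K (z (n + N)) w)) + ennreal (norm (K z0 w))"
        unfolding Vh by (simp add: ennreal_plus[symmetric] norm_triangle_ineq4 ennreal_leI del: ennreal_plus)
      also have "\<dots> \<le> B (w - z0) + B (w - z0)" by (intro add_mono a b)
      finally show "ennreal (norm (STFT \<gamma> (h n) w)) \<le> 2 * B (w - z0)" by (simp add: mult_2)
    qed simp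
    show "(\<integral>\<^sup>+w. 2 * B (w - z0) * ennreal (v w) \<partial>lborel) < \<infinity>"
    proof -
      have "(\<integral>\<^sup>+w. 2 * B (w - z0) * ennreal (v w) \<partial>lborel) = 2 * wint (\<lambda>w. B (w - z0))"
        unfolding wint_def mult.assoc by (rule nn_integral_cmult) measurable
      also have "\<dots> \<le> 2 * (ennreal (v z0) * wint B)" by (intro mult_left_mono wint_translate) auto
      also have "\<dots> < \<infinity>" using B(3) by (simp add: ennreal_mult_less_top)
      finally show ?thesis .
    qed
    show "AE w in lborel. (\<lambda>n. ennreal (norm (STFT \<gamma> (h n) w)) * ennreal (v w)) \<longlonglongrightarrow> 0"
    proof (rule AE_I2)
      fix w
      have "(\<lambda>n. K (z (n + N)) w) \<longlonglongrightarrow> K z0 w"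
        using continuous_on_tendsto_compose[OF continuous_K[of UNIV "\<lambda>z. z" "\<lambda>_. w"] zN] by simp
      then have "(\<lambda>n. norm (STFT \<gamma> (h n) w) * v w) \<longlonglongrightarrow> norm (K z0 w - K z0 w) * v w"
        unfolding Vh by (intro tendsto_intros)
      from tendsto_ennrealI[OF this] show "(\<lambda>n. ennreal (norm (STFT \<gamma> (h n) w)) * ennreal (v w)) \<longlonglongrightarrow> 0"
        by (simp add: ennreal_mult)
    qed
  qed auto
  then have "(\<lambda>n. wint (\<lambda>w. norm (STFT \<gamma> (h n) w))) \<longlonglongrightarrow> ennreal 0" by simp
  then have "(\<lambda>n. enn2real (wint (\<lambda>w. norm (STFT \<gamma> (h n) w)))) \<longlonglongrightarrow> 0"
    by (intro tendsto_enn2real) auto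
  then have "(\<lambda>n. C * enn2real (wint (\<lambda>w. norm (STFT \<gamma> (h n) w)))) \<longlonglongrightarrow> 0"
    by (rule tendsto_mult_right_zero)
  then have "(\<lambda>n. f (h n)) \<longlonglongrightarrow> 0"
    by (rule Lim_null_comparison[rotated]) (use bspec[OF C(2) hM] in auto)
  then have "(\<lambda>n. f (tf_shift (z (n + N)) \<gamma>) - f (tf_shift z0 \<gamma>)) \<longlonglongrightarrow> 0"
    unfolding h_def by (subst (asm) antidual_diff) (auto intro!: M1_tf_shift \<gamma>)
  then have "(\<lambda>n. f (tf_shift (z (n + N)) \<gamma>)) \<longlonglongrightarrow> f (tf_shift z0 \<gamma>)" by (simp add: LIM_zero_iff)
  then show "((\<lambda>z. f (tf_shift z \<gamma>)) \<circ> z) \<longlonglongrightarrow> f (tf_shift z0 \<gamma>)"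
    using LIMSEQ_offset[of "\<lambda>n. f (tf_shift (z n) \<gamma>)"] by (simp add: o_def)
qed

end

end

section \<open>Representation of functionals and oscillation of the kernel\<close>

context tf_window
begin

lemma STFT_M1_facts:
  assumes h: "h \<in> M1_space g\<^sub>0 r s"
  shows "STFT \<gamma> h \<in> borel_measurable borel" "integrable lborel (STFT \<gamma> h)"
    "(LINT z|lborel. STFT \<gamma> h z * K z w) = STFT \<gamma> h w" "integrable lborel (\<lambda>z. STFT \<gamma> h z * K z w)"
proof -
  show m: "STFT \<gamma> h \<in> borel_measurable borel" by (rule measurable_STFT[OF M1_L2[OF h] \<gamma>_L2])
  show i: "integrable lborel (STFT \<gamma> h)" by (rule integrable_if_wint[OF m wint_STFT_M1[OF h \<gamma>]])
  show "(LINT z|lborel. STFT \<gamma> h z * K z w) = STFT \<gamma> h w" "integrable lborel (\<lambda>z. STFT \<gamma> h z * K z w)"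
    using STFT_reproducing[OF M1_L2[OF h] \<gamma>_L2 \<gamma>_L2 i] \<gamma>_nrm by simp_all
qed

lemma norm_G_le_1: "norm (G z) \<le> 1"
  using STFT_bound[OF \<gamma>_L2 \<gamma>_L2, of z] \<gamma>_nrm by simp

lemma integrable_growth_STFT:
  assumes F: "F \<in> borel_measurable borel" "\<And>z. norm (F z) \<le> C * v z" and h: "h \<in> M1_space g\<^sub>0 r s"
  shows "integrable lborel (\<lambda>z. F z * cnj (STFT \<gamma> h z))"
    and "norm (LINT z|lborel. F z * cnj (STFT \<gamma> h z)) \<le> C * enn2real (wint (\<lambda>z. norm (STFT \<gamma> h z)))"
proof -
  have C: "0 \<le> C" using F(2)[of 0] norm_ge_zero[of "F 0"] v_pos[of 0]
    by (metis dual_order.trans zero_le_mult_iff not_le)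
  note [measurable] = F(1) STFT_M1_facts(1)[OF h]
  have "(\<integral>\<^sup>+z. norm (F z * cnj (STFT \<gamma> h z)) \<partial>lborel) \<le> (\<integral>\<^sup>+z. ennreal C * (norm (STFT \<gamma> h z) * ennreal (v z)) \<partial>lborel)"
  proof (intro nn_integral_mono)
    fix z
    have "norm (F z * cnj (STFT \<gamma> h z)) \<le> C * (norm (STFT \<gamma> h z) * v z)"
      using mult_right_mono[OF F(2)[of z], of "norm (STFT \<gamma> h z)"] by (simp add: norm_mult mult_ac)
    then have "ennreal (norm (F z * cnj (STFT \<gamma> h z))) \<le> ennreal (C * (norm (STFT \<gamma> h z) * v z))"
      by (rule ennreal_leI)
    then show "ennreal (norm (F z * cnj (STFT \<gamma> h z))) \<le> ennreal C * (norm (STFT \<gamma> h z) * ennreal (v z))"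
      using C by (simp add: ennreal_mult)
  qed
  also have "\<dots> = ennreal C * wint (\<lambda>z. norm (STFT \<gamma> h z))"
    unfolding wint_def by (rule nn_integral_cmult) measurable
  finally have le: "(\<integral>\<^sup>+z. norm (F z * cnj (STFT \<gamma> h z)) \<partial>lborel) \<le> ennreal C * wint (\<lambda>z. norm (STFT \<gamma> h z))" .
  have fin: "ennreal C * wint (\<lambda>z. norm (STFT \<gamma> h z)) < \<infinity>"
    using wint_STFT_M1[OF h \<gamma>] by (simp add: ennreal_mult_less_top)
  show i: "integrable lborel (\<lambda>z. F z * cnj (STFT \<gamma> h z))"
    by (rule integrableI_bounded) (use le_less_trans[OF le fin] in auto)
  have "ennreal (norm (LINT z|lborel. F z * cnj (STFT \<gamma> h z))) \<le> ennreal C * wint (\<lambda>z. norm (STFT \<gamma> h z))"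
    by (rule order_trans[OF integral_norm_bound_ennreal[OF i] le])
  from enn2real_mono[OF this] fin
  show "norm (LINT z|lborel. F z * cnj (STFT \<gamma> h z)) \<le> C * enn2real (wint (\<lambda>z. norm (STFT \<gamma> h z)))"
    using C by (simp add: enn2real_mult)
qed

text \<open>The functional is evaluated on finite sums \<open>h i\<close> of time-frequency shifts of \<open>\<gamma>\<close>, obtained from
  the reproducing formula by replacing the integration variable \<open>z\<close> with its simple-function
  approximation \<open>\<sigma> i z\<close>; they converge to \<open>h\<close> in \<open>M\<^sup>1\<close> by dominated convergence.\<close>

theorem antidual_representation:
  assumes f: "f \<in> M1_antidual g\<^sub>0 r s" and h: "h \<in> M1_space g\<^sub>0 r s"
  shows "f h = (LINT z|lborel. f (tf_shift z \<gamma>) * cnj (STFT \<gamma> h z))"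
proof -
  define F where "F = (\<lambda>z. f (tf_shift z \<gamma>))"
  define H where "H = STFT \<gamma> h"
  have Fc: "continuous_on UNIV F" unfolding F_def by (rule antidual_continuous[OF f])
  have Fm [measurable]: "F \<in> borel_measurable borel" by (rule borel_measurable_continuous_onI[OF Fc])
  have Hm [measurable]: "H \<in> borel_measurable borel" and Hi: "integrable lborel H"
    using STFT_M1_facts[OF h] by (simp_all add: H_def)
  have Hw: "wint (\<lambda>z. norm (H z)) < \<infinity>" unfolding H_def by (rule wint_STFT_M1[OF h \<gamma>])
  obtain CF where CF: "0 \<le> CF" "\<And>z. norm (F z) \<le> CF * v z"
    unfolding F_def by (rule antidual_growth[OF f \<gamma>]) blast
  obtain C where C: "0 \<le> C" "\<forall>h\<in>M1_space g\<^sub>0 r s. norm (f h) \<le> C * enn2real (wint (\<lambda>z. norm (STFT \<gamma> h z)))"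
    by (rule antidual_bound[OF f])
  obtain \<delta> B where B: "0 < \<delta>" "B \<in> borel_measurable borel" "wint B < \<infinity>"
    "\<And>x u. norm u \<le> \<delta> \<Longrightarrow> ennreal (norm (G (x + u))) \<le> B x"
    using G_majorant by blast
  note [measurable] = B(2)
  obtain V where V: "1 \<le> V" "\<And>z. norm z \<le> \<delta> \<Longrightarrow> v z \<le> V" by (rule v_bounded_cball) blast
  obtain \<sigma> :: "nat \<Rightarrow> (real ^ 'n) \<times> (real ^ 'n) \<Rightarrow> (real ^ 'n) \<times> (real ^ 'n)"
    where \<sigma>: "\<And>i. simple_function borel (\<sigma> i)" "\<And>z. (\<lambda>i. \<sigma> i z) \<longlonglongrightarrow> z"
    using borel_measurable_implies_sequence_metric[of "\<lambda>z. z" borel 0] by auto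
  have \<sigma>m [measurable]: "\<sigma> i \<in> borel_measurable borel" for i
    using \<sigma>(1) by (rule borel_measurable_simple_function)
  define A where "A = (\<lambda>i. {z. norm (\<sigma> i z - z) \<le> \<delta>})"
  have Am [measurable]: "A i \<in> sets borel" for i unfolding A_def by measurable
  have Aev: "eventually (\<lambda>i. z \<in> A i) sequentially" for z
  proof -
    have "(\<lambda>i. norm (\<sigma> i z - z)) \<longlonglongrightarrow> 0"
      using \<sigma>(2)[of z] by (simp add: LIM_zero tendsto_norm_zero)
    from order_tendstoD(2)[OF this B(1)] show ?thesis by (auto simp: A_def elim!: eventually_mono)
  qed
  define S where "S = (\<lambda>i. range (\<sigma> i))"
  have Sf: "finite (S i)" for i using \<sigma>(1)[of i] by (simp add: S_def simple_function_def)
  define \<alpha> where "\<alpha> = (\<lambda>i l. LINT z|lborel. H z * (indicator (A i \<inter> \<sigma> i -` {l}) z :: real))"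
  have pm [measurable]: "A i \<inter> \<sigma> i -` {l} \<in> sets borel" for i l
    using measurable_sets[OF \<sigma>m, of "{l}" i] by (auto intro!: sets.Int)
  have \<alpha>i: "integrable lborel (\<lambda>z. H z * (indicator (A i \<inter> \<sigma> i -` {l}) z :: real))" for i l
    by (rule Bochner_Integration.integrable_bound[OF Hi]) (auto simp: indicator_def)
  have comb: "(\<Sum>l\<in>S i. \<alpha> i l * X l) = (LINT z|lborel. H z * (indicator (A i) z :: real) * X (\<sigma> i z))" for i and X :: "_ \<Rightarrow> complex"
  proof -
    have "(\<Sum>l\<in>S i. \<alpha> i l * X l) = (LINT z|lborel. (\<Sum>l\<in>S i. H z * (indicator (A i \<inter> \<sigma> i -` {l}) z :: real) * X l))"
      unfolding \<alpha>_def using \<alpha>i by (subst Bochner_Integration.integral_sum) auto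
    also have "\<dots> = (LINT z|lborel. H z * (indicator (A i) z :: real) * X (\<sigma> i z))"
    proof (rule Bochner_Integration.integral_cong[OF refl])
      fix z
      have "(\<Sum>l\<in>S i. H z * (indicator (A i \<inter> \<sigma> i -` {l}) z :: real) * X l)
         = (\<Sum>l\<in>S i. if l = \<sigma> i z then H z * (indicator (A i) z :: real) * X l else 0)"
        by (intro sum.cong) (auto simp: indicator_def)
      then show "(\<Sum>l\<in>S i. H z * (indicator (A i \<inter> \<sigma> i -` {l}) z :: real) * X l) = H z * (indicator (A i) z :: real) * X (\<sigma> i z)"
        using Sf by (simp add: S_def)
    qed
    finally show ?thesis .
  qed
  define k where "k = (\<lambda>i t. \<Sum>l\<in>S i. \<alpha> i l * tf_shift l \<gamma> t)"
  have kM: "k i \<in> M1_space g\<^sub>0 r s" for i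
    unfolding k_def by (intro M1_sum Sf M1_scale M1_tf_shift \<gamma>)
  have fk: "cnj (f (k i)) = (LINT z|lborel. H z * (indicator (A i) z :: real) * cnj (F (\<sigma> i z)))" for i
  proof -
    have "f (k i) = (\<Sum>l\<in>S i. cnj (\<alpha> i l) * F l)"
      unfolding k_def F_def
      by (subst antidual_sum[OF f Sf]) (auto intro!: M1_scale M1_tf_shift \<gamma> sum.cong simp: antidual_scale[OF f M1_tf_shift[OF \<gamma>]])
    then show ?thesis using comb[of i "\<lambda>l. cnj (F l)"] by simp
  qed
  have Vk: "STFT \<gamma> (k i) w = (LINT z|lborel. H z * (indicator (A i) z :: real) * K (\<sigma> i z) w)" for i w
  proof -
    have "STFT \<gamma> (k i) w = (\<Sum>l\<in>S i. \<alpha> i l * K l w)"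
      unfolding k_def STFT_eq
      by (subst L2_inner_sum_left[OF Sf]) (auto intro!: L2_scale L2_tf_shift \<gamma>_L2 simp: L2_inner_scale_left)
    then show ?thesis using comb[of i "\<lambda>l. K l w"] by simp
  qed
  have K1: "ennreal (norm (K z w)) \<le> B (w - z)" for z w
    using B(4)[of 0 "w - z"] B(1) by (simp add: norm_K)
  have K2: "ennreal (norm (K (\<sigma> i z) w)) \<le> B (w - z)" if "z \<in> A i" for i z w
    using B(4)[of "z - \<sigma> i z" "w - z"] that by (simp add: norm_K A_def norm_minus_commute)
  have K2i: "integrable lborel (\<lambda>z. H z * (indicator (A i) z :: real) * K (\<sigma> i z) w)" for i w
  proof (rule Bochner_Integration.integrable_bound[OF integrable_mult_right[OF Hi, of "of_real (L2_nrm \<gamma> * L2_nrm \<gamma>)"]])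
    show "AE z in lborel. norm (H z * (indicator (A i) z :: real) * K (\<sigma> i z) w) \<le> norm (of_real (L2_nrm \<gamma> * L2_nrm \<gamma>) * H z)"
      by (intro AE_I2) (auto simp: norm_mult norm_K indicator_def \<gamma>_nrm intro!: mult_left_le norm_G_le_1)
  qed measurable
  let ?E = "\<lambda>i z w. ennreal (norm (H z * (K z w - (indicator (A i) z :: real) * K (\<sigma> i z) w)))"
  have le: "wint (\<lambda>w. norm (STFT \<gamma> (\<lambda>t. h t - k i t) w)) \<le> (\<integral>\<^sup>+p. ?E i (snd p) (fst p) * ennreal (v (fst p)) \<partial>(lborel \<Otimes>\<^sub>M lborel))" for i
  proof -
    have "ennreal (norm (STFT \<gamma> (\<lambda>t. h t - k i t) w)) \<le> (\<integral>\<^sup>+z. ?E i z w \<partial>lborel)" for w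
    proof -
      have "STFT \<gamma> (\<lambda>t. h t - k i t) w = H w - STFT \<gamma> (k i) w"
        unfolding H_def by (intro STFT_diff M1_L2 h kM \<gamma>_L2)
      also have "\<dots> = (LINT z|lborel. H z * K z w) - (LINT z|lborel. H z * (indicator (A i) z :: real) * K (\<sigma> i z) w)"
        unfolding Vk using STFT_M1_facts(3)[OF h, of w] by (simp add: H_def)
      also have "\<dots> = (LINT z|lborel. H z * (K z w - (indicator (A i) z :: real) * K (\<sigma> i z) w))"
        using STFT_M1_facts(4)[OF h, of w] K2i[of i w]
        by (subst Bochner_Integration.integral_diff[symmetric]) (auto simp: H_def algebra_simps)
      finally have eq: "STFT \<gamma> (\<lambda>t. h t - k i t) w
         = (LINT z|lborel. H z * (K z w - (indicator (A i) z :: real) * K (\<sigma> i z) w))" .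
      have "integrable lborel (\<lambda>z. H z * K z w - H z * (indicator (A i) z :: real) * K (\<sigma> i z) w)"
        using STFT_M1_facts(4)[OF h, of w] K2i[of i w] by (auto simp: H_def)
      then have "integrable lborel (\<lambda>z. H z * (K z w - (indicator (A i) z :: real) * K (\<sigma> i z) w))"
        by (simp add: right_diff_distrib mult.assoc)
      then show ?thesis unfolding eq by (rule integral_norm_bound_ennreal)
    qed
    then have "wint (\<lambda>w. norm (STFT \<gamma> (\<lambda>t. h t - k i t) w)) \<le> wint (\<lambda>w. \<integral>\<^sup>+z. ?E i z w \<partial>lborel)"
      by (rule wint_mono)
    also have "\<dots> = (\<integral>\<^sup>+w. \<integral>\<^sup>+z. ?E i z w * ennreal (v w) \<partial>lborel \<partial>lborel)"
      unfolding wint_def by (intro nn_integral_cong nn_integral_multc[symmetric]) measurable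
    also have "\<dots> = (\<integral>\<^sup>+p. ?E i (snd p) (fst p) * ennreal (v (fst p)) \<partial>(lborel \<Otimes>\<^sub>M lborel))"
      by (subst lborel.nn_integral_fst[symmetric]) auto
    finally show ?thesis .
  qed
  have lim: "(\<lambda>i. \<integral>\<^sup>+p. ?E i (snd p) (fst p) * ennreal (v (fst p)) \<partial>(lborel \<Otimes>\<^sub>M lborel))
     \<longlonglongrightarrow> (\<integral>\<^sup>+p. 0 \<partial>(lborel \<Otimes>\<^sub>M lborel :: (((real ^ 'n) \<times> (real ^ 'n)) \<times> ((real ^ 'n) \<times> (real ^ 'n))) measure))"
  proof (rule nn_integral_dominated_convergence[where w="\<lambda>p. 2 * (ennreal (norm (H (snd p))) * B (fst p - snd p)) * ennreal (v (fst p))"])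
    show "AE p in lborel \<Otimes>\<^sub>M lborel. ?E i (snd p) (fst p) * ennreal (v (fst p))
       \<le> 2 * (ennreal (norm (H (snd p))) * B (fst p - snd p)) * ennreal (v (fst p))" for i
    proof (intro AE_I2 mult_right_mono)
      fix p :: "((real ^ 'n) \<times> (real ^ 'n)) \<times> ((real ^ 'n) \<times> (real ^ 'n))"
      let ?z = "snd p" and ?w = "fst p"
      have "ennreal (norm (K ?z ?w - (indicator (A i) ?z :: real) * K (\<sigma> i ?z) ?w))
         \<le> ennreal (norm (K ?z ?w)) + ennreal (norm ((indicator (A i) ?z :: real) * K (\<sigma> i ?z) ?w))"
        by (simp add: ennreal_plus[symmetric] norm_triangle_ineq4 ennreal_leI del: ennreal_plus)
      also have "\<dots> \<le> B (?w - ?z) + B (?w - ?z)"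
        using K1[of ?z ?w] K2[of ?z i ?w] by (intro add_mono) (auto simp: indicator_def)
      finally have "ennreal (norm (H ?z)) * ennreal (norm (K ?z ?w - (indicator (A i) ?z :: real) * K (\<sigma> i ?z) ?w))
         \<le> ennreal (norm (H ?z)) * (2 * B (?w - ?z))" by (intro mult_left_mono) (auto simp: mult_2)
      then show "?E i ?z ?w \<le> 2 * (ennreal (norm (H ?z)) * B (?w - ?z))"
        by (simp add: norm_mult ennreal_mult mult_ac)
    qed simp
    have "(\<integral>\<^sup>+p. 2 * (ennreal (norm (H (snd p))) * B (fst p - snd p)) * ennreal (v (fst p)) \<partial>(lborel \<Otimes>\<^sub>M lborel))
       = 2 * (\<integral>\<^sup>+p. (ennreal (norm (H (snd p))) * B (fst p - snd p)) * ennreal (v (fst p)) \<partial>(lborel \<Otimes>\<^sub>M lborel))"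
      unfolding mult.assoc[of 2] by (rule nn_integral_cmult) measurable
    also have "(\<integral>\<^sup>+p. (ennreal (norm (H (snd p))) * B (fst p - snd p)) * ennreal (v (fst p)) \<partial>(lborel \<Otimes>\<^sub>M lborel))
       = wint (\<lambda>w. \<integral>\<^sup>+z. ennreal (norm (H z)) * B (w - z) \<partial>lborel)"
      unfolding wint_def by (subst lborel.nn_integral_fst[symmetric]) (auto simp: nn_integral_multc)
    also have "2 * \<dots> \<le> 2 * (wint (\<lambda>z. norm (H z)) * wint B)"
      by (intro mult_left_mono wint_conv) auto
    also have "\<dots> < \<infinity>" using Hw B(3) by (simp add: ennreal_mult_less_top)
    finally show "(\<integral>\<^sup>+p. 2 * (ennreal (norm (H (snd p))) * B (fst p - snd p)) * ennreal (v (fst p)) \<partial>(lborel \<Otimes>\<^sub>M lborel)) < \<infinity>" .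
    show "AE p in lborel \<Otimes>\<^sub>M lborel. (\<lambda>i. ?E i (snd p) (fst p) * ennreal (v (fst p))) \<longlonglongrightarrow> 0"
    proof (rule AE_I2)
      fix p :: "((real ^ 'n) \<times> (real ^ 'n)) \<times> ((real ^ 'n) \<times> (real ^ 'n))"
      let ?z = "snd p" and ?w = "fst p"
      have "(\<lambda>i. K (\<sigma> i ?z) ?w) \<longlonglongrightarrow> K ?z ?w"
        using continuous_on_tendsto_compose[OF continuous_K[of UNIV "\<lambda>z. z" "\<lambda>_. ?w"] \<sigma>(2)] by simp
      moreover have "(\<lambda>i. complex_of_real (indicator (A i) ?z)) \<longlonglongrightarrow> 1"
        by (rule tendsto_eventually) (use Aev[of ?z] in \<open>auto elim!: eventually_mono\<close>)
      ultimately have "(\<lambda>i. norm (H ?z * (K ?z ?w - (indicator (A i) ?z :: real) * K (\<sigma> i ?z) ?w)) * v ?w)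
         \<longlonglongrightarrow> norm (H ?z * (K ?z ?w - 1 * K ?z ?w)) * v ?w" by (intro tendsto_intros)
      from tendsto_ennrealI[OF this] show "(\<lambda>i. ?E i ?z ?w * ennreal (v ?w)) \<longlonglongrightarrow> 0"
        by (simp add: ennreal_mult)
    qed
  qed measurable
  have "(\<lambda>i. wint (\<lambda>w. norm (STFT \<gamma> (\<lambda>t. h t - k i t) w))) \<longlonglongrightarrow> ennreal 0"
    by (rule tendsto_sandwich[OF _ _ tendsto_const lim[simplified, folded ennreal_0]]) (use le in auto)
  then have "(\<lambda>i. enn2real (wint (\<lambda>w. norm (STFT \<gamma> (\<lambda>t. h t - k i t) w)))) \<longlonglongrightarrow> 0"
    by (intro tendsto_enn2real) auto
  then have "(\<lambda>i. C * enn2real (wint (\<lambda>w. norm (STFT \<gamma> (\<lambda>t. h t - k i t) w)))) \<longlonglongrightarrow> 0"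
    by (rule tendsto_mult_right_zero)
  then have "(\<lambda>i. f (\<lambda>t. h t - k i t)) \<longlonglongrightarrow> 0"
    by (rule Lim_null_comparison[rotated]) (use bspec[OF C(2) M1_diff[OF h kM]] in auto)
  then have "(\<lambda>i. f h - f (k i)) \<longlonglongrightarrow> 0"
    by (simp add: antidual_diff[OF f h kM])
  then have "(\<lambda>i. f h - (f h - f (k i))) \<longlonglongrightarrow> f h - 0"
    by (intro tendsto_diff tendsto_const)
  then have l1: "(\<lambda>i. f (k i)) \<longlonglongrightarrow> f h" by simp
  have "(\<lambda>i. cnj (f (k i))) \<longlonglongrightarrow> (LINT z|lborel. H z * cnj (F z))"
    unfolding fk
  proof (rule integral_dominated_convergence[where w="\<lambda>z. norm (H z) * v z * (CF * V)"])
    show "integrable lborel (\<lambda>z. norm (H z) * v z * (CF * V))"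
      using Hw by (intro integrable_mult_left) (auto simp: integrable_iff_bounded wint_def ennreal_mult abs_mult)
    show "AE z in lborel. norm (H z * (indicator (A i) z :: real) * cnj (F (\<sigma> i z))) \<le> norm (H z) * v z * (CF * V)" for i
    proof (rule AE_I2)
      fix z
      show "norm (H z * (indicator (A i) z :: real) * cnj (F (\<sigma> i z))) \<le> norm (H z) * v z * (CF * V)"
      proof (cases "z \<in> A i")
        case True
        then have "v (\<sigma> i z - z) \<le> V" by (intro V) (auto simp: A_def)
        then have "v (\<sigma> i z) \<le> v z * V"
          using v_le_diff[of "\<sigma> i z" z] by (meson mult_left_mono order_trans v_nonneg)
        then have "norm (F (\<sigma> i z)) \<le> CF * (v z * V)"
          using CF(2)[of "\<sigma> i z"] mult_left_mono[OF _ CF(1)] by fastforce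
        from mult_left_mono[OF this norm_ge_zero[of "H z"]] show ?thesis
          using True by (simp add: norm_mult mult_ac)
      qed (use CF(1) V(1) in simp)
    qed
    show "AE z in lborel. (\<lambda>i. H z * (indicator (A i) z :: real) * cnj (F (\<sigma> i z))) \<longlonglongrightarrow> H z * cnj (F z)"
    proof (rule AE_I2)
      fix z
      have "(\<lambda>i. F (\<sigma> i z)) \<longlonglongrightarrow> F z" using continuous_on_tendsto_compose[OF Fc \<sigma>(2)] by simp
      moreover have "(\<lambda>i. complex_of_real (indicator (A i) z)) \<longlonglongrightarrow> 1"
        by (rule tendsto_eventually) (use Aev[of z] in \<open>auto elim!: eventually_mono\<close>)
      ultimately have "(\<lambda>i. H z * (indicator (A i) z :: real) * cnj (F (\<sigma> i z))) \<longlonglongrightarrow> H z * 1 * cnj (F z)"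
        by (intro tendsto_intros)
      then show "(\<lambda>i. H z * (indicator (A i) z :: real) * cnj (F (\<sigma> i z))) \<longlonglongrightarrow> H z * cnj (F z)" by simp
    qed
  qed measurable
  from LIMSEQ_unique[OF this tendsto_cnj[OF l1]] have "cnj (f h) = (LINT z|lborel. H z * cnj (F z))" by simp
  then have "cnj (cnj (f h)) = (LINT z|lborel. cnj (H z * cnj (F z)))"
    by (simp only: Bochner_Integration.integral_cnj)
  then show ?thesis by (simp add: H_def F_def mult.commute)
qed


lemma antidual_STFT_other_window:
  assumes f: "f \<in> M1_antidual g\<^sub>0 r s" and e: "e \<in> M1_space g\<^sub>0 r s"
  shows "(\<lambda>w. f (tf_shift w e)) \<in> borel_measurable borel"
    and "ennreal (norm (f (tf_shift w e))) \<le> (\<integral>\<^sup>+z. norm (f (tf_shift z \<gamma>)) * ennreal (norm (STFT e \<gamma> (w - z))) \<partial>lborel)"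
proof -
  define F where "F = (\<lambda>z. f (tf_shift z \<gamma>))"
  have Fm [measurable]: "F \<in> borel_measurable borel"
    unfolding F_def by (rule borel_measurable_continuous_onI[OF antidual_continuous[OF f]])
  have eq: "cnj (STFT \<gamma> (tf_shift w e) z) = L2_inner (tf_shift z \<gamma>) (tf_shift w e)" for z w
    by (simp add: STFT_eq L2_inner_cnj)
  have rep: "f (tf_shift w e) = (LINT z|lborel. F z * L2_inner (tf_shift z \<gamma>) (tf_shift w e))" for w
    using antidual_representation[OF f M1_tf_shift[OF e, of w]] by (simp add: F_def eq)
  have [measurable]: "(\<lambda>p. L2_inner (tf_shift (f p) \<gamma>) (tf_shift (h p) e)) \<in> borel_measurable M"
    if "f \<in> borel_measurable M" "h \<in> borel_measurable M" for f h and M :: "'z measure"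
    using that by (intro measurable_tf_kernel \<gamma>_L2 M1_L2[OF e])
  show "(\<lambda>w. f (tf_shift w e)) \<in> borel_measurable borel"
    unfolding rep by measurable
  obtain C where C: "0 \<le> C" "\<And>z. norm (F z) \<le> C * v z"
    unfolding F_def by (rule antidual_growth[OF f \<gamma>]) blast
  have "ennreal (norm (f (tf_shift w e))) \<le> (\<integral>\<^sup>+z. norm (F z * L2_inner (tf_shift z \<gamma>) (tf_shift w e)) \<partial>lborel)"
    unfolding rep
    by (rule integral_norm_bound_ennreal)
       (use integrable_growth_STFT(1)[OF Fm C(2) M1_tf_shift[OF e, of w]] in \<open>simp add: eq\<close>)
  then show "ennreal (norm (f (tf_shift w e))) \<le> (\<integral>\<^sup>+z. norm (f (tf_shift z \<gamma>)) * ennreal (norm (STFT e \<gamma> (w - z))) \<partial>lborel)"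
    by (simp add: F_def norm_mult norm_L2_inner_tf_shift ennreal_mult)
qed

lemma K_shift_difference:
  "norm (K y z - cnj (unimod (snd (z - l) \<bullet> fst l)) * K y l) = norm (K (y - l) (z - l) - K (y - l) 0)"
proof -
  have split: "tf_shift x \<gamma> = (\<lambda>t. unimod (snd (x - l) \<bullet> fst l) * tf_shift l (tf_shift (x - l) \<gamma>) t)" for x
    by (rule ext) (simp add: tf_shift_tf_shift mult.assoc[symmetric])
  have iso: "L2_inner (tf_shift l a) (tf_shift l b) = L2_inner a b" for a b :: "real ^ 'n \<Rightarrow> complex"
    by (simp add: L2_inner_tf_shift_tf_shift STFT_eq)
  have scale: "L2_inner (\<lambda>t. c * a t) (\<lambda>t. d * b t) = c * cnj d * L2_inner a b" for c d and a b :: "real ^ 'n \<Rightarrow> complex"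
  proof -
    have "L2_inner a (\<lambda>t. d * b t) = cnj d * L2_inner a b"
      using arg_cong[OF L2_inner_scale_left[of d b a], of cnj] by (simp add: L2_inner_cnj)
    then show ?thesis by (simp add: L2_inner_scale_left)
  qed
  let ?b = "unimod (snd (y - l) \<bullet> fst l)" and ?a = "unimod (snd (z - l) \<bullet> fst l)"
  have 1: "K y z = ?b * cnj ?a * K (y - l) (z - l)"
    by (subst split[of y], subst split[of z], subst scale) (simp only: iso)
  have 2: "K y l = ?b * K (y - l) 0"
    by (subst split[of y], subst split[of l], subst scale) (simp add: iso)
  have "K y z - cnj ?a * K y l = ?b * cnj ?a * (K (y - l) (z - l) - K (y - l) 0)"
    unfolding 1 2 by (simp add: algebra_simps)
  then show ?thesis by (simp add: norm_mult)
qed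

lemma oscillation_kernel:
  assumes \<epsilon>: "0 < \<epsilon>" and \<eta>0: "0 < \<eta>0"
  obtains \<eta> N where "0 < \<eta>" "\<eta> \<le> \<eta>0" "N \<in> borel_measurable borel" "wint N \<le> ennreal \<epsilon>"
    "\<And>x u u'. norm u \<le> \<eta> \<Longrightarrow> norm u' \<le> \<eta> \<Longrightarrow> ennreal (norm (K (x + u') u - K (x + u') 0)) \<le> N x"
proof -
  obtain \<delta> B where B: "0 < \<delta>" "B \<in> borel_measurable borel" "wint B < \<infinity>"
    "\<And>x u. norm u \<le> \<delta> \<Longrightarrow> ennreal (norm (G (x + u))) \<le> B x"
    using G_majorant by blast
  note [measurable] = B(2)
  define \<eta> where "\<eta> = (\<lambda>k::nat. min \<eta>0 (\<delta> / 2) / Suc k)"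
  have \<eta>pos: "0 < \<eta> k" for k using \<eta>0 B(1) by (simp add: \<eta>_def)
  have "min \<eta>0 (\<delta> / 2) / Suc k \<le> min \<eta>0 (\<delta> / 2) / 1" for k
    using \<eta>0 B(1) by (intro divide_left_mono) auto
  then have \<eta>le: "\<eta> k \<le> \<eta>0" "\<eta> k \<le> \<delta> / 2" for k by (simp_all add: \<eta>_def)
  have \<eta>lim: "\<eta> \<longlonglongrightarrow> 0" unfolding \<eta>_def by (rule LIMSEQ_Suc[OF lim_const_over_n])
  define D where "D = (\<lambda>p x. norm (K (x + snd p) (fst p) - K (x + snd p) 0))"
  define Q where "Q = (\<lambda>k. {p :: ((real ^ 'n) \<times> (real ^ 'n)) \<times> ((real ^ 'n) \<times> (real ^ 'n)). norm (fst p) \<le> \<eta> k \<and> norm (snd p) \<le> \<eta> k})"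
  define N where "N = (\<lambda>k x. SUP p\<in>Q k. ennreal (D p x))"
  have Nle: "N k x \<le> 2 * B (- x)" for k x
    unfolding N_def
  proof (rule SUP_least)
    fix p assume p: "p \<in> Q k"
    have "norm (fst p - snd p) \<le> \<delta>" "norm (- snd p) \<le> \<delta>"
      using p \<eta>le(2)[of k] norm_triangle_ineq4[of "fst p" "snd p"] B(1) by (auto simp: Q_def)
    from B(4)[OF this(1), of "-x"] B(4)[OF this(2), of "-x"]
    have "ennreal (norm (K (x + snd p) (fst p))) \<le> B (- x)" "ennreal (norm (K (x + snd p) 0)) \<le> B (- x)"
      unfolding norm_K by (simp_all add: algebra_simps)
    then have "ennreal (norm (K (x + snd p) (fst p))) + ennreal (norm (K (x + snd p) 0)) \<le> B (- x) + B (- x)"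
      by (rule add_mono)
    moreover have "ennreal (D p x) \<le> ennreal (norm (K (x + snd p) (fst p))) + ennreal (norm (K (x + snd p) 0))"
      by (simp add: D_def ennreal_plus[symmetric] norm_triangle_ineq4 ennreal_leI del: ennreal_plus)
    ultimately show "ennreal (D p x) \<le> 2 * B (- x)" by (simp add: mult_2)
  qed
  have Nm [measurable]: "N k \<in> borel_measurable borel" for k
  proof (rule borel_measurableI_greater)
    fix y
    have "{x \<in> space borel. y < N k x} = (\<Union>p\<in>Q k. {x. y < ennreal (D p x)})"
      by (auto simp: N_def less_SUP_iff)
    moreover have op: "open {x. y < ennreal (D p x)}" for p
      unfolding D_def by (intro open_Collect_less continuous_on_ennreal continuous_intros)
    ultimately show "{x \<in> space borel. y < N k x} \<in> sets borel"
      by (simp only: open_UN[OF ballI[OF op]] borel_open)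
  qed
  have Nlim: "(\<lambda>k. N k x) \<longlonglongrightarrow> 0" for x
  proof (rule order_tendstoI)
    fix a :: ennreal assume "0 < a"
    then obtain e where e: "0 < e" "e < a" using dense by blast
    then obtain e' where e': "e = ennreal e'" "0 < e'"
      by (cases e) auto
    have "continuous_on UNIV (\<lambda>p. D p x)" unfolding D_def by (intro continuous_intros)
    then have "isCont (\<lambda>p. D p x) 0" using continuous_on_eq_continuous_at[OF open_UNIV] by blast
    then have "((\<lambda>p. D p x) \<longlongrightarrow> D 0 x) (nhds 0)"
      unfolding continuous_at using tendsto_at_iff_tendsto_nhds[of "\<lambda>p. D p x" 0] by blast
    then have "eventually (\<lambda>p. D p x < e') (nhds 0)"
      by (rule order_tendstoD(2)) (simp add: D_def e')
    then obtain \<rho> where \<rho>: "0 < \<rho>" "\<And>p. dist p 0 < \<rho> \<Longrightarrow> D p x < e'"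
      by (auto simp: eventually_nhds_metric)
    have "eventually (\<lambda>k. \<eta> k < \<rho> / 2) sequentially"
      using order_tendstoD(2)[OF \<eta>lim, of "\<rho> / 2"] \<rho>(1) by simp
    then show "eventually (\<lambda>k. N k x < a) sequentially"
    proof eventually_elim
      case (elim k)
      have "N k x \<le> ennreal e'"
        unfolding N_def
      proof (rule SUP_least)
        fix p assume p: "p \<in> Q k"
        have "dist p 0 \<le> norm (fst p) + norm (snd p)"
          using norm_Pair_le[of "fst p" "snd p"] by simp
        also have "\<dots> < \<rho>" using p elim by (auto simp: Q_def)
        finally show "ennreal (D p x) \<le> ennreal e'" using \<rho>(2)[of p] by (intro ennreal_leI) simp
      qed
      then show "N k x < a" using e e' by auto
    qed
  qed auto
  have "(\<lambda>k. wint (N k)) \<longlonglongrightarrow> (\<integral>\<^sup>+x. 0 \<partial>(lborel :: ((real ^ 'n) \<times> (real ^ 'n)) measure))"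
    unfolding wint_def
  proof (rule nn_integral_dominated_convergence[where w="\<lambda>x. 2 * B (- x) * ennreal (v x)"])
    show "AE x in lborel. N k x * ennreal (v x) \<le> 2 * B (- x) * ennreal (v x)" for k
      by (intro AE_I2 mult_right_mono Nle) auto
    have "(\<integral>\<^sup>+x. 2 * B (- x) * ennreal (v x) \<partial>lborel) = 2 * wint (\<lambda>x. B (- x))"
      unfolding wint_def mult.assoc by (rule nn_integral_cmult) measurable
    also have "\<dots> < \<infinity>" using B(3) by (simp add: wint_reflect ennreal_mult_less_top)
    finally show "(\<integral>\<^sup>+x. 2 * B (- x) * ennreal (v x) \<partial>lborel) < \<infinity>" .
    show "AE x in lborel. (\<lambda>k. N k x * ennreal (v x)) \<longlonglongrightarrow> 0"
      using tendsto_mult_ennreal[OF Nlim tendsto_const, of "ennreal (v _)"] by (intro AE_I2) simp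
  qed auto
  then have "(\<lambda>k. wint (N k)) \<longlonglongrightarrow> 0" by simp
  from order_tendstoD(2)[OF this, of "ennreal \<epsilon>"] \<epsilon>
  obtain k where k: "wint (N k) < ennreal \<epsilon>" by (auto simp: eventually_sequentially)
  have "ennreal (norm (K (x + u') u - K (x + u') 0)) \<le> N k x" if "norm u \<le> \<eta> k" "norm u' \<le> \<eta> k" for x u u'
  proof -
    have "(u, u') \<in> Q k" using that by (simp add: Q_def)
    from SUP_upper[OF this, of "\<lambda>p. ennreal (D p x)"] show ?thesis by (simp add: N_def D_def)
  qed
  then show ?thesis using that[OF \<eta>pos \<eta>le(1) Nm less_imp_le[OF k]] by blast
qed

end

section \<open>Sampling on cells\<close>

context tf_window
begin

definition reproject :: "((real ^ 'n) \<times> (real ^ 'n) \<Rightarrow> complex) \<Rightarrow> (real ^ 'n) \<times> (real ^ 'n) \<Rightarrow> complex" where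
  "reproject F w = (LINT z|lborel. F z * K z w)"

definition synthesis :: "((real ^ 'n) \<times> (real ^ 'n) \<Rightarrow> complex) \<Rightarrow> (real ^ 'n \<Rightarrow> complex) \<Rightarrow> complex" where
  "synthesis F h = (if h \<in> M1_space g\<^sub>0 r s then (LINT z|lborel. F z * cnj (STFT \<gamma> h z)) else 0)"

definition moderate :: "((real ^ 'n) \<times> (real ^ 'n) \<Rightarrow> complex) \<Rightarrow> bool" where
  "moderate F \<longleftrightarrow> F \<in> borel_measurable borel \<and> (\<exists>C. \<forall>z. norm (F z) \<le> C * v z)"

lemma moderateI: "F \<in> borel_measurable borel \<Longrightarrow> (\<And>z. norm (F z) \<le> C * v z) \<Longrightarrow> moderate F"
  unfolding moderate_def by blast

lemma moderate_measurable: "moderate F \<Longrightarrow> F \<in> borel_measurable borel"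
  by (simp add: moderate_def)

lemma moderateE:
  assumes "moderate F"
  obtains C where "0 \<le> C" "\<And>z. norm (F z) \<le> C * v z"
proof -
  obtain C where C: "\<forall>z. norm (F z) \<le> C * v z" using assms unfolding moderate_def by blast
  have "norm (F z) \<le> \<bar>C\<bar> * v z" for z
    by (rule order_trans[OF spec[OF C] mult_right_mono[OF abs_ge_self v_nonneg]])
  then show ?thesis using that[of "\<bar>C\<bar>"] by auto
qed

lemma moderate_add:
  assumes "moderate F" "moderate H" shows "moderate (\<lambda>z. F z + H z)"
proof -
  obtain C D where "\<And>z. norm (F z) \<le> C * v z" "\<And>z. norm (H z) \<le> D * v z"
    using assms by (auto simp: moderate_def)
  then have "norm (F z + H z) \<le> (C + D) * v z" for z
    using norm_triangle_ineq[of "F z" "H z"] by (simp add: distrib_right) (meson add_mono order_trans)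
  then show ?thesis
    using borel_measurable_add[OF moderate_measurable[OF assms(1)] moderate_measurable[OF assms(2)]]
    by (intro moderateI[of _ "C + D"])
qed

lemma moderate_scale:
  assumes "moderate F" shows "moderate (\<lambda>z. c * F z)"
proof -
  obtain C where "\<And>z. norm (F z) \<le> C * v z" using assms by (auto simp: moderate_def)
  then have "norm (c * F z) \<le> (norm c * C) * v z" for z
    using mult_left_mono[of "norm (F z)" "C * v z" "norm c"] by (simp add: norm_mult mult.assoc)
  then show ?thesis
    using borel_measurable_times[OF borel_measurable_const moderate_measurable[OF assms]]
    by (intro moderateI[of _ "norm c * C"])
qed

lemma moderate_diff: "moderate F \<Longrightarrow> moderate H \<Longrightarrow> moderate (\<lambda>z. F z - H z)"
  using moderate_add[of F "\<lambda>z. -1 * H z"] moderate_scale[of H "-1"] by simp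

lemma moderate_integrable:
  assumes "moderate F" "h \<in> M1_space g\<^sub>0 r s"
  shows "integrable lborel (\<lambda>z. F z * cnj (STFT \<gamma> h z))"
proof -
  obtain C where "\<And>z. norm (F z) \<le> C * v z" using assms by (auto simp: moderate_def)
  from integrable_growth_STFT(1)[OF moderate_measurable[OF assms(1)] this assms(2)] show ?thesis .
qed

lemma cnj_STFT_K: "cnj (STFT \<gamma> (tf_shift w \<gamma>) z) = K z w"
  by (simp add: STFT_eq L2_inner_cnj)

lemma reproject_integrable: "moderate F \<Longrightarrow> integrable lborel (\<lambda>z. F z * K z w)"
  using moderate_integrable[OF _ M1_tf_shift[OF \<gamma>], of F w] by (simp add: cnj_STFT_K)

lemma synthesis_tf_shift: "synthesis F (tf_shift w \<gamma>) = reproject F w"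
  by (simp add: synthesis_def reproject_def M1_tf_shift[OF \<gamma>] cnj_STFT_K)

lemma reproject_measurable: "moderate F \<Longrightarrow> reproject F \<in> borel_measurable borel"
proof -
  assume "moderate F"
  note [measurable] = moderate_measurable[OF this]
  show ?thesis unfolding reproject_def[abs_def] by measurable
qed

lemma reproject_bound:
  assumes "moderate F"
  shows "ennreal (norm (reproject F w)) \<le> (\<integral>\<^sup>+z. ennreal (norm (F z)) * ennreal (norm (G (w - z))) \<partial>lborel)"
  using integral_norm_bound_ennreal[OF reproject_integrable[OF assms, of w]]
  by (simp add: reproject_def norm_mult norm_K ennreal_mult)

lemma reproject_growth:
  assumes F: "F \<in> borel_measurable borel" "\<And>z. norm (F z) \<le> C * v z" "0 \<le> C"
    and D: "wint (\<lambda>z. norm (G z)) \<le> ennreal D" "0 \<le> D"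
  shows "norm (reproject F w) \<le> D * C * v w"
  using growth_Young[of "\<lambda>z. norm (F z)" C "\<lambda>z. ennreal (norm (G z))" D "norm (reproject F w)" w]
    reproject_bound[OF moderateI[OF F(1,2)], of w] F D by simp

lemma reproject_moderate: "moderate F \<Longrightarrow> moderate (reproject F)"
proof -
  assume F: "moderate F"
  obtain C where "0 \<le> C" "\<And>z. norm (F z) \<le> C * v z" using moderateE[OF F] by blast
  moreover have "wint (\<lambda>z. norm (G z)) \<le> ennreal (enn2real (wint (\<lambda>z. norm (G z))))"
    using wint_G by simp
  ultimately have "norm (reproject F w) \<le> (enn2real (wint (\<lambda>z. norm (G z))) * C) * v w" for w
    by (intro reproject_growth moderate_measurable F) auto
  then show ?thesis by (intro moderateI[OF reproject_measurable[OF F]])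
qed

lemma reproject_diff:
  "moderate F \<Longrightarrow> moderate H \<Longrightarrow> reproject (\<lambda>z. F z - H z) w = reproject F w - reproject H w"
  unfolding reproject_def left_diff_distrib
  by (intro Bochner_Integration.integral_diff reproject_integrable)

lemma reproject_add:
  "moderate F \<Longrightarrow> moderate H \<Longrightarrow> reproject (\<lambda>z. F z + H z) w = reproject F w + reproject H w"
  unfolding reproject_def distrib_right
  by (intro Bochner_Integration.integral_add reproject_integrable)

lemma reproject_scale: "reproject (\<lambda>z. c * F z) w = c * reproject F w"
  unfolding reproject_def mult.assoc by simp

lemma synthesis_antidual:
  assumes F: "moderate F"
  shows "synthesis F \<in> M1_antidual g\<^sub>0 r s"
  unfolding M1_antidual_def
proof (intro CollectI conjI ballI allI impI)
  fix h k assume h: "h \<in> M1_space g\<^sub>0 r s" and k: "k \<in> M1_space g\<^sub>0 r s"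
  show "synthesis F (\<lambda>t. h t + k t) = synthesis F h + synthesis F k"
    using h k M1_add[OF h k] moderate_integrable[OF F h] moderate_integrable[OF F k]
    by (simp add: synthesis_def STFT_add[OF M1_L2[OF h] M1_L2[OF k] \<gamma>_L2] distrib_left)
next
  fix a h assume h: "h \<in> M1_space g\<^sub>0 r s"
  have "(LINT z|lborel. F z * cnj (STFT \<gamma> (\<lambda>t. a * h t) z)) = (LINT z|lborel. cnj a * (F z * cnj (STFT \<gamma> h z)))"
    by (simp add: STFT_scale mult_ac)
  then show "synthesis F (\<lambda>t. a * h t) = cnj a * synthesis F h"
    using h M1_scale[OF h, of a] by (simp add: synthesis_def)
next
  fix h assume "h \<notin> M1_space g\<^sub>0 r s"
  then show "synthesis F h = 0" by (simp add: synthesis_def)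
next
  obtain C where C: "0 \<le> C" "\<And>z. norm (F z) \<le> C * v z" using moderateE[OF F] by blast
  let ?D = "enn2real (wint (\<lambda>z. norm (STFT \<gamma> g\<^sub>0 z))) / (L2_nrm g\<^sub>0)\<^sup>2"
  have "norm (synthesis F h) \<le> (C * ?D) * M1_norm g\<^sub>0 r s h" if h: "h \<in> M1_space g\<^sub>0 r s" for h
  proof -
    have f0: "wint (\<lambda>z. norm (STFT g\<^sub>0 h z)) < \<infinity>" "wint (\<lambda>z. norm (STFT \<gamma> g\<^sub>0 z)) < \<infinity>"
      using wint_STFT_M1 h \<gamma> g0_M1 by auto
    have "wint (\<lambda>z. norm (STFT \<gamma> h z)) * ennreal ((L2_nrm g\<^sub>0)\<^sup>2) \<le> wint (\<lambda>z. norm (STFT g\<^sub>0 h z)) * wint (\<lambda>z. norm (STFT \<gamma> g\<^sub>0 z))"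
      by (rule wint_STFT_window_change[OF M1_L2[OF h] g0_L2 \<gamma>_L2 f0(1)])
    from enn2real_mono[OF this] f0
    have "enn2real (wint (\<lambda>z. norm (STFT \<gamma> h z))) * (L2_nrm g\<^sub>0)\<^sup>2 \<le> M1_norm g\<^sub>0 r s h * enn2real (wint (\<lambda>z. norm (STFT \<gamma> g\<^sub>0 z)))"
      by (simp add: enn2real_mult M1_iff(2)[OF g0_L2 M1_L2[OF h]] ennreal_mult_less_top)
    then have "enn2real (wint (\<lambda>z. norm (STFT \<gamma> h z))) \<le> ?D * M1_norm g\<^sub>0 r s h"
      using g0_nz by (simp add: field_simps)
    then have "C * enn2real (wint (\<lambda>z. norm (STFT \<gamma> h z))) \<le> C * (?D * M1_norm g\<^sub>0 r s h)"
      using C(1) by (rule mult_left_mono)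
    moreover have "norm (synthesis F h) \<le> C * enn2real (wint (\<lambda>z. norm (STFT \<gamma> h z)))"
      using integrable_growth_STFT(2)[OF moderate_measurable[OF F] C(2) h] h by (simp add: synthesis_def)
    ultimately show ?thesis by (simp add: mult.assoc)
  qed
  then show "\<exists>C. \<forall>h\<in>M1_space g\<^sub>0 r s. norm (synthesis F h) \<le> C * M1_norm g\<^sub>0 r s h" by blast
qed

lemma antidual_moderate:
  assumes f: "f \<in> M1_antidual g\<^sub>0 r s" shows "moderate (\<lambda>z. f (tf_shift z \<gamma>))"
proof -
  obtain C where "0 \<le> C" "\<And>z. norm (f (tf_shift z \<gamma>)) \<le> C * v z"
    by (rule antidual_growth[OF f \<gamma>]) blast
  then show ?thesis
    by (intro moderateI borel_measurable_continuous_onI[OF antidual_continuous[OF f]])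
qed

lemma antidual_eq_synthesis:
  assumes f: "f \<in> M1_antidual g\<^sub>0 r s" shows "f = synthesis (\<lambda>z. f (tf_shift z \<gamma>))"
  using antidual_representation[OF f] antidual_off[OF f] by (auto simp: synthesis_def fun_eq_iff)

lemma reproject_antidual:
  assumes f: "f \<in> M1_antidual g\<^sub>0 r s"
  shows "reproject (\<lambda>z. f (tf_shift z \<gamma>)) = (\<lambda>z. f (tf_shift z \<gamma>))"
  using antidual_eq_synthesis[OF f] synthesis_tf_shift by (metis (no_types, lifting) ext)

lemma reproject_reproject:
  assumes "moderate F" shows "reproject (reproject F) = reproject F"
  using reproject_antidual[OF synthesis_antidual[OF assms]] by (simp add: synthesis_tf_shift)

end

locale tf_cells = tf_window r s v g\<^sub>0 \<gamma>
  for r s and v :: "(real ^ 'n) \<times> (real ^ 'n) \<Rightarrow> real" and g\<^sub>0 \<gamma> +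
  fixes \<Lambda> :: "((real ^ 'n) \<times> (real ^ 'n)) set" and cell :: "(real ^ 'n) \<times> (real ^ 'n) \<Rightarrow> (real ^ 'n) \<times> (real ^ 'n)"
    and \<eta> vol dG dN dB V :: real and N B :: "(real ^ 'n) \<times> (real ^ 'n) \<Rightarrow> ennreal"
  assumes countable_\<Lambda>: "countable \<Lambda>"
    and cell_measurable: "cell \<in> measurable borel (count_space \<Lambda>)"
    and cell_near: "norm (z - cell z) \<le> \<eta>"
    and cell_vol: "l \<in> \<Lambda> \<Longrightarrow> emeasure lborel (cell -` {l}) = ennreal vol" and vol_pos: "0 < vol"
    and osc_measurable: "N \<in> borel_measurable borel" and osc_wint: "wint N \<le> ennreal dN" and dN_pos: "0 < dN"
    and osc: "norm u \<le> \<eta> \<Longrightarrow> norm u' \<le> \<eta> \<Longrightarrow> ennreal (norm (K (x + u') u - K (x + u') 0)) \<le> N x"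
    and major_measurable: "B \<in> borel_measurable borel" and major_wint: "wint B \<le> ennreal dB" and dB_pos: "0 < dB"
    and major: "norm u \<le> \<eta> \<Longrightarrow> ennreal (norm (G (x + u))) \<le> B x"
    and G_wint: "wint (\<lambda>z. norm (G z)) \<le> ennreal dG" and dG_pos: "0 < dG"
    and small: "dG * dN \<le> 1 / 2"
    and V_ge_1: "1 \<le> V" and V_bound: "norm z \<le> \<eta> \<Longrightarrow> v z \<le> V"
begin

lemma cell_in: "cell z \<in> \<Lambda>"
  using measurable_space[OF cell_measurable, of z] by simp

lemma cell_comp_measurable: "(\<lambda>z. a (cell z)) \<in> borel_measurable borel" for a :: "_ \<Rightarrow> 'b::topological_space"
  by (rule measurable_compose[OF cell_measurable]) simp

lemma cell_id_measurable [measurable]: "cell \<in> borel_measurable borel"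
  using cell_comp_measurable[of "\<lambda>x. x"] by simp

lemma v_cell_le: "v (cell z) \<le> V * v z" and v_le_cell: "v z \<le> V * v (cell z)"
proof -
  have V1: "v (z - cell z) \<le> V" by (rule V_bound[OF cell_near])
  then have V2: "v (cell z - z) \<le> V" by (simp add: v_minus_commute)
  have "v (cell z) \<le> v z * V"
    by (rule order_trans[OF v_le_diff mult_left_mono[OF V2 v_nonneg]])
  then show "v (cell z) \<le> V * v z" by (simp only: mult.commute)
  have "v z \<le> v (cell z) * V"
    by (rule order_trans[OF v_le_diff mult_left_mono[OF V1 v_nonneg]])
  then show "v z \<le> V * v (cell z)" by (simp only: mult.commute)
qed

text \<open>The phase comes from \<open>\<pi>(l) \<pi>(z - l) = cnj (unimod \<dots>) \<pi>(z)\<close>; without it the step function would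
  not be close to \<open>F\<close> uniformly over the cells.\<close>

definition step :: "((real ^ 'n) \<times> (real ^ 'n) \<Rightarrow> complex) \<Rightarrow> (real ^ 'n) \<times> (real ^ 'n) \<Rightarrow> complex" where
  "step a z = cnj (unimod (snd (z - cell z) \<bullet> fst (cell z))) * a (cell z)"

lemma norm_step: "norm (step a z) = norm (a (cell z))"
  by (simp add: step_def norm_mult)

lemma step_measurable: "step a \<in> borel_measurable borel"
proof -
  have "continuous_on UNIV (\<lambda>p :: ((real ^ 'n) \<times> (real ^ 'n)) \<times> ((real ^ 'n) \<times> (real ^ 'n)). cnj (unimod (snd (fst p - snd p) \<bullet> fst (snd p))))"
    by (intro continuous_intros)
  then have m: "(\<lambda>p :: ((real ^ 'n) \<times> (real ^ 'n)) \<times> ((real ^ 'n) \<times> (real ^ 'n)). cnj (unimod (snd (fst p - snd p) \<bullet> fst (snd p)))) \<in> borel_measurable (borel \<Otimes>\<^sub>M borel)"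
    unfolding borel_prod by (rule borel_measurable_continuous_onI)
  have "(\<lambda>z. (z, cell z)) \<in> borel \<rightarrow>\<^sub>M borel \<Otimes>\<^sub>M borel" by measurable
  from measurable_compose[OF this m] have [measurable]: "(\<lambda>z. cnj (unimod (snd (z - cell z) \<bullet> fst (cell z)))) \<in> borel_measurable borel" by simp
  note [measurable] = cell_comp_measurable[of a]
  show ?thesis unfolding step_def[abs_def] by measurable
qed

lemma step_diff: "step (\<lambda>z. a z - b z) z = step a z - step b z"
  and step_add: "step (\<lambda>z. a z + b z) z = step a z + step b z"
  and step_scale: "step (\<lambda>z. c * a z) z = c * step a z"
  by (simp_all add: step_def algebra_simps)

lemma step_moderate:
  assumes "\<And>l. l \<in> \<Lambda> \<Longrightarrow> norm (a l) \<le> C * v l" and C: "0 \<le> C"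
  shows "moderate (step a)"
proof (rule moderateI[OF step_measurable])
  fix z
  have "norm (a (cell z)) \<le> C * (V * v z)"
    by (rule order_trans[OF assms(1)[OF cell_in] mult_left_mono[OF v_cell_le C]])
  then show "norm (step a z) \<le> (C * V) * v z" by (simp add: norm_step mult.assoc)
qed

lemma step_moderate': "moderate F \<Longrightarrow> moderate (step F)"
proof -
  assume "moderate F"
  then obtain C where "0 \<le> C" "\<And>z. norm (F z) \<le> C * v z" using moderateE by blast
  then show ?thesis by (intro step_moderate) auto
qed

definition residual :: "((real ^ 'n) \<times> (real ^ 'n) \<Rightarrow> complex) \<Rightarrow> (real ^ 'n) \<times> (real ^ 'n) \<Rightarrow> complex" where
  "residual F z = F z - reproject (step F) z"

lemma step_close:
  assumes F: "moderate F" and fx: "reproject F = F"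
  shows "ennreal (norm (F z - step F z)) \<le> (\<integral>\<^sup>+y. ennreal (norm (F y)) * N (- (z - y)) \<partial>lborel)"
proof -
  let ?c = "cnj (unimod (snd (z - cell z) \<bullet> fst (cell z)))"
  have F1: "F z = (LINT y|lborel. F y * K y z)" and F2: "F (cell z) = (LINT y|lborel. F y * K y (cell z))"
    using fun_cong[OF fx, of z] fun_cong[OF fx, of "cell z"] by (simp_all add: reproject_def)
  have i: "integrable lborel (\<lambda>y. F y * K y z - ?c * (F y * K y (cell z)))"
    by (intro Bochner_Integration.integrable_diff integrable_mult_right reproject_integrable F)
  have "F z - step F z = (LINT y|lborel. F y * K y z) - ?c * (LINT y|lborel. F y * K y (cell z))"
    unfolding step_def F1[symmetric] F2[symmetric] ..
  also have "\<dots> = (LINT y|lborel. F y * K y z - ?c * (F y * K y (cell z)))"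
    using reproject_integrable[OF F] by simp
  finally have "ennreal (norm (F z - step F z)) \<le> (\<integral>\<^sup>+y. norm (F y * K y z - ?c * (F y * K y (cell z))) \<partial>lborel)"
    using integral_norm_bound_ennreal[OF i] by simp
  also have "\<dots> \<le> (\<integral>\<^sup>+y. ennreal (norm (F y)) * N (- (z - y)) \<partial>lborel)"
  proof (intro nn_integral_mono)
    fix y
    have "norm (F y * K y z - ?c * (F y * K y (cell z))) = norm (F y) * norm (K y z - ?c * K y (cell z))"
      by (simp add: norm_mult[symmetric] algebra_simps)
    also have "norm (K y z - ?c * K y (cell z)) = norm (K (y - cell z) (z - cell z) - K (y - cell z) 0)"
      by (rule K_shift_difference)
    finally have eq: "norm (F y * K y z - ?c * (F y * K y (cell z)))
      = norm (F y) * norm (K (y - cell z) (z - cell z) - K (y - cell z) 0)" .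
    have yz: "- (z - y) + (z - cell z) = y - cell z" by simp
    have "ennreal (norm (K (y - cell z) (z - cell z) - K (y - cell z) 0)) \<le> N (- (z - y))"
      using osc[OF cell_near[of z] cell_near[of z], of "- (z - y)"] unfolding yz .
    then show "ennreal (norm (F y * K y z - ?c * (F y * K y (cell z)))) \<le> ennreal (norm (F y)) * N (- (z - y))"
      unfolding eq by (simp add: ennreal_mult mult_left_mono)
  qed
  finally show ?thesis .
qed

lemma wint_osc_reflect: "wint (\<lambda>z. N (- z)) \<le> ennreal dN"
  using wint_reflect[OF osc_measurable] osc_wint by simp

lemma osc_reflect_measurable: "(\<lambda>z. N (- z)) \<in> borel_measurable borel"
  using osc_measurable by measurable

lemma residual_eq:
  assumes F: "moderate F" and fx: "reproject F = F"
  shows "residual F = reproject (\<lambda>z. F z - step F z)"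
  using fun_cong[OF fx] by (intro ext) (simp add: residual_def reproject_diff[OF F step_moderate'[OF F]])

lemma residual_moderate:
  assumes F: "moderate F" and fx: "reproject F = F"
  shows "moderate (residual F)" "reproject (residual F) = residual F"
  using reproject_moderate[OF moderate_diff[OF F step_moderate'[OF F]]]
    reproject_reproject[OF moderate_diff[OF F step_moderate'[OF F]]]
  by (simp_all add: residual_eq[OF F fx])

lemma residual_growth:
  assumes F: "moderate F" and fx: "reproject F = F" and C: "\<And>z. norm (F z) \<le> C * v z" "0 \<le> C"
  shows "norm (residual F z) \<le> (C / 2) * v z"
proof -
  have "norm (F y - step F y) \<le> dN * C * v y" for y
    using growth_Young[of "\<lambda>z. norm (F z)" C "\<lambda>z. N (- z)" dN "norm (F y - step F y)" y]
      step_close[OF F fx, of y] wint_osc_reflect osc_reflect_measurable C dN_pos by simp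
  then have "norm (residual F z) \<le> dG * (dN * C) * v z"
    unfolding residual_eq[OF F fx]
    using dN_pos dG_pos C(2) moderate_measurable[OF F] step_measurable[of F]
    by (intro reproject_growth G_wint) auto
  also have "\<dots> \<le> (C / 2) * v z"
    using mult_right_mono[OF small C(2)] by (intro mult_right_mono) (auto simp: mult_ac)
  finally show ?thesis .
qed

lemma reproject_Lp:
  assumes p: "1 \<le> p" and F: "moderate F" and C: "Lp_le lborel p (\<lambda>z. norm (F z) * v z) C" "0 \<le> C"
  shows "Lp_le lborel p (\<lambda>z. norm (reproject F z) * v z) (dG * C)"
  using reproject_bound[OF F] moderate_measurable[OF F] reproject_measurable[OF F]
  by (intro weighted_Young[OF p C, of "\<lambda>z. ennreal (norm (G z))"] G_wint dG_pos) auto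

lemma residual_Lp:
  assumes p: "1 \<le> p" and F: "moderate F" and fx: "reproject F = F"
    and C: "Lp_le lborel p (\<lambda>z. norm (F z) * v z) C" "0 \<le> C"
  shows "Lp_le lborel p (\<lambda>z. norm (residual F z) * v z) (C / 2)"
proof -
  have "Lp_le lborel p (\<lambda>z. norm (F z - step F z) * v z) (dN * C)"
    using step_close[OF F fx] moderate_measurable[OF F] step_measurable[of F]
    by (intro weighted_Young[OF p C, of "\<lambda>z. N (- z)"] wint_osc_reflect dN_pos osc_reflect_measurable) auto
  then have L: "Lp_le lborel p (\<lambda>z. norm (residual F z) * v z) (dG * (dN * C))"
    unfolding residual_eq[OF F fx]
    using dN_pos C(2) by (intro reproject_Lp p moderate_diff F step_moderate') auto
  show ?thesis
    by (rule Lp_le_mono[OF L Lp_leD[OF L]])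
       (use mult_right_mono[OF small C(2)] dN_pos dG_pos C(2) in \<open>auto simp: mult_ac\<close>)
qed

lemma nn_integral_cells:
  fixes \<phi> :: "(real ^ 'n) \<times> (real ^ 'n) \<Rightarrow> ennreal"
  shows "(\<integral>\<^sup>+z. \<phi> (cell z) \<partial>lborel) = ennreal vol * (\<integral>\<^sup>+l. \<phi> l \<partial>count_space \<Lambda>)"
proof -
  have m: "cell \<in> lborel \<rightarrow>\<^sub>M count_space \<Lambda>" using cell_measurable by simp
  have "distr lborel (count_space \<Lambda>) cell = scale_measure (ennreal vol) (count_space \<Lambda>)"
  proof (rule measure_eqI_countable[OF _ _ countable_\<Lambda>])
    fix l assume l: "l \<in> \<Lambda>"
    then show "emeasure (distr lborel (count_space \<Lambda>) cell) {l} = emeasure (scale_measure (ennreal vol) (count_space \<Lambda>)) {l}"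
      using cell_vol[OF l] by (subst emeasure_distr[OF m]) auto
  qed auto
  then have "(\<integral>\<^sup>+l. \<phi> l \<partial>distr lborel (count_space \<Lambda>) cell) = ennreal vol * (\<integral>\<^sup>+l. \<phi> l \<partial>count_space \<Lambda>)"
    by (simp add: nn_integral_scale_measure)
  then show ?thesis by (subst (asm) nn_integral_distr[OF m]) auto
qed

lemma AE_cells: "(AE z in lborel. P (cell z)) \<longleftrightarrow> (\<forall>l\<in>\<Lambda>. P l)"
proof
  assume AE: "AE z in lborel. P (cell z)"
  show "\<forall>l\<in>\<Lambda>. P l"
  proof (rule ballI, rule ccontr)
    fix l assume l: "l \<in> \<Lambda>" "\<not> P l"
    have "AE z in lborel. z \<notin> cell -` {l}" using AE by eventually_elim (use l in auto)
    moreover have "cell -` {l} \<in> sets borel"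
      using measurable_sets[OF cell_measurable, of "{l}"] l by simp
    ultimately have "emeasure lborel (cell -` {l}) = 0"
      by (subst (asm) AE_iff_measurable[OF _ refl]) (auto simp: vimage_def)
    then show False using cell_vol[OF l(1)] vol_pos by simp
  qed
qed (use cell_in in auto)

definition vroot :: "ennreal \<Rightarrow> real" where
  "vroot p = (if p = \<infinity> then 1 else vol powr (1 / enn2real p))"

lemma vroot_pos: "0 < vroot p"
  using vol_pos by (simp add: vroot_def)

lemma Lp_le_cells:
  assumes p: "1 \<le> p" and C: "0 \<le> C"
  shows "Lp_le lborel p (\<lambda>z. \<psi> (cell z)) (vroot p * C) \<longleftrightarrow> Lp_le (count_space \<Lambda>) p \<psi> C"
proof (cases "p = \<infinity>")
  case True
  then show ?thesis
    using AE_cells[of "\<lambda>l. \<bar>\<psi> l\<bar> \<le> C"] cell_comp_measurable[of \<psi>]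
    by (simp add: Lp_le_def vroot_def AE_count_space)
next
  case False
  define q where "q = enn2real p"
  have q: "1 \<le> q" unfolding q_def using p False by (rule enn2real_ge_1)
  have "(vroot p * C) powr q = vol * C powr q"
    using False q vol_pos C by (simp add: vroot_def q_def[symmetric] powr_mult powr_powr)
  then have "Lp_le lborel p (\<lambda>z. \<psi> (cell z)) (vroot p * C)
     \<longleftrightarrow> ennreal vol * (\<integral>\<^sup>+l. ennreal (\<bar>\<psi> l\<bar> powr q) \<partial>count_space \<Lambda>) \<le> ennreal vol * ennreal (C powr q)"
    using False cell_comp_measurable[of \<psi>] vol_pos nn_integral_cells[of "\<lambda>l. ennreal (\<bar>\<psi> l\<bar> powr q)"]
    by (simp add: Lp_le_def q_def[symmetric] ennreal_mult)
  also have "\<dots> \<longleftrightarrow> (\<integral>\<^sup>+l. ennreal (\<bar>\<psi> l\<bar> powr q) \<partial>count_space \<Lambda>) \<le> ennreal (C powr q)"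
    using vol_pos by (intro ennreal_mult_le_mult_iff) auto
  finally show ?thesis using False by (simp add: Lp_le_def q_def)
qed

lemma step_Lp:
  assumes p: "1 \<le> p" and a: "Lp_le (count_space \<Lambda>) p (\<lambda>l. norm (a l) * v l) C" and C: "0 \<le> C"
  shows "Lp_le lborel p (\<lambda>z. norm (step a z) * v z) (V * (vroot p * C))"
proof -
  have "Lp_le lborel p (\<lambda>z. norm (a (cell z)) * v (cell z)) (vroot p * C)"
    using a Lp_le_cells[OF p C, of "\<lambda>l. norm (a l) * v l"] by simp
  from Lp_le_scale[OF this, of V] have L: "Lp_le lborel p (\<lambda>z. V * (norm (a (cell z)) * v (cell z))) (V * (vroot p * C))"
    using V_ge_1 C vroot_pos[of p] by simp
  have [measurable]: "step a \<in> borel_measurable borel" by (rule step_measurable)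
  show ?thesis
  proof (rule Lp_le_mono[OF L])
    fix z
    have "norm (a (cell z)) * v z \<le> norm (a (cell z)) * (V * v (cell z))"
      by (intro mult_left_mono v_le_cell) auto
    then show "\<bar>norm (step a z) * v z\<bar> \<le> \<bar>V * (norm (a (cell z)) * v (cell z))\<bar>"
      using V_ge_1 by (simp add: norm_step mult_ac abs_mult)
  qed (use V_ge_1 C vroot_pos[of p] in auto)
qed

lemma sampling_Lp:
  assumes p: "1 \<le> p" and F: "moderate F" and fx: "reproject F = F"
    and C: "Lp_le lborel p (\<lambda>z. norm (F z) * v z) C" "0 \<le> C"
  shows "Lp_le (count_space \<Lambda>) p (\<lambda>l. norm (F l) * v l) (V * (dB * C) / vroot p)"
proof -
  note [measurable] = moderate_measurable[OF F] cell_comp_measurable[of F] major_measurable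
  have le: "ennreal \<bar>norm (F (cell w))\<bar> \<le> (\<integral>\<^sup>+z. ennreal \<bar>norm (F z)\<bar> * B (w - z) \<partial>lborel)" for w
  proof -
    have "ennreal (norm (F (cell w))) \<le> (\<integral>\<^sup>+z. ennreal (norm (F z)) * ennreal (norm (G (cell w - z))) \<partial>lborel)"
      using reproject_bound[OF F, of "cell w"] by (simp add: fx)
    also have "\<dots> \<le> (\<integral>\<^sup>+z. ennreal (norm (F z)) * B (w - z) \<partial>lborel)"
    proof (intro nn_integral_mono mult_left_mono)
      fix z
      show "ennreal (norm (G (cell w - z))) \<le> B (w - z)"
        using major[of "cell w - w" "w - z"] cell_near[of w] by (simp add: norm_minus_commute)
    qed auto
    finally show ?thesis by simp
  qed
  have "Lp_le lborel p (\<lambda>z. norm (F (cell z)) * v z) (dB * C)"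
    by (rule weighted_Young[OF p C _ major_measurable major_wint dB_pos _ le]) measurable
  from Lp_le_scale[OF this, of V] have L: "Lp_le lborel p (\<lambda>z. V * (norm (F (cell z)) * v z)) (V * (dB * C))"
    using V_ge_1 C(2) dB_pos by simp
  have "Lp_le lborel p (\<lambda>z. norm (F (cell z)) * v (cell z)) (V * (dB * C))"
  proof (rule Lp_le_mono[OF L])
    show "(\<lambda>z. norm (F (cell z)) * v (cell z)) \<in> borel_measurable lborel" by measurable
    fix z
    have "norm (F (cell z)) * v (cell z) \<le> norm (F (cell z)) * (V * v z)"
      by (intro mult_left_mono v_cell_le) auto
    then show "\<bar>norm (F (cell z)) * v (cell z)\<bar> \<le> \<bar>V * (norm (F (cell z)) * v z)\<bar>"
      using V_ge_1 by (simp add: mult_ac abs_mult)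
  qed (use V_ge_1 C(2) dB_pos in auto)
  moreover have "V * (dB * C) = vroot p * (V * (dB * C) / vroot p)" using vroot_pos[of p] by simp
  ultimately show ?thesis
    using Lp_le_cells[OF p, of "V * (dB * C) / vroot p" "\<lambda>l. norm (F l) * v l"] V_ge_1 C(2) dB_pos vroot_pos[of p]
    by (simp add: less_imp_le)
qed

primrec neumann :: "((real ^ 'n) \<times> (real ^ 'n) \<Rightarrow> complex) \<Rightarrow> nat \<Rightarrow> (real ^ 'n) \<times> (real ^ 'n) \<Rightarrow> complex" where
  "neumann a 0 = reproject (step a)"
| "neumann a (Suc n) = residual (neumann a n)"

lemma neumann_moderate:
  assumes a: "moderate (step a)"
  shows "moderate (neumann a n)" "reproject (neumann a n) = neumann a n"
proof (induction n)
  case 0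
  { case 1 show ?case using reproject_moderate[OF a] by simp }
  { case 2 show ?case using reproject_reproject[OF a] by simp }
next
  case (Suc n)
  { case 1 show ?case using residual_moderate(1)[OF Suc] by simp }
  { case 2 show ?case using residual_moderate(2)[OF Suc] by simp }
qed

lemma neumann_growth:
  assumes a: "moderate (step a)" and C: "\<And>z. norm (step a z) \<le> C * v z" "0 \<le> C"
  shows "norm (neumann a n z) \<le> (dG * C * (1/2) ^ n) * v z"
proof (induction n arbitrary: z)
  case 0
  show ?case using reproject_growth[OF step_measurable C G_wint] dG_pos by simp
next
  case (Suc n)
  show ?case
    using residual_growth[OF neumann_moderate[OF a, of n] Suc, of z] dG_pos C(2) by simp
qed

lemma neumann_Lp:
  assumes p: "1 \<le> p" and a: "moderate (step a)"
    and C: "Lp_le lborel p (\<lambda>z. norm (step a z) * v z) C" "0 \<le> C"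
  shows "Lp_le lborel p (\<lambda>z. norm (neumann a n z) * v z) (dG * C * (1/2) ^ n)"
proof (induction n)
  case 0
  show ?case using reproject_Lp[OF p a C] by simp
next
  case (Suc n)
  show ?case
    using residual_Lp[OF p neumann_moderate[OF a, of n] Suc] dG_pos C(2) by simp
qed

definition neumann_sum :: "((real ^ 'n) \<times> (real ^ 'n) \<Rightarrow> complex) \<Rightarrow> (real ^ 'n) \<times> (real ^ 'n) \<Rightarrow> complex" where
  "neumann_sum a z = (\<Sum>n. neumann a n z)"

lemma neumann_summable:
  assumes a: "moderate (step a)"
  shows "summable (\<lambda>n. norm (neumann a n z))"
proof -
  obtain C where C: "0 \<le> C" "\<And>z. norm (step a z) \<le> C * v z" using moderateE[OF a] by blast
  show ?thesis
  proof (rule summable_comparison_test')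
    show "summable (\<lambda>n. (dG * C * v z) * (1/2) ^ n)" by (intro summable_mult summable_geometric) auto
    show "norm (norm (neumann a n z)) \<le> (dG * C * v z) * (1/2) ^ n" if "n \<ge> 0" for n
      using neumann_growth[OF a C(2,1), of n z] by (simp add: mult_ac)
  qed
qed

lemma neumann_sum_moderate:
  assumes a: "moderate (step a)"
  shows "moderate (neumann_sum a)"
proof -
  obtain C where C: "0 \<le> C" "\<And>z. norm (step a z) \<le> C * v z" using moderateE[OF a] by blast
  have s: "summable (\<lambda>n. (dG * C * v z) * (1/2) ^ n)" for z by (intro summable_mult summable_geometric) auto
  have "norm (neumann_sum a z) \<le> (2 * (dG * C)) * v z" for z
  proof -
    have "norm (neumann_sum a z) \<le> (\<Sum>n. norm (neumann a n z))"
      unfolding neumann_sum_def by (rule summable_norm[OF neumann_summable[OF a]])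
    also have "\<dots> \<le> (\<Sum>n. (dG * C * v z) * (1/2) ^ n)"
      using neumann_growth[OF a C(2,1), of _ z] by (intro suminf_le neumann_summable a s) (simp add: mult_ac)
    also have "\<dots> = (2 * (dG * C)) * v z"
      by (subst suminf_mult) (auto simp: suminf_geometric intro: summable_geometric)
    finally show ?thesis .
  qed
  moreover have "neumann_sum a \<in> borel_measurable borel"
    using moderate_measurable[OF neumann_moderate(1)[OF a]] unfolding neumann_sum_def[abs_def] by measurable
  ultimately show ?thesis by (intro moderateI)
qed

lemma neumann_sum_Lp:
  assumes p: "1 \<le> p" and a: "moderate (step a)"
    and C: "Lp_le lborel p (\<lambda>z. norm (step a z) * v z) C" "0 < C"
  shows "Lp_le lborel p (\<lambda>z. norm (neumann_sum a z) * v z) (2 * (dG * C))"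
proof (rule Lp_le_suminf[OF sigma_finite_lborel p neumann_Lp[OF p a C(1)]])
  show "(\<lambda>z. norm (neumann_sum a z) * v z) \<in> borel_measurable lborel"
    using moderate_measurable[OF neumann_sum_moderate[OF a]] by measurable
  fix z
  have s: "summable (\<lambda>n. norm (neumann a n z) * v z)"
    by (intro summable_mult2 neumann_summable a)
  have "norm (neumann_sum a z) * v z \<le> (\<Sum>n. norm (neumann a n z)) * v z"
    unfolding neumann_sum_def by (intro mult_right_mono summable_norm neumann_summable a) auto
  also have "\<dots> = (\<Sum>n. norm (neumann a n z) * v z)"
    by (rule suminf_mult2[OF neumann_summable[OF a]])
  finally have "ennreal (norm (neumann_sum a z) * v z) \<le> ennreal (\<Sum>n. norm (neumann a n z) * v z)"
    by (rule ennreal_leI)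
  also have "\<dots> = (\<Sum>n. ennreal (norm (neumann a n z) * v z))"
    by (rule suminf_ennreal2[symmetric]) (auto intro: s)
  finally show "ennreal \<bar>norm (neumann_sum a z) * v z\<bar> \<le> (\<Sum>n. ennreal \<bar>norm (neumann a n z) * v z\<bar>)" by simp
qed (use dG_pos C in auto)

lemma neumann_add:
  assumes a: "moderate (step a)" and b: "moderate (step b)"
  shows "neumann (\<lambda>l. a l + b l) n z = neumann a n z + neumann b n z"
proof (induction n arbitrary: z)
  case 0
  show ?case using reproject_add[OF a b] by (simp add: step_add[abs_def])
next
  case (Suc n)
  have "neumann (\<lambda>l. a l + b l) n = (\<lambda>z. neumann a n z + neumann b n z)" using Suc by auto
  then show ?case
    using reproject_add[OF step_moderate'[OF neumann_moderate(1)[OF a]] step_moderate'[OF neumann_moderate(1)[OF b]], of n n z]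
    by (simp add: residual_def step_add[abs_def])
qed

lemma neumann_scale: "neumann (\<lambda>l. c * a l) n z = c * neumann a n z"
proof (induction n arbitrary: z)
  case 0
  show ?case by (simp add: step_scale[abs_def] reproject_scale)
next
  case (Suc n)
  have "neumann (\<lambda>l. c * a l) n = (\<lambda>z. c * neumann a n z)" using Suc by auto
  then show ?case by (simp add: residual_def step_scale[abs_def] reproject_scale right_diff_distrib)
qed

lemma neumann_sum_add:
  assumes a: "moderate (step a)" and b: "moderate (step b)"
  shows "neumann_sum (\<lambda>l. a l + b l) z = neumann_sum a z + neumann_sum b z"
  unfolding neumann_sum_def neumann_add[OF a b]
  by (rule suminf_add[OF summable_norm_cancel[OF neumann_summable[OF a]] summable_norm_cancel[OF neumann_summable[OF b]], symmetric])

lemma neumann_sum_scale: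
  assumes a: "moderate (step a)"
  shows "neumann_sum (\<lambda>l. c * a l) z = c * neumann_sum a z"
  unfolding neumann_sum_def neumann_scale
  by (rule suminf_mult[OF summable_norm_cancel[OF neumann_summable[OF a]]])

definition reconstruct :: "((real ^ 'n) \<times> (real ^ 'n) \<Rightarrow> complex) \<Rightarrow> (real ^ 'n \<Rightarrow> complex) \<Rightarrow> complex" where
  "reconstruct a = synthesis (neumann_sum a)"

lemma reconstruct_antidual:
  "moderate (step a) \<Longrightarrow> reconstruct a \<in> M1_antidual g\<^sub>0 r s"
  unfolding reconstruct_def by (intro synthesis_antidual neumann_sum_moderate)

lemma reconstruct_add:
  assumes a: "moderate (step a)" and b: "moderate (step b)"
  shows "reconstruct (\<lambda>l. a l + b l) h = reconstruct a h + reconstruct b h"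
  using moderate_integrable[OF neumann_sum_moderate[OF a]] moderate_integrable[OF neumann_sum_moderate[OF b]]
  by (simp add: reconstruct_def synthesis_def neumann_sum_add[OF a b] distrib_right)

lemma reconstruct_scale:
  assumes a: "moderate (step a)"
  shows "reconstruct (\<lambda>l. c * a l) h = c * reconstruct a h"
  by (simp add: reconstruct_def synthesis_def neumann_sum_scale[OF a] mult.assoc)

lemma reconstruct_Lp:
  assumes p: "1 \<le> p" and a: "moderate (step a)"
    and C: "Lp_le lborel p (\<lambda>z. norm (step a z) * v z) C" "0 < C"
  shows "Lp_le lborel p (\<lambda>z. norm (reconstruct a (tf_shift z \<gamma>)) * v z) (dG * (2 * (dG * C)))"
  unfolding reconstruct_def synthesis_tf_shift
  using dG_pos C by (intro reproject_Lp p neumann_sum_moderate a neumann_sum_Lp) auto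

text \<open>The remainder after \<open>n\<close> Neumann steps is obtained from \<open>F\<close> by \<open>n\<close> applications of \<open>residual\<close>.\<close>

theorem reconstruct_coefficients:
  assumes f: "f \<in> M1_antidual g\<^sub>0 r s"
  shows "reconstruct (coefficients \<Lambda> (\<lambda>z. tf_shift z \<gamma>) f) = f"
proof -
  define F where "F = (\<lambda>z. f (tf_shift z \<gamma>))"
  define a where "a = coefficients \<Lambda> (\<lambda>z. tf_shift z \<gamma>) f"
  have F: "moderate F" "reproject F = F"
    unfolding F_def by (rule antidual_moderate[OF f], rule reproject_antidual[OF f])
  have sa: "step a = step F"
    by (rule ext) (simp add: step_def a_def F_def coefficients_def cell_in)
  define D where "D = (\<lambda>n. (residual ^^ n) F)"
  have D: "moderate (D n) \<and> reproject (D n) = D n" for n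
    by (induction n) (auto simp: D_def F residual_moderate)
  have nD: "neumann a n = reproject (step (D n))" for n
  proof (induction n)
    case 0
    show ?case by (simp add: D_def sa)
  next
    case (Suc n)
    have D1: "D (Suc n) = (\<lambda>z. D n z - neumann a n z)"
      unfolding Suc by (simp add: D_def residual_def[abs_def])
    have m: "moderate (neumann a n)" unfolding Suc by (intro reproject_moderate step_moderate') (simp add: D)
    show ?case
      unfolding D1 using D[of n] m Suc
      by (intro ext) (simp add: step_diff[abs_def] residual_def reproject_diff step_moderate')
  qed
  have FD: "F z = D n z + (\<Sum>i<n. neumann a i z)" for n z
  proof (induction n)
    case 0
    show ?case by (simp add: D_def)
  next
    case (Suc n)
    have "D (Suc n) z = D n z - neumann a n z"
      unfolding nD by (simp add: D_def residual_def)
    then show ?case using Suc by simp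
  qed
  obtain C where C: "0 \<le> C" "\<And>z. norm (F z) \<le> C * v z" using moderateE[OF F(1)] by blast
  have Dg: "norm (D n z) \<le> (C * (1/2) ^ n) * v z" for n z
  proof (induction n arbitrary: z)
    case 0
    show ?case using C by (simp add: D_def)
  next
    case (Suc n)
    have "norm (residual (D n) z) \<le> (C * (1/2) ^ n / 2) * v z"
      using D[of n] C(1) by (intro residual_growth Suc) auto
    then show ?case by (simp add: D_def)
  qed
  have "neumann_sum a z = F z" for z
  proof -
    have "(\<lambda>n. (C * v z) * (1/2) ^ n) \<longlonglongrightarrow> 0"
      by (intro tendsto_mult_right_zero LIMSEQ_realpow_zero) auto
    then have "(\<lambda>n. D n z) \<longlonglongrightarrow> 0"
      by (rule Lim_null_comparison[rotated]) (use Dg[of _ z] in \<open>auto simp: mult_ac\<close>)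
    then have "(\<lambda>n. F z - D n z) \<longlonglongrightarrow> F z - 0" by (intro tendsto_diff tendsto_const)
    moreover have "F z - D n z = (\<Sum>i<n. neumann a i z)" for n using FD[of z n] by simp
    ultimately have "(\<lambda>n. neumann a n z) sums F z" by (simp add: sums_def)
    then show ?thesis by (simp add: neumann_sum_def sums_unique[symmetric])
  qed
  then have "neumann_sum a = F" by auto
  then show ?thesis using antidual_eq_synthesis[OF f] by (simp add: reconstruct_def a_def[symmetric] F_def)
qed

end

section \<open>Sequence spaces and lattices\<close>

lemma weighted_Lp_iff:
  assumes p: "1 \<le> p" and C: "0 \<le> C" and F: "F \<in> borel_measurable M" and w: "w \<in> borel_measurable M"
    and nn: "\<And>x. 0 \<le> w x"
  shows "F \<in> weighted_Lp_space M w p \<and> weighted_Lp_norm M w p F \<le> C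
     \<longleftrightarrow> Lp_le M p (\<lambda>x. norm (F x) * w x) C"
proof -
  have m: "(\<lambda>x. F x * of_real (w x)) \<in> borel_measurable M" using F w by measurable
  show ?thesis
    using Lp_le_iff[OF p C m] F nn by (simp add: weighted_Lp_space_def weighted_Lp_norm_def norm_mult)
qed

lemma weighted_Lp_norm_nonneg: "0 \<le> weighted_Lp_norm M w p F"
  by (simp add: weighted_Lp_norm_def Lp_norm_nonneg)

lemma weighted_Lp_le:
  assumes "1 \<le> p" "F \<in> weighted_Lp_space M w p" "w \<in> borel_measurable M" "\<And>x. 0 \<le> w x"
  shows "Lp_le M p (\<lambda>x. norm (F x) * w x) (weighted_Lp_norm M w p F)"
proof -
  have "F \<in> borel_measurable M" using assms(2) by (simp add: weighted_Lp_space_def)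
  from weighted_Lp_iff[OF assms(1) weighted_Lp_norm_nonneg this assms(3,4)] assms(2)
  show ?thesis by blast
qed

lemma Lp_le_count_space_pointwise:
  assumes p: "1 \<le> p" and \<psi>: "Lp_le (count_space \<Lambda>) p \<psi> C" and C: "0 \<le> C" and l: "l \<in> \<Lambda>"
  shows "\<bar>\<psi> l\<bar> \<le> C"
proof (cases "p = \<infinity>")
  case True
  then show ?thesis using \<psi> l by (simp add: Lp_le_def AE_count_space)
next
  case False
  define q where "q = enn2real p"
  have q: "1 \<le> q" unfolding q_def using p False by (rule enn2real_ge_1)
  have "ennreal (\<bar>\<psi> l\<bar> powr q) \<le> (\<integral>\<^sup>+l. ennreal (\<bar>\<psi> l\<bar> powr q) \<partial>count_space \<Lambda>)"
    by (rule nn_integral_ge_point[OF l])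
  also have "\<dots> \<le> ennreal (C powr q)" using \<psi> False by (simp add: Lp_le_def q_def)
  finally have "\<bar>\<psi> l\<bar> powr q \<le> C powr q" by (simp add: ennreal_le_iff)
  then show ?thesis using powr_less_mono2[of q C "\<bar>\<psi> l\<bar>"] q C by force
qed

lemma le_mult_epsilon:
  fixes x y d :: real
  assumes "0 < d" "\<And>e. 0 < e \<Longrightarrow> x \<le> d * (y + e)" shows "x \<le> d * y"
proof (rule field_le_epsilon)
  fix e :: real assume "0 < e"
  then show "x \<le> d * y + e" using assms(2)[of "e / d"] assms(1) by (simp add: distrib_left)
qed

context
  fixes \<Lambda> :: "'a set" and w :: "'a \<Rightarrow> real" and p :: ennreal
  assumes countable: "countable \<Lambda>" and w: "\<And>x. 0 < w x" and p: "1 \<le> p"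
begin

lemma weighted_lp_Lp_le:
  "c \<in> weighted_lp_space \<Lambda> w p \<Longrightarrow> Lp_le (count_space \<Lambda>) p (\<lambda>x. norm (c x) * w x) (weighted_lp_norm \<Lambda> w p c)"
  unfolding weighted_lp_space_def weighted_lp_norm_def
  by (rule weighted_Lp_le[OF p]) (auto intro: less_imp_le w)

lemma weighted_lpI:
  assumes "Lp_le (count_space \<Lambda>) p (\<lambda>x. norm (c x) * w x) C" "0 \<le> C" "\<And>x. x \<notin> \<Lambda> \<Longrightarrow> c x = 0"
  shows "c \<in> weighted_lp_space \<Lambda> w p" "weighted_lp_norm \<Lambda> w p c \<le> C"
  using weighted_Lp_iff[OF p assms(2), of c "count_space \<Lambda>" w] assms less_imp_le[OF w]
  by (auto simp: weighted_lp_space_def weighted_lp_norm_def)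

lemma weighted_lp_norm_nonneg: "0 \<le> weighted_lp_norm \<Lambda> w p c"
  by (simp add: weighted_lp_norm_def weighted_Lp_norm_nonneg)

lemma weighted_lp_off: "c \<in> weighted_lp_space \<Lambda> w p \<Longrightarrow> x \<notin> \<Lambda> \<Longrightarrow> c x = 0"
  by (simp add: weighted_lp_space_def)

lemma weighted_lp_pointwise:
  assumes "c \<in> weighted_lp_space \<Lambda> w p"
  shows "norm (c x) * w x \<le> weighted_lp_norm \<Lambda> w p c"
proof (cases "x \<in> \<Lambda>")
  case True
  then show ?thesis
    using Lp_le_count_space_pointwise[OF p weighted_lp_Lp_le[OF assms] weighted_lp_norm_nonneg True] w[of x]
    by (simp add: abs_mult)
next
  case False
  then show ?thesis using weighted_lp_off[OF assms] weighted_lp_norm_nonneg by simp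
qed

lemma sigma_finite_count: "sigma_finite_measure (count_space \<Lambda>)"
  by (rule sigma_finite_measure_count_space_countable[OF countable])

lemma weighted_lp_zero: "(\<lambda>_. 0) \<in> weighted_lp_space \<Lambda> w p" "weighted_lp_norm \<Lambda> w p (\<lambda>_. 0) = 0"
proof -
  have L: "Lp_le (count_space \<Lambda>) p (\<lambda>x. norm (0 :: complex) * w x) 0"
    by (auto simp: Lp_le_def AE_count_space)
  show "(\<lambda>_. 0) \<in> weighted_lp_space \<Lambda> w p" "weighted_lp_norm \<Lambda> w p (\<lambda>_. 0) = 0"
    using weighted_lpI[OF L] weighted_lp_norm_nonneg[of "\<lambda>_. 0"] by simp_all
qed

lemma weighted_lp_add:
  assumes c: "c \<in> weighted_lp_space \<Lambda> w p" and d: "d \<in> weighted_lp_space \<Lambda> w p"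
  shows "(\<lambda>x. c x + d x) \<in> weighted_lp_space \<Lambda> w p"
    "weighted_lp_norm \<Lambda> w p (\<lambda>x. c x + d x) \<le> weighted_lp_norm \<Lambda> w p c + weighted_lp_norm \<Lambda> w p d"
proof -
  let ?N = "weighted_lp_norm \<Lambda> w p"
  have L: "Lp_le (count_space \<Lambda>) p (\<lambda>x. norm (c x + d x) * w x) ((?N c + e) + (?N d + e))" if e: "0 < e" for e
  proof -
    have "Lp_le (count_space \<Lambda>) p (\<lambda>x. norm (c x) * w x) (?N c + e)" "Lp_le (count_space \<Lambda>) p (\<lambda>x. norm (d x) * w x) (?N d + e)"
      using e by (auto intro: Lp_le_mono[OF weighted_lp_Lp_le[OF c]] Lp_le_mono[OF weighted_lp_Lp_le[OF d]]
          weighted_lp_norm_nonneg)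
    from Lp_le_add[OF sigma_finite_count p this] e weighted_lp_norm_nonneg[of c] weighted_lp_norm_nonneg[of d]
    have *: "Lp_le (count_space \<Lambda>) p (\<lambda>x. norm (c x) * w x + norm (d x) * w x) ((?N c + e) + (?N d + e))"
      by simp
    show ?thesis
    proof (rule Lp_le_mono[OF *])
      fix x
      have "norm (c x + d x) * w x \<le> norm (c x) * w x + norm (d x) * w x"
        using mult_right_mono[OF norm_triangle_ineq[of "c x" "d x"] less_imp_le[OF w[of x]]] by (simp add: distrib_right)
      then show "\<bar>norm (c x + d x) * w x\<bar> \<le> \<bar>norm (c x) * w x + norm (d x) * w x\<bar>"
        using w[of x] by (simp add: abs_mult)
    qed (use e weighted_lp_norm_nonneg[of c] weighted_lp_norm_nonneg[of d] in auto)
  qed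
  have off: "c x + d x = 0" if "x \<notin> \<Lambda>" for x by (simp add: weighted_lp_off[OF c that] weighted_lp_off[OF d that])
  note I = weighted_lpI[OF L _ off]
  show "(\<lambda>x. c x + d x) \<in> weighted_lp_space \<Lambda> w p"
    using I(1)[of 1] weighted_lp_norm_nonneg[of c] weighted_lp_norm_nonneg[of d] by simp
  show "?N (\<lambda>x. c x + d x) \<le> ?N c + ?N d"
  proof (rule field_le_epsilon)
    fix e :: real assume "0 < e"
    then show "?N (\<lambda>x. c x + d x) \<le> ?N c + ?N d + e"
      using I(2)[of "e / 2"] weighted_lp_norm_nonneg[of c] weighted_lp_norm_nonneg[of d] by simp
  qed
qed

lemma weighted_lp_scale:
  assumes c: "c \<in> weighted_lp_space \<Lambda> w p"
  shows "(\<lambda>x. a * c x) \<in> weighted_lp_space \<Lambda> w p"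
    "weighted_lp_norm \<Lambda> w p (\<lambda>x. a * c x) = norm a * weighted_lp_norm \<Lambda> w p c"
proof -
  let ?N = "weighted_lp_norm \<Lambda> w p"
  have le: "(\<lambda>x. a * c x) \<in> weighted_lp_space \<Lambda> w p \<and> ?N (\<lambda>x. a * c x) \<le> norm a * ?N c"
    if c: "c \<in> weighted_lp_space \<Lambda> w p" for a c
  proof -
    have L: "Lp_le (count_space \<Lambda>) p (\<lambda>x. norm (a * c x) * w x) (norm a * ?N c)"
      using Lp_le_scale[OF weighted_lp_Lp_le[OF c] weighted_lp_norm_nonneg, of "norm a"] by (simp add: norm_mult mult.assoc)
    show ?thesis
      using weighted_lpI[OF L] weighted_lp_norm_nonneg[of c] weighted_lp_off[OF c] by simp
  qed
  show "(\<lambda>x. a * c x) \<in> weighted_lp_space \<Lambda> w p" using le[OF c] by blast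
  show "?N (\<lambda>x. a * c x) = norm a * ?N c"
  proof (cases "a = 0")
    case True
    then show ?thesis by (simp add: weighted_lp_zero)
  next
    case False
    have "?N (\<lambda>x. inverse a * (a * c x)) \<le> norm (inverse a) * ?N (\<lambda>x. a * c x)"
      using le[of "\<lambda>x. a * c x" "inverse a"] le[OF c, of a] by blast
    moreover have "(\<lambda>x. inverse a * (a * c x)) = c" using False by (auto simp: mult.assoc[symmetric])
    ultimately have "norm a * ?N c \<le> ?N (\<lambda>x. a * c x)"
      using False by (simp add: norm_divide norm_inverse field_simps)
    then show ?thesis using le[OF c, of a] by simp
  qed
qed

lemma weighted_lp_norm_eq_0:
  assumes "c \<in> weighted_lp_space \<Lambda> w p" "weighted_lp_norm \<Lambda> w p c = 0"
  shows "c = (\<lambda>_. 0)"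
proof
  fix x
  have "norm (c x) * w x \<le> 0" using weighted_lp_pointwise[OF assms(1), of x] assms(2) by simp
  then show "c x = 0" using w[of x] by (simp add: mult_le_0_iff)
qed

lemma norm_on_weighted_lp: "norm_on (weighted_lp_space \<Lambda> w p) (weighted_lp_norm \<Lambda> w p)"
proof -
  have iff: "weighted_lp_norm \<Lambda> w p c = 0 \<longleftrightarrow> c = (\<lambda>_. 0)" if "c \<in> weighted_lp_space \<Lambda> w p" for c
  proof
    assume "c = (\<lambda>_. 0)"
    then show "weighted_lp_norm \<Lambda> w p c = 0" by (simp only: weighted_lp_zero)
  qed (rule weighted_lp_norm_eq_0[OF that])
  show ?thesis
    unfolding norm_on_def
    by (intro conjI ballI allI weighted_lp_zero(1) weighted_lp_add weighted_lp_scale weighted_lp_norm_nonneg iff)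
qed

lemma banach_space_on_weighted_lp: "banach_space_on (weighted_lp_space \<Lambda> w p) (weighted_lp_norm \<Lambda> w p)"
  unfolding banach_space_on_def
proof (intro conjI norm_on_weighted_lp allI impI, elim conjE)
  let ?N = "weighted_lp_norm \<Lambda> w p"
  fix X :: "nat \<Rightarrow> 'a \<Rightarrow> complex"
  assume X: "\<forall>n. X n \<in> weighted_lp_space \<Lambda> w p"
    and cauchy: "\<forall>e>0. \<exists>n0. \<forall>m\<ge>n0. \<forall>n\<ge>n0. ?N (\<lambda>x. X m x - X n x) < e"
  have diff: "(\<lambda>x. c x - d x) \<in> weighted_lp_space \<Lambda> w p"
    if "c \<in> weighted_lp_space \<Lambda> w p" "d \<in> weighted_lp_space \<Lambda> w p" for c d
    using weighted_lp_add(1)[OF that(1) weighted_lp_scale(1)[OF that(2), of "-1"]] by simp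
  have "Cauchy (\<lambda>n. X n x)" for x
  proof (rule metric_CauchyI)
    fix e :: real assume e: "0 < e"
    then obtain n0 where n0: "\<forall>m\<ge>n0. \<forall>n\<ge>n0. ?N (\<lambda>x. X m x - X n x) < e * w x"
      using cauchy w[of x] by (meson mult_pos_pos)
    have "dist (X m x) (X n x) < e" if "m \<ge> n0" "n \<ge> n0" for m n
    proof -
      have "norm (X m x - X n x) * w x < e * w x"
        using weighted_lp_pointwise[OF diff, of "X m" "X n" x] X n0 that by (auto intro: le_less_trans)
      then show ?thesis using w[of x] by (simp add: dist_norm)
    qed
    then show "\<exists>M. \<forall>m\<ge>M. \<forall>n\<ge>M. dist (X m x) (X n x) < e" by blast
  qed
  then have "\<exists>y. (\<lambda>n. X n x) \<longlonglongrightarrow> y" for x by (simp add: Cauchy_convergent convergent_def[symmetric])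
  then obtain Y where Y: "\<And>x. (\<lambda>n. X n x) \<longlonglongrightarrow> Y x" by metis
  have Yoff: "Y x = 0" if "x \<notin> \<Lambda>" for x
    using Y[of x] weighted_lp_off[OF spec[OF X] that] by (simp add: LIMSEQ_const_iff)
  have close: "(\<lambda>x. X n x - Y x) \<in> weighted_lp_space \<Lambda> w p \<and> ?N (\<lambda>x. X n x - Y x) \<le> e"
    if e: "0 < e" and n: "\<forall>m\<ge>n0. ?N (\<lambda>x. X n x - X m x) < e" for n n0 e
  proof -
    have "Lp_le (count_space \<Lambda>) p (\<lambda>x. norm (X n x - Y x) * w x) e"
    proof (rule Lp_le_limit)
      show "Lp_le (count_space \<Lambda>) p (\<lambda>x. norm (X n x - X (m + n0) x) * w x) e" for m
      proof (rule Lp_le_mono[OF weighted_lp_Lp_le[OF diff]])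
        show "?N (\<lambda>x. X n x - X (m + n0) x) \<le> e" using n by (intro less_imp_le) simp
      qed (auto simp: X weighted_lp_norm_nonneg)
      show "(\<lambda>m. norm (X n x - X (m + n0) x) * w x) \<longlonglongrightarrow> norm (X n x - Y x) * w x" for x
        by (intro tendsto_intros LIMSEQ_ignore_initial_segment Y)
    qed (use e in auto)
    then show ?thesis using weighted_lpI[of "\<lambda>x. X n x - Y x" e] e Yoff weighted_lp_off[OF spec[OF X]] by auto
  qed
  have "Y \<in> weighted_lp_space \<Lambda> w p"
  proof -
    obtain n0 where "\<forall>m\<ge>n0. \<forall>n\<ge>n0. ?N (\<lambda>x. X m x - X n x) < 1" using cauchy zero_less_one by blast
    then have "(\<lambda>x. X n0 x - Y x) \<in> weighted_lp_space \<Lambda> w p" using close[of 1 n0 n0] by auto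
    from diff[OF spec[OF X, of n0] this] show ?thesis by simp
  qed
  moreover have "(\<lambda>n. ?N (\<lambda>x. X n x - Y x)) \<longlonglongrightarrow> 0"
  proof (rule LIMSEQ_I)
    fix e :: real assume e: "0 < e"
    then obtain n0 where n0: "\<forall>m\<ge>n0. \<forall>n\<ge>n0. ?N (\<lambda>x. X m x - X n x) < e / 2"
      using cauchy half_gt_zero by blast
    have "norm (?N (\<lambda>x. X n x - Y x) - 0) < e" if "n \<ge> n0" for n
      using close[of "e / 2" n0 n] n0 that e weighted_lp_norm_nonneg by auto
    then show "\<exists>no. \<forall>n\<ge>no. norm (?N (\<lambda>x. X n x - Y x) - 0) < e" by blast
  qed
  ultimately show "\<exists>f\<in>weighted_lp_space \<Lambda> w p. (\<lambda>n. ?N (\<lambda>x. X n x - f x)) \<longlonglongrightarrow> 0" by blast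
qed

end

definition vec_floor :: "(real ^ 'n) \<times> (real ^ 'n) \<Rightarrow> (real ^ 'n) \<times> (real ^ 'n)" where
  "vec_floor y = ((\<chi> i. of_int \<lfloor>fst y $ i\<rfloor>), (\<chi> i. of_int \<lfloor>snd y $ i\<rfloor>))"

lemma vec_floor_in: "vec_floor y \<in> integer_points"
  by (auto simp: vec_floor_def integer_points_def)

lemma vec_floor_eq_iff:
  assumes "k \<in> integer_points"
  shows "vec_floor y = k \<longleftrightarrow> (\<forall>i. 0 \<le> fst (y - k) $ i \<and> fst (y - k) $ i < 1 \<and> 0 \<le> snd (y - k) $ i \<and> snd (y - k) $ i < 1)"
proof -
  have *: "of_int \<lfloor>a\<rfloor> = b \<longleftrightarrow> 0 \<le> a - b \<and> a - b < 1" if "b \<in> \<int>" for a b :: real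
    using that by (auto elim!: Ints_cases simp: floor_eq_iff)
  have "vec_floor y = k \<longleftrightarrow> (\<forall>i. of_int \<lfloor>fst y $ i\<rfloor> = fst k $ i) \<and> (\<forall>i. of_int \<lfloor>snd y $ i\<rfloor> = snd k $ i)"
    by (auto simp: vec_floor_def prod_eq_iff vec_eq_iff)
  also have "\<dots> \<longleftrightarrow> (\<forall>i. 0 \<le> fst (y - k) $ i \<and> fst (y - k) $ i < 1 \<and> 0 \<le> snd (y - k) $ i \<and> snd (y - k) $ i < 1)"
    using assms by (subst *, force simp: integer_points_def case_prod_unfold)+ (auto simp: integer_points_def)
  finally show ?thesis .
qed

lemma countable_integer_points: "countable (integer_points :: ((real ^ 'n) \<times> (real ^ 'n)) set)"
proof -
  have "integer_points \<subseteq> range (\<lambda>(a :: int ^ 'n, b :: int ^ 'n). ((\<chi> i. of_int (a $ i)) :: real ^ 'n, (\<chi> i. of_int (b $ i)) :: real ^ 'n))"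
  proof
    fix k :: "(real ^ 'n) \<times> (real ^ 'n)" assume k: "k \<in> integer_points"
    have "k = ((\<chi> i. of_int ((\<chi> i. \<lfloor>fst k $ i\<rfloor>) $ i)), (\<chi> i. of_int ((\<chi> i. \<lfloor>snd k $ i\<rfloor>) $ i)))"
      using k by (auto simp: integer_points_def prod_eq_iff vec_eq_iff case_prod_unfold)
    then show "k \<in> range (\<lambda>(a :: int ^ 'n, b :: int ^ 'n). ((\<chi> i. of_int (a $ i)) :: real ^ 'n, (\<chi> i. of_int (b $ i)) :: real ^ 'n))"
      by (auto intro!: rev_image_eqI[of "(\<chi> i. \<lfloor>fst k $ i\<rfloor>, \<chi> i. \<lfloor>snd k $ i\<rfloor>)"])
  qed
  then show ?thesis by (rule countable_subset) auto
qed

definition cell_partition ::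
    "'a::euclidean_space set \<Rightarrow> ('a \<Rightarrow> 'a) \<Rightarrow> real \<Rightarrow> real \<Rightarrow> bool" where
  "cell_partition \<Lambda> cell vol e \<longleftrightarrow> 0 < vol \<and> countable \<Lambda> \<and> cell \<in> measurable borel (count_space \<Lambda>) \<and>
     (\<forall>z. norm (z - cell z) \<le> e) \<and> (\<forall>l\<in>\<Lambda>. emeasure lborel (cell -` {l}) = ennreal vol)"

lemma lattice_cells:
  fixes A :: "(real ^ 'n) \<times> (real ^ 'n) \<Rightarrow> (real ^ 'n) \<times> (real ^ 'n)"
  assumes A: "linear A" and bij: "bij A"
  shows "\<exists>D>0. \<forall>c>0. \<exists>cell vol. cell_partition ((\<lambda>k. c *\<^sub>R A k) ` integer_points) cell vol (c * D)"
proof -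
  obtain a where a: "0 < a" "\<And>x. norm (A x) \<le> a * norm x"
    using linear_bounded_pos[OF A] by blast
  define I where "I = inv A"
  have IA: "I (A x) = x" and AI: "A (I x) = x" for x
    using bij by (auto simp: I_def bij_def surj_f_inv_f)
  have I: "linear I"
    using linear_inverse_left[OF A] by (metis A I_def bij bij_is_inj inj_linear_imp_inv_linear)
  define D where "D = a * (2 * CARD('n))"
  have D: "0 < D" using a by (simp add: D_def)
  have unit: "norm y \<le> 2 * CARD('n)"
    if "\<And>i. 0 \<le> fst y $ i \<and> fst y $ i < 1 \<and> 0 \<le> snd y $ i \<and> snd y $ i < 1" for y :: "(real ^ 'n) \<times> (real ^ 'n)"
  proof -
    have "norm (fst y) \<le> (\<Sum>i\<in>UNIV. \<bar>fst y $ i\<bar>)" by (rule norm_le_l1_cart)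
    also have "\<dots> \<le> (\<Sum>i\<in>(UNIV::'n set). 1)" using that by (intro sum_mono) (auto simp: abs_le_iff less_imp_le intro: order_trans)
    finally have 1: "norm (fst y) \<le> CARD('n)" by simp
    have "norm (snd y) \<le> (\<Sum>i\<in>UNIV. \<bar>snd y $ i\<bar>)" by (rule norm_le_l1_cart)
    also have "\<dots> \<le> (\<Sum>i\<in>(UNIV::'n set). 1)" using that by (intro sum_mono) (auto simp: abs_le_iff less_imp_le intro: order_trans)
    finally have 2: "norm (snd y) \<le> CARD('n)" by simp
    show ?thesis using norm_Pair_le[of "fst y" "snd y"] 1 2 by simp
  qed
  have main: "\<exists>cell vol. cell_partition ((\<lambda>k. c *\<^sub>R A k) ` integer_points) cell vol (c * D)" if c: "0 < c" for c
  proof -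
    let ?L = "(\<lambda>k. c *\<^sub>R A k) ` integer_points"
    define y where "y = (\<lambda>z. (1 / c) *\<^sub>R I z)"
    have yl: "linear y" unfolding y_def using I by (intro linear_compose_scale_right) auto
    have yA: "y (c *\<^sub>R A k) = k" and Ay: "c *\<^sub>R A (y z) = z" for k z
      using c by (simp_all add: y_def linear_scale[OF I] linear_scale[OF A] IA AI)
    define cell where "cell = (\<lambda>z. c *\<^sub>R A (vec_floor (y z)))"
    have cL: "cell z \<in> ?L" for z unfolding cell_def using vec_floor_in by blast
    have cnt: "countable ?L" by (intro countable_image countable_integer_points)
    define Q where "Q = {z. \<forall>i. 0 \<le> fst (y z) $ i \<and> fst (y z) $ i < 1 \<and> 0 \<le> snd (y z) $ i \<and> snd (y z) $ i < 1}"
    have cell_iff: "cell z = l \<longleftrightarrow> z - l \<in> Q" if l: "l \<in> ?L" for z l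
    proof -
      obtain k where k: "k \<in> integer_points" "l = c *\<^sub>R A k" using l by auto
      have "cell z = l \<longleftrightarrow> vec_floor (y z) = k"
        unfolding cell_def k(2) using yA by metis
      also have "\<dots> \<longleftrightarrow> z - l \<in> Q"
        unfolding vec_floor_eq_iff[OF k(1)] Q_def by (simp add: linear_diff[OF yl] k(2) yA)
      finally show ?thesis .
    qed
    have yc: "continuous_on UNIV y" using yl by (simp add: linear_continuous_on linear_conv_bounded_linear)
    have Qm [measurable]: "Q \<in> sets borel"
    proof -
      have "Q = (\<Inter>i\<in>UNIV. {z. 0 \<le> fst (y z) $ i} \<inter> {z. fst (y z) $ i < 1} \<inter> ({z. 0 \<le> snd (y z) $ i} \<inter> {z. snd (y z) $ i < 1}))"
        by (auto simp: Q_def)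
      also have "\<dots> \<in> sets borel"
        by (intro sets.finite_INT sets.Int borel_closed borel_open closed_Collect_le open_Collect_less continuous_intros yc) auto
      finally show ?thesis .
    qed
    have near: "norm (z - cell z) \<le> c * D" for z
    proof -
      have "z - cell z \<in> Q" using cell_iff[OF cL, of z z] by simp
      then have "norm (y (z - cell z)) \<le> 2 * CARD('n)" by (intro unit) (auto simp: Q_def)
      then have "norm (A (y (z - cell z))) \<le> D"
        using a(2)[of "y (z - cell z)"] mult_left_mono[OF _ less_imp_le[OF a(1)]] unfolding D_def by (meson order_trans)
      then have "c * norm (A (y (z - cell z))) \<le> c * D" by (rule mult_left_mono) (use c in simp)
      moreover have "norm (z - cell z) = c * norm (A (y (z - cell z)))"
        using arg_cong[OF Ay[of "z - cell z"], of norm] c by simp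
      ultimately show ?thesis by (simp only:)
    qed
    have pre: "cell -` {l} = (\<lambda>z. z - l) -` Q" if "l \<in> ?L" for l
      using cell_iff[OF that] by auto
    have prem: "(\<lambda>z. z - l) -` Q \<in> sets borel" for l
      using measurable_sets[of "\<lambda>z. z - l" borel borel Q] Qm by simp
    have meas: "cell \<in> measurable borel (count_space ?L)"
      unfolding measurable_count_space_eq_countable[OF cnt] using cL pre prem by auto
    have vol_eq: "emeasure lborel (cell -` {l}) = emeasure lborel Q" if "l \<in> ?L" for l
    proof -
      have "(\<lambda>z. z - l) = (+) (- l)" by auto
      then have "emeasure lborel Q = emeasure (distr lborel borel (\<lambda>z. z - l)) Q"
        by (simp only: lborel_distr_plus)
      also have "\<dots> = emeasure lborel ((\<lambda>z. z - l) -` Q)"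
        using Qm by (subst emeasure_distr) auto
      finally show ?thesis using pre[OF that] by simp
    qed
    have "c *\<^sub>R A 0 \<in> ?L" by (rule imageI) (simp add: integer_points_def case_prod_unfold)
    then have "0 \<in> ?L" by (simp add: linear_0[OF A])
    then have Q0: "z \<in> Q \<Longrightarrow> norm z \<le> c * D" for z
      using near[of z] cell_iff[of 0 z] by simp
    have "emeasure lborel Q < \<infinity>"
      by (rule emeasure_bounded_finite) (unfold bounded_iff, use Q0 in blast)
    moreover have "emeasure lborel Q > 0"
    proof -
      define U where "U = (\<Inter>i\<in>UNIV. {z. 0 < fst (y z) $ i} \<inter> {z. fst (y z) $ i < 1} \<inter> ({z. 0 < snd (y z) $ i} \<inter> {z. snd (y z) $ i < 1}))"
      have "open U" unfolding U_def
        by (intro open_INT ballI open_Int open_Collect_less continuous_intros yc) auto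
      moreover have "c *\<^sub>R A ((\<chi> i. 1/2), (\<chi> i. 1/2)) \<in> U" by (simp add: U_def yA)
      ultimately obtain e where e: "0 < e" "ball (c *\<^sub>R A ((\<chi> i. 1/2), (\<chi> i. 1/2))) e \<subseteq> U"
        unfolding open_contains_ball by blast
      have "U \<subseteq> Q" by (auto simp: U_def Q_def less_imp_le)
      then have "emeasure lborel (ball (c *\<^sub>R A ((\<chi> i. 1/2), (\<chi> i. 1/2))) e) \<le> emeasure lborel Q"
        using e by (intro emeasure_mono) auto
      moreover have "emeasure lborel (ball (c *\<^sub>R A ((\<chi> i. 1/2), (\<chi> i. 1/2))) e) > 0"
        using content_ball_pos[OF e(1), of "c *\<^sub>R A ((\<chi> i. 1/2), (\<chi> i. 1/2))"]
        by (auto simp: measure_def enn2real_positive_iff zero_less_iff_neq_zero intro!: ccontr)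
      ultimately show ?thesis by simp
    qed
    ultimately have "0 < measure lborel Q" "emeasure lborel Q = ennreal (measure lborel Q)"
      by (simp_all add: measure_def enn2real_positive_iff)
    then show ?thesis
      using cnt meas near vol_eq unfolding cell_partition_def
      by (intro exI[of _ cell] exI[of _ "measure lborel Q"]) simp
  qed
  then show ?thesis using D by blast
qed

section \<open>The frame\<close>

lemma L2_nrm_eq_0:
  assumes "f \<in> L2_space" "L2_nrm f = 0"
  shows "AE t in lborel. f t = 0"
proof -
  have "(LINT t|lborel. (norm (f t))\<^sup>2) = 0" using assms(2) by (simp add: L2_nrm_def)
  then have "AE t in lborel. (norm (f t))\<^sup>2 = 0"
    using integral_nonneg_eq_0_iff_AE[OF L2_integrable[OF assms(1)]] by simp
  then show ?thesis by simp
qed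

lemma antidual_STFT_eq: "antidual_STFT g f z = f (tf_shift z g)"
  by (simp add: antidual_STFT_def tf_shift_def case_prod_unfold)

context tf_window
begin

lemma modulation_space_iff:
  assumes p: "1 \<le> p" and C: "0 \<le> C" and f: "f \<in> M1_antidual g\<^sub>0 r s"
  shows "f \<in> modulation_space g\<^sub>0 p r s \<and> modulation_norm g\<^sub>0 p r s f \<le> C
    \<longleftrightarrow> Lp_le lborel p (\<lambda>z. norm (f (tf_shift z g\<^sub>0)) * v z) C"
proof -
  have [measurable]: "antidual_STFT g\<^sub>0 f \<in> borel_measurable lborel"
    unfolding antidual_STFT_eq[abs_def] using antidual_STFT_other_window(1)[OF f g0_M1] by simp
  have "v \<in> borel_measurable lborel" by simp
  from weighted_Lp_iff[OF p C _ this, of "antidual_STFT g\<^sub>0 f"] f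
  show ?thesis by (simp add: modulation_space_def modulation_norm_def v_def[symmetric] antidual_STFT_eq)
qed

lemma modulation_norm_nonneg: "0 \<le> modulation_norm g\<^sub>0 p r s f"
  by (simp add: modulation_norm_def weighted_Lp_norm_nonneg)

lemma modulation_space_antidual: "f \<in> modulation_space g\<^sub>0 p r s \<Longrightarrow> f \<in> M1_antidual g\<^sub>0 r s"
  by (simp add: modulation_space_def)

lemma modulation_space_Lp:
  assumes p: "1 \<le> p" and f: "f \<in> modulation_space g\<^sub>0 p r s"
  shows "Lp_le lborel p (\<lambda>z. norm (f (tf_shift z g\<^sub>0)) * v z) (modulation_norm g\<^sub>0 p r s f)"
  using modulation_space_iff[OF p modulation_norm_nonneg modulation_space_antidual[OF f]] f by blast

lemma other_window_Lp:
  assumes p: "1 \<le> p" and e: "e \<in> M1_space g\<^sub>0 r s"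
  obtains d where "0 < d"
    "\<And>f C. f \<in> M1_antidual g\<^sub>0 r s \<Longrightarrow> 0 \<le> C \<Longrightarrow> Lp_le lborel p (\<lambda>z. norm (f (tf_shift z \<gamma>)) * v z) C
      \<Longrightarrow> Lp_le lborel p (\<lambda>z. norm (f (tf_shift z e)) * v z) (d * C)"
proof
  let ?W = "wint (\<lambda>z. norm (STFT e \<gamma> z))"
  show "0 < enn2real ?W + 1" by (simp add: add_nonneg_pos)
  have fin: "?W < \<infinity>" by (rule wint_STFT_M1[OF \<gamma> e])
  have "?W = ennreal (enn2real ?W)" using fin by simp
  also have "\<dots> \<le> ennreal (enn2real ?W + 1)" by (rule ennreal_leI) simp
  finally have W: "?W \<le> ennreal (enn2real ?W + 1)" .
  fix f C assume f: "f \<in> M1_antidual g\<^sub>0 r s" and C: "0 \<le> C" "Lp_le lborel p (\<lambda>z. norm (f (tf_shift z \<gamma>)) * v z) C"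
  show "Lp_le lborel p (\<lambda>z. norm (f (tf_shift z e)) * v z) ((enn2real ?W + 1) * C)"
  proof (rule weighted_Young[OF p C(2,1) _ _ W])
    show "(\<lambda>z. norm (f (tf_shift z \<gamma>))) \<in> borel_measurable borel"
      using moderate_measurable[OF antidual_moderate[OF f]] by measurable
    show "(\<lambda>z. ennreal (norm (STFT e \<gamma> z))) \<in> borel_measurable borel"
      using measurable_STFT[OF \<gamma>_L2 M1_L2[OF e]] by measurable
    show "(\<lambda>z. norm (f (tf_shift z e))) \<in> borel_measurable borel"
      using antidual_STFT_other_window(1)[OF f e] by measurable
    show "ennreal \<bar>norm (f (tf_shift w e))\<bar> \<le> (\<integral>\<^sup>+z. ennreal \<bar>norm (f (tf_shift z \<gamma>))\<bar> * ennreal (norm (STFT e \<gamma> (w - z))) \<partial>lborel)" for w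
      using antidual_STFT_other_window(2)[OF f e, of w] by simp
  qed (simp add: add_nonneg_pos)
qed

lemma zero_antidual: "(\<lambda>_. 0) \<in> M1_antidual g\<^sub>0 r s"
  by (auto simp: M1_antidual_def intro!: exI[of _ 0])

lemma add_antidual:
  assumes f: "f \<in> M1_antidual g\<^sub>0 r s" and k: "k \<in> M1_antidual g\<^sub>0 r s"
  shows "(\<lambda>h. f h + k h) \<in> M1_antidual g\<^sub>0 r s"
proof -
  obtain C where C: "\<forall>h\<in>M1_space g\<^sub>0 r s. norm (f h) \<le> C * M1_norm g\<^sub>0 r s h"
    using f unfolding M1_antidual_def by blast
  obtain D where D: "\<forall>h\<in>M1_space g\<^sub>0 r s. norm (k h) \<le> D * M1_norm g\<^sub>0 r s h"
    using k unfolding M1_antidual_def by blast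
  have "norm (f h + k h) \<le> (C + D) * M1_norm g\<^sub>0 r s h" if "h \<in> M1_space g\<^sub>0 r s" for h
    using norm_triangle_ineq[of "f h" "k h"] bspec[OF C that] bspec[OF D that] by (simp add: distrib_right)
  then have "\<exists>C. \<forall>h\<in>M1_space g\<^sub>0 r s. norm (f h + k h) \<le> C * M1_norm g\<^sub>0 r s h" by blast
  then show ?thesis
    using antidual_add[OF f] antidual_add[OF k] antidual_scale[OF f] antidual_scale[OF k] antidual_off[OF f] antidual_off[OF k]
    by (simp add: M1_antidual_def distrib_left)
qed

lemma scale_antidual:
  assumes f: "f \<in> M1_antidual g\<^sub>0 r s"
  shows "(\<lambda>h. a * f h) \<in> M1_antidual g\<^sub>0 r s"
proof -
  obtain C where C: "\<forall>h\<in>M1_space g\<^sub>0 r s. norm (f h) \<le> C * M1_norm g\<^sub>0 r s h"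
    using f unfolding M1_antidual_def by blast
  have "norm (a * f h) \<le> (norm a * C) * M1_norm g\<^sub>0 r s h" if "h \<in> M1_space g\<^sub>0 r s" for h
    using mult_left_mono[OF bspec[OF C that], of "norm a"] by (simp add: norm_mult mult.assoc)
  then have "\<exists>C. \<forall>h\<in>M1_space g\<^sub>0 r s. norm (a * f h) \<le> C * M1_norm g\<^sub>0 r s h" by blast
  then show ?thesis
    using antidual_add[OF f] antidual_scale[OF f] antidual_off[OF f]
    by (simp add: M1_antidual_def distrib_left mult_ac)
qed

lemma modulation_space_zero: "(\<lambda>_. 0) \<in> modulation_space g\<^sub>0 p r s" if p: "1 \<le> p"
proof -
  have "Lp_le lborel p (\<lambda>z. norm (0 :: complex) * v z) 0" by (simp add: Lp_le_def)
  then show ?thesis using modulation_space_iff[OF p _ zero_antidual, of 0] by simp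
qed

lemma modulation_space_add:
  assumes p: "1 \<le> p" and f: "f \<in> modulation_space g\<^sub>0 p r s" and k: "k \<in> modulation_space g\<^sub>0 p r s"
  shows "(\<lambda>h. f h + k h) \<in> modulation_space g\<^sub>0 p r s"
proof -
  let ?N = "modulation_norm g\<^sub>0 p r s"
  note fa = modulation_space_antidual[OF f] and ka = modulation_space_antidual[OF k]
  have "Lp_le lborel p (\<lambda>z. norm (f (tf_shift z g\<^sub>0)) * v z) (?N f + 1)"
    "Lp_le lborel p (\<lambda>z. norm (k (tf_shift z g\<^sub>0)) * v z) (?N k + 1)"
    using modulation_space_Lp[OF p f] modulation_space_Lp[OF p k]
    by (auto intro: Lp_le_mono modulation_norm_nonneg dest: Lp_leD)
  from Lp_le_add[OF sigma_finite_lborel p this] modulation_norm_nonneg[of p f] modulation_norm_nonneg[of p k]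
  have L: "Lp_le lborel p (\<lambda>z. norm (f (tf_shift z g\<^sub>0)) * v z + norm (k (tf_shift z g\<^sub>0)) * v z) (?N f + 1 + (?N k + 1))"
    by (simp add: add_nonneg_pos)
  have "Lp_le lborel p (\<lambda>z. norm (f (tf_shift z g\<^sub>0) + k (tf_shift z g\<^sub>0)) * v z) (?N f + 1 + (?N k + 1))"
  proof (rule Lp_le_mono[OF L])
    show "(\<lambda>z. norm (f (tf_shift z g\<^sub>0) + k (tf_shift z g\<^sub>0)) * v z) \<in> borel_measurable lborel"
      using antidual_STFT_other_window(1)[OF fa g0_M1] antidual_STFT_other_window(1)[OF ka g0_M1] by measurable
    fix z
    have "norm (f (tf_shift z g\<^sub>0) + k (tf_shift z g\<^sub>0)) * v z \<le> norm (f (tf_shift z g\<^sub>0)) * v z + norm (k (tf_shift z g\<^sub>0)) * v z"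
      unfolding distrib_right[symmetric] by (intro mult_right_mono norm_triangle_ineq) simp
    then show "\<bar>norm (f (tf_shift z g\<^sub>0) + k (tf_shift z g\<^sub>0)) * v z\<bar> \<le> \<bar>norm (f (tf_shift z g\<^sub>0)) * v z + norm (k (tf_shift z g\<^sub>0)) * v z\<bar>"
      by (simp add: abs_mult)
  qed (use modulation_norm_nonneg[of p f] modulation_norm_nonneg[of p k] in auto)
  then show ?thesis
    using modulation_space_iff[OF p _ add_antidual[OF fa ka], of "?N f + 1 + (?N k + 1)"]
      modulation_norm_nonneg[of p f] modulation_norm_nonneg[of p k] by simp
qed

lemma modulation_space_scale:
  assumes p: "1 \<le> p" and f: "f \<in> modulation_space g\<^sub>0 p r s"
  shows "(\<lambda>h. a * f h) \<in> modulation_space g\<^sub>0 p r s"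
proof -
  have "Lp_le lborel p (\<lambda>z. norm (a * f (tf_shift z g\<^sub>0)) * v z) (norm a * modulation_norm g\<^sub>0 p r s f)"
    using Lp_le_scale[OF modulation_space_Lp[OF p f] modulation_norm_nonneg, of "norm a"] by (simp add: norm_mult mult.assoc)
  then show ?thesis
    using modulation_space_iff[OF p _ scale_antidual[OF modulation_space_antidual[OF f], of a], of "norm a * modulation_norm g\<^sub>0 p r s f"]
      modulation_norm_nonneg[of p f] by simp
qed

end

lemma tf_shift_scale: "tf_shift z (\<lambda>t. c * f t) = (\<lambda>t. c * tf_shift z f t)"
  by (rule ext) (simp add: tf_shift_apply)

lemma (in tf_window) modulation_space_window:
  assumes p: "1 \<le> p"
  obtains d where "0 < d"
    "\<And>f. f \<in> modulation_space g\<^sub>0 p r s \<Longrightarrow> Lp_le lborel p (\<lambda>z. norm (f (tf_shift z \<gamma>)) * v z) (d * modulation_norm g\<^sub>0 p r s f)"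
proof -
  define a where "a = complex_of_real (1 / L2_nrm g\<^sub>0)"
  define \<gamma>0 where "\<gamma>0 = (\<lambda>t. a * g\<^sub>0 t)"
  have pos: "0 < L2_nrm g\<^sub>0" using g0_nz L2_nrm_nonneg[of g\<^sub>0] by linarith
  have na: "norm a = 1 / L2_nrm g\<^sub>0" using pos by (simp add: a_def norm_divide)
  have M: "\<gamma>0 \<in> M1_space g\<^sub>0 r s" unfolding \<gamma>0_def by (rule M1_scale[OF g0_M1])
  have "(L2_nrm \<gamma>0)\<^sup>2 = (norm a)\<^sup>2 * (L2_nrm g\<^sub>0)\<^sup>2"
    by (simp add: L2_nrm_sq \<gamma>0_def norm_mult power_mult_distrib)
  then have "(L2_nrm \<gamma>0)\<^sup>2 = 1\<^sup>2" using pos by (simp add: na power_divide)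
  then have n: "L2_nrm \<gamma>0 = 1" using power2_eq_imp_eq[of "L2_nrm \<gamma>0" 1] by simp
  interpret W0: tf_window r s v g\<^sub>0 \<gamma>0
    by unfold_locales (use g0 g0_nz M n in auto)
  obtain d where d: "0 < d"
    "\<And>f C. f \<in> M1_antidual g\<^sub>0 r s \<Longrightarrow> 0 \<le> C \<Longrightarrow> Lp_le lborel p (\<lambda>z. norm (f (tf_shift z \<gamma>0)) * v z) C
      \<Longrightarrow> Lp_le lborel p (\<lambda>z. norm (f (tf_shift z \<gamma>)) * v z) (d * C)"
    using W0.other_window_Lp[OF p \<gamma>] by blast
  show ?thesis
  proof (rule that[of "d * norm a"])
    show "0 < d * norm a" using d(1) pos by (simp add: na)
    fix f assume f: "f \<in> modulation_space g\<^sub>0 p r s"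
    note fa = modulation_space_antidual[OF f]
    have "norm (f (tf_shift z \<gamma>0)) = norm a * norm (f (tf_shift z g\<^sub>0))" for z
      unfolding \<gamma>0_def tf_shift_scale antidual_scale[OF fa M1_tf_shift[OF g0_M1]] by (simp add: norm_mult)
    then have "Lp_le lborel p (\<lambda>z. norm (f (tf_shift z \<gamma>0)) * v z) (norm a * modulation_norm g\<^sub>0 p r s f)"
      using Lp_le_scale[OF modulation_space_Lp[OF p f] modulation_norm_nonneg, of "norm a"] by (simp add: mult.assoc)
    from d(2)[OF fa _ this] show "Lp_le lborel p (\<lambda>z. norm (f (tf_shift z \<gamma>)) * v z) (d * norm a * modulation_norm g\<^sub>0 p r s f)"
      using modulation_norm_nonneg[of p f] by (simp add: mult.assoc)
  qed
qed

theorem (in tf_cells) banach_frame_cells: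
  assumes p: "1 \<le> p"
  shows "banach_frame (M1_space g\<^sub>0 r s) (modulation_space g\<^sub>0 p r s) (modulation_norm g\<^sub>0 p r s)
    (weighted_lp_space \<Lambda> v p) (weighted_lp_norm \<Lambda> v p) \<Lambda> (\<lambda>z. tf_shift z \<gamma>)"
proof -
  let ?B = "weighted_lp_space \<Lambda> v p" and ?NB = "weighted_lp_norm \<Lambda> v p"
  let ?X = "modulation_space g\<^sub>0 p r s" and ?N = "modulation_norm g\<^sub>0 p r s"
  let ?co = "coefficients \<Lambda> (\<lambda>z. tf_shift z \<gamma>)"
  note lp = countable_\<Lambda> v_pos p
  note B_norm = norm_on_weighted_lp[where w=v, OF lp, unfolded norm_on_def]
  obtain d1 where d1: "0 < d1"
    "\<And>f. f \<in> ?X \<Longrightarrow> Lp_le lborel p (\<lambda>z. norm (f (tf_shift z \<gamma>)) * v z) (d1 * ?N f)"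
    using modulation_space_window[OF p] by blast
  obtain d2 where d2: "0 < d2"
    "\<And>f C. f \<in> M1_antidual g\<^sub>0 r s \<Longrightarrow> 0 \<le> C \<Longrightarrow> Lp_le lborel p (\<lambda>z. norm (f (tf_shift z \<gamma>)) * v z) C
      \<Longrightarrow> Lp_le lborel p (\<lambda>z. norm (f (tf_shift z g\<^sub>0)) * v z) (d2 * C)"
    using other_window_Lp[OF p g0_M1] by blast
  define b where "b = V * (dB * d1) / vroot p"
  have b: "0 < b" unfolding b_def using V_ge_1 dB_pos d1(1) vroot_pos[of p] by simp
  have co: "?co f \<in> ?B \<and> ?NB (?co f) \<le> b * ?N f" if f: "f \<in> ?X" for f
  proof -
    note fa = modulation_space_antidual[OF f]
    have "Lp_le (count_space \<Lambda>) p (\<lambda>l. norm (f (tf_shift l \<gamma>)) * v l) (V * (dB * (d1 * ?N f)) / vroot p)"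
      using d1 modulation_norm_nonneg[of p f]
      by (intro sampling_Lp p antidual_moderate fa reproject_antidual d1(2) f) auto
    then have "Lp_le (count_space \<Lambda>) p (\<lambda>l. norm (?co f l) * v l) (b * ?N f)"
    proof (rule Lp_le_mono)
      show "0 \<le> V * (dB * (d1 * ?N f)) / vroot p"
        using V_ge_1 dB_pos d1(1) modulation_norm_nonneg[of p f] vroot_pos[of p]
        by (intro divide_nonneg_pos mult_nonneg_nonneg) auto
    qed (auto simp: coefficients_def b_def)
    then show ?thesis
      using weighted_lpI[where w=v, OF lp, where c="?co f" and C="b * ?N f"] b modulation_norm_nonneg[of p f]
      by (auto simp: coefficients_def)
  qed
  have sm: "moderate (step a)" if a: "a \<in> ?B" for a
  proof (rule step_moderate)
    fix l
    have "norm (a l) * 1 \<le> norm (a l) * v l" by (intro mult_left_mono v_ge_1) auto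
    also have "\<dots> \<le> ?NB a" by (rule weighted_lp_pointwise[where w=v, OF lp a])
    also have "\<dots> \<le> ?NB a * v l"
      using mult_left_mono[OF v_ge_1[of l] weighted_lp_norm_nonneg[where w=v, OF lp, where c=a]] by simp
    finally show "norm (a l) \<le> ?NB a * v l" by simp
  qed (rule weighted_lp_norm_nonneg[where w=v, OF lp])
  define d where "d = d2 * (dG * (2 * (dG * (V * vroot p))))"
  have d: "0 < d" unfolding d_def using d2(1) dG_pos V_ge_1 vroot_pos[of p] by simp
  have R: "reconstruct a \<in> ?X \<and> ?N (reconstruct a) \<le> d * ?NB a" if a: "a \<in> ?B" for a
  proof -
    have *: "reconstruct a \<in> ?X \<and> ?N (reconstruct a) \<le> d * (?NB a + e)" if e: "0 < e" for e
    proof -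
      let ?C = "?NB a + e"
      have C: "0 < ?C" using e weighted_lp_norm_nonneg[where w=v, OF lp, where c=a] by simp
      have "Lp_le (count_space \<Lambda>) p (\<lambda>l. norm (a l) * v l) ?C"
        using e by (intro Lp_le_mono[OF weighted_lp_Lp_le[where w=v, OF lp a]]) (auto intro: weighted_lp_norm_nonneg[where w=v, OF lp])
      then have "Lp_le lborel p (\<lambda>z. norm (step a z) * v z) (V * (vroot p * ?C))"
        using C by (intro step_Lp p) auto
      then have "Lp_le lborel p (\<lambda>z. norm (reconstruct a (tf_shift z \<gamma>)) * v z) (dG * (2 * (dG * (V * (vroot p * ?C)))))"
        using C V_ge_1 vroot_pos[of p] by (intro reconstruct_Lp p sm a) auto
      then have "Lp_le lborel p (\<lambda>z. norm (reconstruct a (tf_shift z g\<^sub>0)) * v z) (d2 * (dG * (2 * (dG * (V * (vroot p * ?C))))))"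
        using C V_ge_1 vroot_pos[of p] dG_pos by (intro d2(2) reconstruct_antidual sm a) auto
      then have "Lp_le lborel p (\<lambda>z. norm (reconstruct a (tf_shift z g\<^sub>0)) * v z) (d * ?C)"
        by (simp add: d_def mult.assoc)
      then show ?thesis
        using modulation_space_iff[OF p _ reconstruct_antidual[OF sm[OF a]], of "d * ?C"] C d by simp
    qed
    show ?thesis using *[of 1] le_mult_epsilon[OF d, of "?N (reconstruct a)" "?NB a"] * by simp
  qed
  have Rco: "reconstruct (?co f) = f" if "f \<in> ?X" for f
    by (rule reconstruct_coefficients[OF modulation_space_antidual[OF that]])
  have R0: "reconstruct (\<lambda>_. 0) = (\<lambda>_. 0)"
    using reconstruct_scale[OF sm[OF weighted_lp_zero(1)[where w=v, OF lp]], of 0] by (intro ext) simp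
  have co_add: "?co (\<lambda>h. f h + k h) = (\<lambda>l. ?co f l + ?co k l)"
    and co_scale: "?co (\<lambda>h. a * f h) = (\<lambda>l. a * ?co f l)" and co_0: "?co (\<lambda>_. 0) = (\<lambda>_. 0)" for f k a
    by (auto simp: coefficients_def)
  have N_le: "?N f \<le> d * ?NB (?co f)" if "f \<in> ?X" for f
    using R[of "?co f"] co[OF that] Rco[OF that] by simp
  show ?thesis
    unfolding banach_frame_def
  proof (intro conjI)
    show "banach_space_on ?B ?NB" by (rule banach_space_on_weighted_lp[where w=v, OF lp])
    show "\<forall>i\<in>\<Lambda>. tf_shift i \<gamma> \<in> M1_space g\<^sub>0 r s" by (intro ballI M1_tf_shift \<gamma>)
    show "\<forall>f\<in>?X. ?co f \<in> ?B" using co by blast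
    show "norm_on ?X (\<lambda>f. ?NB (?co f))"
      unfolding norm_on_def
    proof (intro conjI ballI allI)
      show "(\<lambda>_. 0) \<in> ?X" by (rule modulation_space_zero[OF p])
      fix f assume f: "f \<in> ?X"
      have cf: "?co f \<in> ?B" using co[OF f] by blast
      show "0 \<le> ?NB (?co f)" by (rule weighted_lp_norm_nonneg[where w=v, OF lp])
      show "?NB (?co f) = 0 \<longleftrightarrow> f = (\<lambda>_. 0)"
      proof
        assume "?NB (?co f) = 0"
        then have "?co f = (\<lambda>_. 0)" by (rule weighted_lp_norm_eq_0[where w=v, OF lp cf])
        then show "f = (\<lambda>_. 0)" using Rco[OF f] R0 by simp
      qed (simp add: co_0 weighted_lp_zero(2)[where w=v, OF lp])
      show "(\<lambda>h. a * f h) \<in> ?X" "?NB (?co (\<lambda>h. a * f h)) = norm a * ?NB (?co f)" for a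
        using modulation_space_scale[OF p f] weighted_lp_scale(2)[where w=v, OF lp cf] by (simp_all add: co_scale)
      fix k assume k: "k \<in> ?X"
      have ck: "?co k \<in> ?B" using co[OF k] by blast
      show "(\<lambda>h. f h + k h) \<in> ?X" "?NB (?co (\<lambda>h. f h + k h)) \<le> ?NB (?co f) + ?NB (?co k)"
        using modulation_space_add[OF p f k] weighted_lp_add(2)[where w=v, OF lp cf ck] by (simp_all add: co_add)
    qed
    show "equivalent_on ?X ?N (\<lambda>f. ?NB (?co f))"
      unfolding equivalent_on_def
    proof (rule exI[of _ "1 / d"], rule conjI, use d in simp, rule exI[of _ b], intro conjI b ballI)
      fix f assume f: "f \<in> ?X"
      show "1 / d * ?N f \<le> ?NB (?co f)" using N_le[OF f] d by (simp add: field_simps)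
      show "?NB (?co f) \<le> b * ?N f" using co[OF f] by blast
    qed
    show "\<exists>R. bounded_linear_on ?B ?NB ?X ?N R \<and> (\<forall>f\<in>?X. R (?co f) = f)"
    proof (intro exI[of _ reconstruct] conjI)
      show "\<forall>f\<in>?X. reconstruct (?co f) = f" using Rco by blast
      show "bounded_linear_on ?B ?NB ?X ?N reconstruct"
        unfolding bounded_linear_on_def
      proof (intro conjI ballI allI)
        fix a assume a: "a \<in> ?B"
        show "reconstruct a \<in> ?X" using R[OF a] by blast
        show "reconstruct (\<lambda>x. c * a x) = (\<lambda>y. c * reconstruct a y)" for c
          by (intro ext reconstruct_scale sm a)
        fix a' assume a': "a' \<in> ?B"
        show "reconstruct (\<lambda>x. a x + a' x) = (\<lambda>y. reconstruct a y + reconstruct a' y)"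
          by (intro ext reconstruct_add sm a a')
      next
        show "\<exists>C. \<forall>a\<in>?B. ?N (reconstruct a) \<le> C * ?NB a" using R by blast
      qed
    qed
  qed
qed

theorem proposition6p2p4:
  fixes r s :: real and p :: ennreal
    and g\<^sub>0 g :: "real ^ 'n \<Rightarrow> complex"
    and A :: "(real ^ 'n) \<times> (real ^ 'n) \<Rightarrow> (real ^ 'n) \<times> (real ^ 'n)"
  assumes "r \<ge> 0" and "s \<ge> 0" and "1 \<le> p"
    and "g\<^sub>0 \<in> window_class r s" and "\<not> (AE t in lborel. g\<^sub>0 t = 0)"
    and "g \<in> M1_space g\<^sub>0 r s" and "Lp_norm lborel 2 g = 1"
    and "linear A" and "bij A"
  shows "\<exists>c>0. let \<Lambda> = (\<lambda>k. c *\<^sub>R A k) ` integer_points in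
    banach_frame (M1_space g\<^sub>0 r s)
      (modulation_space g\<^sub>0 p r s) (modulation_norm g\<^sub>0 p r s)
      (weighted_lp_space \<Lambda> (poly_weight r s) p) (weighted_lp_norm \<Lambda> (poly_weight r s) p)
      \<Lambda> (\<lambda>(x, \<omega>). modulation \<omega> (translation x g))"
proof -
  define v :: "(real ^ 'n) \<times> (real ^ 'n) \<Rightarrow> real" where "v = poly_weight r s"
  have nz: "L2_nrm g\<^sub>0 \<noteq> 0"
    using L2_nrm_eq_0[of g\<^sub>0] assms(4,5) by (auto simp: window_class_def)
  interpret tf_window r s v g\<^sub>0 g
    by unfold_locales (use assms nz in \<open>auto simp: v_def Lp_norm_2\<close>)
  have fin: "x \<le> ennreal (enn2real x + 1)" if "x < \<infinity>" for x :: ennreal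
  proof -
    have "x = ennreal (enn2real x)" using that by simp
    also have "\<dots> \<le> ennreal (enn2real x + 1)" by (rule ennreal_leI) simp
    finally show ?thesis .
  qed
  obtain \<delta> B where B: "0 < \<delta>" "B \<in> borel_measurable borel" "wint B < \<infinity>"
    "\<And>x u. norm u \<le> \<delta> \<Longrightarrow> ennreal (norm (G (x + u))) \<le> B x"
    using G_majorant by blast
  define dG where "dG = enn2real (wint (\<lambda>z. norm (G z))) + 1"
  have dG: "0 < dG" "wint (\<lambda>z. norm (G z)) \<le> ennreal dG"
    unfolding dG_def using fin[OF wint_G] by (simp_all add: add_nonneg_pos)
  have e: "0 < 1 / (2 * dG)" using dG(1) by simp
  obtain \<eta> N where N: "0 < \<eta>" "\<eta> \<le> \<delta>" "N \<in> borel_measurable borel" "wint N \<le> ennreal (1 / (2 * dG))"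
    "\<And>x u u'. norm u \<le> \<eta> \<Longrightarrow> norm u' \<le> \<eta> \<Longrightarrow> ennreal (norm (K (x + u') u - K (x + u') 0)) \<le> N x"
    by (rule oscillation_kernel[OF e B(1)]) (rule that; blast)
  obtain V where V: "1 \<le> V" "\<And>z. norm z \<le> \<eta> \<Longrightarrow> v z \<le> V" by (rule v_bounded_cball) blast
  obtain D where D: "0 < D"
    "\<forall>c>0. \<exists>cell vol. cell_partition ((\<lambda>k. c *\<^sub>R A k) ` integer_points) cell vol (c * D)"
    using lattice_cells[OF assms(8,9)] by blast
  define c where "c = \<eta> / D"
  have c: "0 < c" "c * D = \<eta>" using D(1) N(1) by (simp_all add: c_def)
  define \<Lambda> where "\<Lambda> = (\<lambda>k. c *\<^sub>R A k) ` integer_points"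
  obtain cell vol where cell: "cell_partition \<Lambda> cell vol \<eta>"
    using D(2) c unfolding \<Lambda>_def by metis
  interpret tf_cells r s v g\<^sub>0 g \<Lambda> cell \<eta> vol dG "1 / (2 * dG)" "enn2real (wint B) + 1" V N B
  proof unfold_locales
    show "wint B \<le> ennreal (enn2real (wint B) + 1)" by (rule fin[OF B(3)])
    show "ennreal (norm (G (x + u))) \<le> B x" if "norm u \<le> \<eta>" for u x using B(4) that N(2) by simp
    show "0 < enn2real (wint B) + 1" by (simp add: add_nonneg_pos)
  qed (use cell[unfolded cell_partition_def] N B dG V in \<open>auto\<close>)
  have eq: "(\<lambda>z. tf_shift z g) = (\<lambda>(x, \<omega>). modulation \<omega> (translation x g))"
    by (auto simp: tf_shift_def)
  show ?thesis
    using banach_frame_cells[OF assms(3)] c(1)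
    unfolding eq Let_def v_def \<Lambda>_def by blast
qed

end
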